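(* Let $N=\sum_{i\ge1}\delta_{X_i}$ be a $B_4$-mixing point process on $\mathbb{R}^d$ with intensity $\lambda>0$, let $(W_n)$ be a convex averaging sequence, and suppose that $$\frac{N(W_n)-\lambda|W_n|}{\sqrt{|W_n|}}\ \xrightarrow[n\to\infty]{d}\ \mathcal N(0,\sigma^2)\qquad\text{with}\qquad \sigma^2=\lambda\bigl(1+\gamma^{(2)}_{red}(\mathbb{R}^d)\bigr).$$ Let $\alpha\in(0,1)$ be such that $c_n^{\alpha}/\varrho(W_n)\to0$ as $n\to\infty$. Then for every fixed $r\ge0$, $$\Delta^{(\alpha)}_{B,n}(r)\ \xrightarrow[n\to\infty]{d}\ G_B(r):=2\lambda|B|r^d\,\mathcal N(0,\sigma^2),$$ and for every $k\ge1$ and all fixed $r_1,\dots,r_k\ge0$, $$\bigl(\Delta^{(\alpha)}_{B,n}(r_i)\bigr)_{i=1}^k\ \xrightarrow[n\to\infty]{d}\ \bigl(G_B(r_i)\bigr)_{i=1}^k ,$$ where in $G_B(r)=2\lambda|B|r^d\,\mathcal N(0,\sigma^2)$ the same Gaussian random variable is used for all $r$.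
   Context: $|\cdot|$ is Lebesgue measure on $\mathbb{R}^d$ (or absolute value), $\mathcal N(0,\tau^2)$ a centered Gaussian random variable with variance $\tau^2$, $\xrightarrow{d}$ convergence in distribution, $\sum^{\ne}$ a sum over tuples of pairwise distinct indices. Point processes. $N=\sum_{i\ge1}\delta_{X_i}$ is a simple point process on $\mathbb{R}^d$ with intensity $\lambda=\mathbf E N([0,1)^d)>0$. Its $k$-th factorial moment measure is $\alpha^{(k)}(A_1\times\dots\times A_k)=\mathbf E\sum^{\ne}_{i_1,\dots,i_k\ge1}\mathbf 1_{A_1}(X_{i_1})\cdots\mathbf 1_{A_k}(X_{i_k})$. $N$ is $k$-th order stationary if $\mathbf E N^k([0,1)^d)<\infty$ and, for $j=1,\dots,k$, $\alpha^{(j)}$ is invariant under diagonal shifts $A_1\times\dots\times A_j\mapsto(A_1+x)\times\dots\times(A_j+x)$. The $k$-th factorial cumulant measure is the (locally finite) signed measure $\gamma^{(k)}(A_1\times\dots\times A_k)=\sum_{j=1}^k(-1)^{j-1}(j-1)!\sum_{K_1\cup\dots\cup K_j=\{1,\dots,k\}}\prod_{i=1}^j\alpha^{(\#K_i)}(\times_{l\in K_i}A_l)$, the inner sum being over partitions into $j$ disjoint non-empty subsets. The reduced measures $\alpha^{(k)}_{red},\gamma^{(k)}_{red}$ on $\mathbb{R}^{d(k-1)}$ are defined by $\alpha^{(k)}(A_1\times\dots\times A_k)=\lambda\int_{A_k}\alpha^{(k)}_{red}((A_1-x)\times\dots\times(A_{k-1}-x))\,dx$ and likewise for $\gamma^{(k)}$;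 in particular $\gamma^{(2)}_{red}(\cdot)=\alpha^{(2)}_{red}(\cdot)-\lambda|\cdot|$. $\|\gamma^{(k)}_{red}\|_{var}$ is the total variation on $\mathbb{R}^{d(k-1)}$. $N$ is $B_4$-mixing if it is fourth-order stationary and $\|\gamma^{(j)}_{red}\|_{var}<\infty$ for $j=2,3,4$. Windows and $B$. A convex averaging sequence $(W_n)$ is an increasing sequence of convex compact sets $W_n\subset\mathbb{R}^d$ with $\varrho(W_n):=\sup\{r>0: x+rB_e\subseteq W_n\text{ for some }x\in W_n\}\to\infty$, where $B_e$ is the closed Euclidean unit ball. Put $c_n:=|W_n|^{1/d}$. $B\subset\mathbb{R}^d$ is a fixed compact convex set, symmetric about the origin, with the origin as an interior point. $K$-function and estimator. $K_B(r):=\lambda^{-1}\alpha^{(2)}_{red}(rB)$ for $r\ge0$, $$(\widehat{\lambda^2K_B})_n(r):=\sum^{\ne}_{i,j\ge1}\frac{\mathbf 1_{W_n}(X_i)\mathbf 1_{W_n}(X_j)\mathbf 1_{rB}(X_j-X_i)}{|(W_n-X_i)\cap(W_n-X_j)|},$$ $$\Delta^{(\alpha)}_{B,n}(r):=|W_n|^{1/2-\alpha}\bigl((\widehat{\lambda^2K_B})_n(c_n^\alpha r)-\lambda^2K_B(c_n^\alpha r)\bigr).$$ *)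

theory Defs
  imports "HOL-Probability.Probability"
begin

section \<open>Point processes\<close>

text \<open>
  A point process on a probability space \<open>M\<close> is given by a measurable enumeration of its atoms:
  in the realisation \<open>\<omega>\<close> the points are \<open>X i \<omega>\<close> with \<open>i \<in> J \<omega>\<close>. The random index set \<open>J \<omega>\<close>
  only serves to admit realisations with finitely many points.
\<close>

definition atom_measure ::
  "(nat \<Rightarrow> 'w \<Rightarrow> 'a::euclidean_space) \<Rightarrow> ('w \<Rightarrow> nat set) \<Rightarrow> 'w \<Rightarrow> 'a measure" where
  "atom_measure X J \<omega> = distr (count_space (J \<omega>)) borel (\<lambda>i. X i \<omega>)"

definition simple_point_process ::
  "'w measure \<Rightarrow> (nat \<Rightarrow> 'w \<Rightarrow> 'a::euclidean_space) \<Rightarrow> ('w \<Rightarrow> nat set) \<Rightarrow> bool" where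
  "simple_point_process M X J \<longleftrightarrow>
     prob_space M \<and>
     (\<forall>i. X i \<in> borel_measurable M) \<and>
     (\<forall>i. {\<omega> \<in> space M. i \<in> J \<omega>} \<in> sets M) \<and>
     (AE \<omega> in M. inj_on (\<lambda>i. X i \<omega>) (J \<omega>)) \<and>
     (AE \<omega> in M. \<forall>C. compact C \<longrightarrow> finite {i \<in> J \<omega>. X i \<omega> \<in> C})"

definition unit_cube :: "'a::euclidean_space set" where
  "unit_cube = {x. \<forall>b\<in>Basis. 0 \<le> x \<bullet> b \<and> x \<bullet> b < 1}"

definition intensity ::
  "'w measure \<Rightarrow> (nat \<Rightarrow> 'w \<Rightarrow> 'a::euclidean_space) \<Rightarrow> ('w \<Rightarrow> nat set) \<Rightarrow> real" where
  "intensity M X J = enn2real (\<integral>\<^sup>+\<omega>. emeasure (atom_measure X J \<omega>) unit_cube \<partial>M)"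

subsection \<open>Factorial moment and cumulant measures\<close>

text \<open>
  The factorial moment measures are given by their values on measurable rectangles. Instead of
  \<open>{1..k}\<close> an arbitrary finite set \<open>K\<close> of coordinates is allowed, so that
  \<open>factorial_moment M X J K A\<close> is the value of the factorial moment measure of order \<open>card K\<close>
  on the product of the sets \<open>A l\<close> with \<open>l \<in> K\<close>.
\<close>

definition factorial_moment ::
  "'w measure \<Rightarrow> (nat \<Rightarrow> 'w \<Rightarrow> 'a::euclidean_space) \<Rightarrow> ('w \<Rightarrow> nat set) \<Rightarrow>
   nat set \<Rightarrow> (nat \<Rightarrow> 'a set) \<Rightarrow> ennreal" where
  "factorial_moment M X J K A =
     (\<integral>\<^sup>+\<omega>. (\<integral>\<^sup>+\<iota>. (\<Prod>l\<in>K. indicator (A l) (X (\<iota> l) \<omega>))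
        \<partial>count_space {\<iota> \<in> K \<rightarrow>\<^sub>E J \<omega>. inj_on \<iota> K}) \<partial>M)"

definition kth_order_stationary ::
  "'w measure \<Rightarrow> (nat \<Rightarrow> 'w \<Rightarrow> 'a::euclidean_space) \<Rightarrow> ('w \<Rightarrow> nat set) \<Rightarrow> nat \<Rightarrow> bool" where
  "kth_order_stationary M X J k \<longleftrightarrow>
     (\<integral>\<^sup>+\<omega>. emeasure (atom_measure X J \<omega>) unit_cube ^ k \<partial>M) < \<infinity> \<and>
     (\<forall>j\<in>{1..k}. \<forall>A x. (\<forall>l\<in>{1..j}. A l \<in> sets borel) \<longrightarrow>
        factorial_moment M X J {1..j} (\<lambda>l. (\<lambda>y. y + x) ` A l) =
        factorial_moment M X J {1..j} A)"

text \<open>Meaningful for bounded Borel sets \<open>A 1, \<dots>, A k\<close> only.\<close>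

definition factorial_cumulant ::
  "'w measure \<Rightarrow> (nat \<Rightarrow> 'w \<Rightarrow> 'a::euclidean_space) \<Rightarrow> ('w \<Rightarrow> nat set) \<Rightarrow>
   nat \<Rightarrow> (nat \<Rightarrow> 'a set) \<Rightarrow> real" where
  "factorial_cumulant M X J k A =
     (\<Sum>j=1..k. (- 1) ^ (j - 1) * fact (j - 1) *
        (\<Sum>P\<in>{P. partition_on {1..k} P \<and> card P = j}.
           \<Prod>K\<in>P. enn2real (factorial_moment M X J K A)))"

subsection \<open>Reduced measures\<close>

text \<open>
  The reduced measures of order \<open>k\<close> live on the space of tuples indexed by \<open>{1..<k}\<close>.
  For a process that is stationary of order \<open>k\<close> with positive intensity, the disintegration
  determines them uniquely, so the choice operator below makes no actual choice.
\<close>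

abbreviation tuples :: "nat \<Rightarrow> (nat \<Rightarrow> 'a::euclidean_space) measure" where
  "tuples k \<equiv> (\<Pi>\<^sub>M l\<in>{1..<k}. borel)"

abbreviation shifted_box :: "nat \<Rightarrow> (nat \<Rightarrow> 'a::euclidean_space set) \<Rightarrow> 'a \<Rightarrow> (nat \<Rightarrow> 'a) set" where
  "shifted_box k A x \<equiv> (\<Pi>\<^sub>E l\<in>{1..<k}. (\<lambda>y. y - x) ` A l)"

definition is_reduced_moment ::
  "'w measure \<Rightarrow> (nat \<Rightarrow> 'w \<Rightarrow> 'a::euclidean_space) \<Rightarrow> ('w \<Rightarrow> nat set) \<Rightarrow>
   nat \<Rightarrow> (nat \<Rightarrow> 'a) measure \<Rightarrow> bool" where
  "is_reduced_moment M X J k \<mu> \<longleftrightarrow>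
     sets \<mu> = sets (tuples k) \<and>
     (\<forall>A. (\<forall>l\<in>{1..k}. A l \<in> sets borel) \<longrightarrow>
        factorial_moment M X J {1..k} A =
        ennreal (intensity M X J) * (\<integral>\<^sup>+x\<in>A k. emeasure \<mu> (shifted_box k A x) \<partial>lborel))"

definition reduced_moment ::
  "'w measure \<Rightarrow> (nat \<Rightarrow> 'w \<Rightarrow> 'a::euclidean_space) \<Rightarrow> ('w \<Rightarrow> nat set) \<Rightarrow>
   nat \<Rightarrow> (nat \<Rightarrow> 'a) measure" where
  "reduced_moment M X J k = (SOME \<mu>. is_reduced_moment M X J k \<mu>)"

text \<open>
  A locally finite signed measure is represented by its Jordan decomposition, the pair
  \<open>(P, Q)\<close> of its positive and negative parts. Its total variation is then the total mass
  of \<open>P + Q\<close>.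
\<close>

definition mutually_singular :: "'b measure \<Rightarrow> 'b measure \<Rightarrow> bool" where
  "mutually_singular P Q \<longleftrightarrow>
     (\<exists>D\<in>sets P. emeasure P D = 0 \<and> emeasure Q (space Q - D) = 0)"

definition signed_value :: "'b measure \<times> 'b measure \<Rightarrow> 'b set \<Rightarrow> real" where
  "signed_value G S = measure (fst G) S - measure (snd G) S"

definition total_variation :: "'b measure \<times> 'b measure \<Rightarrow> ennreal" where
  "total_variation G = emeasure (fst G) (space (fst G)) + emeasure (snd G) (space (snd G))"

definition is_reduced_cumulant ::
  "'w measure \<Rightarrow> (nat \<Rightarrow> 'w \<Rightarrow> 'a::euclidean_space) \<Rightarrow> ('w \<Rightarrow> nat set) \<Rightarrow>
   nat \<Rightarrow> (nat \<Rightarrow> 'a) measure \<times> (nat \<Rightarrow> 'a) measure \<Rightarrow> bool" where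
  "is_reduced_cumulant M X J k G \<longleftrightarrow>
     sets (fst G) = sets (tuples k) \<and> sets (snd G) = sets (tuples k) \<and>
     mutually_singular (fst G) (snd G) \<and>
     (\<forall>C. compact C \<longrightarrow> emeasure (fst G) (\<Pi>\<^sub>E l\<in>{1..<k}. C) < \<infinity> \<and>
                        emeasure (snd G) (\<Pi>\<^sub>E l\<in>{1..<k}. C) < \<infinity>) \<and>
     (\<forall>A. (\<forall>l\<in>{1..k}. A l \<in> sets borel \<and> bounded (A l)) \<longrightarrow>
        factorial_cumulant M X J k A =
        intensity M X J * (LINT x:A k|lborel. signed_value G (shifted_box k A x)))"

definition reduced_cumulant ::
  "'w measure \<Rightarrow> (nat \<Rightarrow> 'w \<Rightarrow> 'a::euclidean_space) \<Rightarrow> ('w \<Rightarrow> nat set) \<Rightarrow>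
   nat \<Rightarrow> (nat \<Rightarrow> 'a) measure \<times> (nat \<Rightarrow> 'a) measure" where
  "reduced_cumulant M X J k = (SOME G. is_reduced_cumulant M X J k G)"

text \<open>
  The first conjunct in the scope of \<open>j\<close> says that the chosen pair is indeed the reduced cumulant
  measure, i.e. that the latter exists.
\<close>

definition B4_mixing ::
  "'w measure \<Rightarrow> (nat \<Rightarrow> 'w \<Rightarrow> 'a::euclidean_space) \<Rightarrow> ('w \<Rightarrow> nat set) \<Rightarrow> bool" where
  "B4_mixing M X J \<longleftrightarrow>
     kth_order_stationary M X J 4 \<and>
     (\<forall>j\<in>{2, 3, 4}. is_reduced_cumulant M X J j (reduced_cumulant M X J j) \<and>
        total_variation (reduced_cumulant M X J j) < \<infinity>)"

section \<open>Observation windows\<close>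

definition inradius :: "'a::euclidean_space set \<Rightarrow> real" where
  "inradius W = Sup {r. 0 < r \<and> (\<exists>x\<in>W. cball x r \<subseteq> W)}"

definition convex_averaging :: "(nat \<Rightarrow> 'a::euclidean_space set) \<Rightarrow> bool" where
  "convex_averaging W \<longleftrightarrow>
     incseq W \<and> (\<forall>n. convex (W n) \<and> compact (W n)) \<and>
     filterlim (\<lambda>n. inradius (W n)) at_top sequentially"

definition window_scale :: "'a::euclidean_space set \<Rightarrow> real" where
  "window_scale W = measure lborel W powr (1 / real DIM('a))"

section \<open>The K-function and its estimator\<close>

definition K_function ::
  "'w measure \<Rightarrow> (nat \<Rightarrow> 'w \<Rightarrow> 'a::euclidean_space) \<Rightarrow> ('w \<Rightarrow> nat set) \<Rightarrow>
   'a set \<Rightarrow> real \<Rightarrow> real" where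
  "K_function M X J B r =
     measure (reduced_moment M X J 2) (\<Pi>\<^sub>E l\<in>{1..<2}. (*\<^sub>R) r ` B) / intensity M X J"

definition K_estimator ::
  "(nat \<Rightarrow> 'w \<Rightarrow> 'a::euclidean_space) \<Rightarrow> ('w \<Rightarrow> nat set) \<Rightarrow>
   'a set \<Rightarrow> 'a set \<Rightarrow> real \<Rightarrow> 'w \<Rightarrow> real" where
  "K_estimator X J B W r \<omega> =
     (\<Sum>\<^sub>\<infinity>(i, j)\<in>{(i, j). i \<in> J \<omega> \<and> j \<in> J \<omega> \<and> i \<noteq> j}.
        indicator W (X i \<omega>) * indicator W (X j \<omega>) * indicator ((*\<^sub>R) r ` B) (X j \<omega> - X i \<omega>) /
        measure lborel ((\<lambda>y. y - X i \<omega>) ` W \<inter> (\<lambda>y. y - X j \<omega>) ` W))"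

definition K_deviation ::
  "'w measure \<Rightarrow> (nat \<Rightarrow> 'w \<Rightarrow> 'a::euclidean_space) \<Rightarrow> ('w \<Rightarrow> nat set) \<Rightarrow>
   'a set \<Rightarrow> real \<Rightarrow> 'a set \<Rightarrow> real \<Rightarrow> 'w \<Rightarrow> real" where
  "K_deviation M X J B \<alpha> W r \<omega> =
     measure lborel W powr (1 / 2 - \<alpha>) *
     (K_estimator X J B W (window_scale W powr \<alpha> * r) \<omega> -
      (intensity M X J)\<^sup>2 * K_function M X J B (window_scale W powr \<alpha> * r))"

section \<open>Convergence in distribution\<close>

text \<open>The scaling form covers the degenerate case \<open>v = 0\<close>, the unit mass at \<open>0\<close>.\<close>

definition centered_normal :: "real \<Rightarrow> real measure" where
  "centered_normal v = distr std_normal_distribution borel (\<lambda>z. sqrt v * z)"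

text \<open>Counterpart of \<open>weak_conv_m\<close> for distributions that need not live on the real line.\<close>

definition weak_conv_joint :: "(nat \<Rightarrow> 'b::topological_space measure) \<Rightarrow> 'b measure \<Rightarrow> bool" where
  "weak_conv_joint L_seq L \<longleftrightarrow>
     (\<forall>f :: 'b \<Rightarrow> real. continuous_on UNIV f \<and> bounded (range f) \<longrightarrow>
        (\<lambda>n. integral\<^sup>L (L_seq n) f) \<longlonglongrightarrow> integral\<^sup>L L f)"

end

theory Submission
  imports Defs
begin

text \<open>
  With $V = |W_n|$, $D = c_n^\alpha r B$ and $f(x, y)$ the edge-corrected indicator of $y - x \in D$, the
  estimator is the double sum of $f$ over pairs of distinct points in $W_n$, and its mean is exactly
  $\lambda^2 K_B(c_n^\alpha r)$ once $D$ is small compared with the inradius. Subtract from the double sum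
  its projection, the linear statistic with weight $2 \lambda \int_{W_n} f(x, y)\, dy$. Expanding the factorial
  moment measures up to order four into products of reduced cumulants, every term of leading order in the
  variance of the difference cancels; the remaining ones are $O((1 + |D|) / V)$, because each
  reduced cumulant has finite total variation. Away from the boundary the weight equals
  $2 \lambda |D| / V$ up to a factor tending to one, so the projection may be replaced by a multiple of
  $N(W_n)$. Hence $\Delta^{(\alpha)}_{B,n}(r)$ differs in $L^2$ by $o(1)$ from
  $2 \lambda |B| r^d (N(W_n) - \lambda V) / \sqrt{V}$, for every $r$ with the same normalised count, and
  Slutsky's theorem finishes the proof.
\<close>

section \<open>Functionals on bounded Borel functions\<close>

text \<open>Factorial moments and reduced cumulants are specified on boxes only, whereas the
  edge-corrected weight is not a product and products of signed cumulants have to be integrated.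
  Signed measures are therefore replaced by linear functionals on bounded Borel functions that
  respect bounded pointwise limits. Such a functional is fixed by its values on boxes, so each
  moment-cumulant identity reduces to the combinatorics of set partitions. Working inside a bounded
  window, where the count has a finite fourth moment, keeps all functionals finite. The factor 2 in
  the projection reflects the two positions of a point in a pair. The terms it removes are of order
  \<open>|D|^2 / V\<close>, which is order one after normalisation. In those left over, an
  integration over \<open>D\<close> is replaced by the finite mass of a cumulant or lost to
  coincident points, which saves a factor \<open>|D|\<close>. Replacing the projection by the count
  gains no power of the volume: it relies on the edge effect vanishing, which is what the assumption
  on the inradius provides.\<close>

definition bounded_borel :: "('b::topological_space \<Rightarrow> real) \<Rightarrow> bool" where
  "bounded_borel F \<longleftrightarrow> F \<in> borel_measurable borel \<and> (\<exists>C. \<forall>x. \<bar>F x\<bar> \<le> C)"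

lemma bounded_borelI: "F \<in> borel_measurable borel \<Longrightarrow> (\<And>x. \<bar>F x\<bar> \<le> C) \<Longrightarrow> bounded_borel F"
  by (auto simp: bounded_borel_def)

lemma bounded_borel_measurable [measurable_dest]: "bounded_borel F \<Longrightarrow> F \<in> borel_measurable borel"
  by (auto simp: bounded_borel_def)

lemma bounded_borelE:
  assumes "bounded_borel F" obtains C where "C \<ge> 0" "\<And>x. \<bar>F x\<bar> \<le> C"
  using assms unfolding bounded_borel_def by (meson abs_ge_zero order_trans)

lemma bounded_borel_add:
  assumes "bounded_borel F" "bounded_borel G" shows "bounded_borel (\<lambda>x. F x + G x)"
proof -
  obtain C D where "\<And>x. \<bar>F x\<bar> \<le> C" "\<And>x. \<bar>G x\<bar> \<le> D" using assms bounded_borelE by metis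
  then have "\<bar>F x + G x\<bar> \<le> C + D" for x
    using abs_triangle_ineq[of "F x" "G x"] by (smt (verit))
  with assms show ?thesis by (intro bounded_borelI) auto
qed

lemma bounded_borel_mult:
  assumes "bounded_borel F" "bounded_borel G" shows "bounded_borel (\<lambda>x. F x * G x)"
proof -
  obtain C D where "C \<ge> 0" "\<And>x. \<bar>F x\<bar> \<le> C" "\<And>x. \<bar>G x\<bar> \<le> D" using assms bounded_borelE by metis
  then have "\<bar>F x * G x\<bar> \<le> C * D" for x by (simp add: abs_mult mult_mono)
  with assms show ?thesis by (intro bounded_borelI) auto
qed

lemma bounded_borel_const: "bounded_borel (\<lambda>_. c)"
  by (rule bounded_borelI[of _ "\<bar>c\<bar>"]) auto

lemma bounded_borel_cmult: "bounded_borel F \<Longrightarrow> bounded_borel (\<lambda>x. c * F x)"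
  by (intro bounded_borel_mult bounded_borel_const)

lemma bounded_borel_uminus: "bounded_borel F \<Longrightarrow> bounded_borel (\<lambda>x. - F x)"
  using bounded_borel_cmult[of F "-1"] by simp

lemma bounded_borel_diff:
  assumes "bounded_borel F" "bounded_borel G" shows "bounded_borel (\<lambda>x. F x - G x)"
  using bounded_borel_add[OF assms(1) bounded_borel_uminus[OF assms(2)]] by simp

lemma bounded_borel_indicator: "A \<in> sets borel \<Longrightarrow> bounded_borel (indicator A)"
  by (rule bounded_borelI[of _ 1]) (auto simp: indicator_def)

lemma bounded_borel_compose:
  assumes "bounded_borel F" "T \<in> borel_measurable borel" shows "bounded_borel (\<lambda>x. F (T x))"
  using assms unfolding bounded_borel_def by auto

lemma bounded_borel_Pair:
  fixes F :: "'b::second_countable_topology \<times> 'c::second_countable_topology \<Rightarrow> real"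
  assumes "bounded_borel F" shows "bounded_borel (\<lambda>y. F (x, y))"
  by (rule bounded_borel_compose[OF assms]) simp

lemma integrable_bounded_borel:
  fixes F :: "'b::topological_space \<Rightarrow> real"
  assumes "finite_measure M" "bounded_borel F" "sets M = sets borel" shows "integrable M F"
proof -
  interpret finite_measure M by fact
  note [measurable_cong] = assms(3)
  obtain C where "\<And>x. \<bar>F x\<bar> \<le> C" using assms(2) bounded_borelE by metis
  with assms(2) show ?thesis by (intro integrable_const_bound[of _ C]) auto
qed

text \<open>Models integration against a finite signed measure. The third clause plays the role of
  countable additivity: it is dominated convergence for uniformly bounded sequences. Since the
  domain is the full function space, linearity is demanded only for bounded Borel arguments.\<close>

definition bounded_functional :: "(('b::second_countable_topology \<Rightarrow> real) \<Rightarrow> real) \<Rightarrow> bool" where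
  "bounded_functional L \<longleftrightarrow>
     (\<forall>F G. bounded_borel F \<longrightarrow> bounded_borel G \<longrightarrow> L (\<lambda>x. F x + G x) = L F + L G) \<and>
     (\<forall>c F. bounded_borel F \<longrightarrow> L (\<lambda>x. c * F x) = c * L F) \<and>
     (\<forall>Fn F C. (\<forall>n::nat. Fn n \<in> borel_measurable borel) \<longrightarrow> (\<forall>n x. \<bar>Fn n x\<bar> \<le> C) \<longrightarrow>
        (\<forall>x. (\<lambda>n. Fn n x) \<longlonglongrightarrow> F x) \<longrightarrow> (\<lambda>n. L (Fn n)) \<longlonglongrightarrow> L F)"

lemma bounded_functionalD:
  assumes "bounded_functional L"
  shows "\<And>F G. bounded_borel F \<Longrightarrow> bounded_borel G \<Longrightarrow> L (\<lambda>x. F x + G x) = L F + L G"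
    and "\<And>c F. bounded_borel F \<Longrightarrow> L (\<lambda>x. c * F x) = c * L F"
    and "\<And>Fn F C. (\<And>n::nat. Fn n \<in> borel_measurable borel) \<Longrightarrow> (\<And>n x. \<bar>Fn n x\<bar> \<le> C) \<Longrightarrow>
        (\<And>x. (\<lambda>n. Fn n x) \<longlonglongrightarrow> F x) \<Longrightarrow> (\<lambda>n. L (Fn n)) \<longlonglongrightarrow> L F"
  using assms unfolding bounded_functional_def by blast+

lemma bounded_functional_lin:
  assumes L: "bounded_functional L" "bounded_functional L'"
  shows "bounded_functional (\<lambda>F. a * L F + b * L' F)"
  unfolding bounded_functional_def
proof (intro conjI allI impI)
  fix F G :: "'a \<Rightarrow> real" assume "bounded_borel F" "bounded_borel G"
  then show "a * L (\<lambda>x. F x + G x) + b * L' (\<lambda>x. F x + G x) = a * L F + b * L' F + (a * L G + b * L' G)"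
    by (simp add: bounded_functionalD(1)[OF L(1)] bounded_functionalD(1)[OF L(2)] algebra_simps)
next
  fix c and F :: "'a \<Rightarrow> real" assume "bounded_borel F"
  then show "a * L (\<lambda>x. c * F x) + b * L' (\<lambda>x. c * F x) = c * (a * L F + b * L' F)"
    by (simp add: bounded_functionalD(2)[OF L(1)] bounded_functionalD(2)[OF L(2)] algebra_simps)
next
  fix Fn :: "nat \<Rightarrow> 'a \<Rightarrow> real" and F C
  assume *: "\<forall>n. Fn n \<in> borel_measurable borel" "\<forall>n x. \<bar>Fn n x\<bar> \<le> C" "\<forall>x. (\<lambda>n. Fn n x) \<longlonglongrightarrow> F x"
  show "(\<lambda>n. a * L (Fn n) + b * L' (Fn n)) \<longlonglongrightarrow> a * L F + b * L' F"
    by (intro tendsto_intros bounded_functionalD(3)[OF L(1)] bounded_functionalD(3)[OF L(2)]) (use * in auto)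
qed

lemma bounded_functional_add:
  "bounded_functional L \<Longrightarrow> bounded_functional L' \<Longrightarrow> bounded_functional (\<lambda>F. L F + L' F)"
  using bounded_functional_lin[of L L' 1 1] by simp

lemma bounded_functional_diff:
  "bounded_functional L \<Longrightarrow> bounded_functional L' \<Longrightarrow> bounded_functional (\<lambda>F. L F - L' F)"
  using bounded_functional_lin[of L L' 1 "-1"] by simp

text \<open>Dynkin's argument carries the vanishing from the generator to all Borel sets
  (complements use \<open>UNIV \<in> E\<close>, countable unions the limit clause). Approximation by
  simple functions then reaches bounded nonnegative functions.\<close>

lemma bounded_functional_eq0:
  fixes L :: "('b::second_countable_topology \<Rightarrow> real) \<Rightarrow> real"
  assumes L: "bounded_functional L"
    and E: "Int_stable E" "sets (borel :: 'b measure) = sigma_sets UNIV E"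
    and UNIV: "UNIV \<in> E"
    and 0: "\<And>A. A \<in> E \<Longrightarrow> L (indicator A) = 0"
    and F: "bounded_borel F"
  shows "L F = 0"
proof -
  note add = bounded_functionalD(1)[OF L] and cm = bounded_functionalD(2)[OF L]
    and lim = bounded_functionalD(3)[OF L]
  have L0: "L (\<lambda>_. 0) = 0" using cm[OF bounded_borel_const, of 0 0] by simp
  have ind: "L (indicator A) = 0" if "A \<in> sets borel" for A :: "'b set"
  proof -
    have "A \<in> sigma_sets UNIV E" using that E(2) by simp
    with E(1) subset_UNIV[of E, folded Pow_UNIV] show ?thesis
    proof (induction rule: sigma_sets_induct_disjoint)
      case (basic A) then show ?case by (rule 0)
    next
      case empty then show ?case using L0 by (simp add: indicator_def[abs_def])
    next
      case (compl A)
      have "A \<in> sets borel" using compl E(2) by simp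
      then have "L (\<lambda>x. indicator UNIV x + (-1) * indicator A x) = 0"
        using compl 0[OF UNIV] by (subst add) (auto simp only: cm bounded_borel_indicator bounded_borel_cmult sets.top space_borel[symmetric])
      moreover have "(\<lambda>x. indicator UNIV x + (-1) * indicator A x :: real) = indicator (UNIV - A)"
        by (auto simp: indicator_def)
      ultimately show ?case by simp
    next
      case (union A)
      have A: "A i \<in> sets borel" for i using union(2) E(2) by auto
      have *: "(\<lambda>x. \<Sum>i<n. indicator (A i) x :: real) = indicator (\<Union>i<n. A i)" for n
        using union(1) by (auto simp: indicator_UN_disjoint disjoint_family_on_def)
      have "L (\<lambda>x. \<Sum>i<n. indicator (A i) x) = 0" for n
      proof (induction n)
        case (Suc n)
        have "bounded_borel (\<lambda>x. \<Sum>i<n. indicator (A i) x)"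
          unfolding * using A by (intro bounded_borel_indicator) auto
        then show ?case using Suc union(3) A by (simp add: add bounded_borel_indicator)
      qed (simp add: L0)
      then have "L (indicator (\<Union>i<n. A i)) = 0" for n by (simp add: *)
      moreover have "(\<lambda>n. L (indicator (\<Union>i<n. A i))) \<longlonglongrightarrow> L (indicator (\<Union>i. A i))"
      proof (rule lim[of _ 1])
        show "\<And>x. (\<lambda>n. indicator (\<Union>i<n. A i) x :: real) \<longlonglongrightarrow> indicator (\<Union>i. A i) x"
          by (rule LIMSEQ_indicator_UN)
      qed (use A in \<open>auto simp: indicator_def\<close>)
      ultimately show ?case using LIMSEQ_unique[OF _ tendsto_const] by simp
    qed
  qed
  have nn: "bounded_borel u \<Longrightarrow> L u = 0" if "u \<in> borel_measurable borel" "\<And>x. 0 \<le> u x" for u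
    using that
  proof (induction rule: borel_measurable_induct_real)
    case (set A) then show ?case by (simp add: ind)
  next
    case (mult u c)
    \<comment> \<open>Boundedness of \<open>c * u\<close> passes to \<open>u\<close> only after
      division by \<open>c\<close>, so \<open>c = 0\<close> is separated.\<close>
    show ?case
    proof (cases "c = 0")
      case False
      have "bounded_borel (\<lambda>x. inverse c * (c * u x))" by (rule bounded_borel_cmult) fact
      moreover have "(\<lambda>x. inverse c * (c * u x)) = u" using False by (auto simp: field_simps)
      ultimately have "bounded_borel u" by simp
      then show ?thesis using mult by (simp add: cm)
    qed (simp add: L0)
  next
    case (add u v)
    obtain C where C: "\<And>x. \<bar>v x + u x\<bar> \<le> C" using add.prems bounded_borelE by metis
    have b: "bounded_borel u" "bounded_borel v"
      by (rule bounded_borelI[of _ C], fact, use C add.hyps in \<open>smt (verit)\<close>)+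
    then show ?case using add bounded_functionalD(1)[OF L b(2,1)] by simp
  next
    case (seq U)
    obtain C where C: "\<And>x. \<bar>u x\<bar> \<le> C" using seq.prems bounded_borelE by metis
    have le: "U i x \<le> u x" for i x
      using incseq_le[of "\<lambda>i. U i x" "u x" i] seq(3,4) by (auto simp: incseq_def le_fun_def)
    have U: "\<bar>U i x\<bar> \<le> C" for i x using le[of i x] C[of x] seq(2)[of i x] by linarith
    have "L (U i) = 0" for i using seq.IH[of i] bounded_borelI[OF seq(1), of i] U by blast
    moreover have "(\<lambda>n. L (U n)) \<longlonglongrightarrow> L u" by (rule lim[of U C]) (use U seq in auto)
    ultimately show ?case using LIMSEQ_unique[OF _ tendsto_const] by simp
  qed
  \<comment> \<open>The induction covers nonnegative functions only; adding the bound
    \<open>C\<close> reduces the general case to two of those.\<close>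
  obtain C where C: "C \<ge> 0" "\<And>x. \<bar>F x\<bar> \<le> C" using F bounded_borelE by metis
  have "L (\<lambda>x. (F x + C) + (-1) * C) = L (\<lambda>x. F x + C) + (-1) * L (\<lambda>x. C)"
    using F by (subst add) (auto simp only: cm bounded_borel_const bounded_borel_cmult bounded_borel_add)
  moreover have "L (\<lambda>x. F x + C) = 0"
  proof (rule nn)
    show "0 \<le> F x + C" for x using C(2)[of x] by linarith
  qed (use F in \<open>auto intro: bounded_borel_add bounded_borel_const\<close>)
  moreover have "L (\<lambda>x. C) = 0" by (rule nn) (use C in \<open>auto intro: bounded_borel_const\<close>)
  ultimately show ?thesis by simp
qed

text \<open>Only the first coordinate is reduced to an indicator; the second keeps an arbitrary
  bounded function. This asymmetry lets the versions for two, three and four coordinates follow by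
  peeling off one coordinate at a time.\<close>

lemma bounded_functional_eqI_Times:
  fixes L :: "('b::second_countable_topology \<times> 'c::second_countable_topology \<Rightarrow> real) \<Rightarrow> real"
  assumes L: "bounded_functional L" "bounded_functional L'"
    and eq: "\<And>A G. A \<in> sets borel \<Longrightarrow> bounded_borel G \<Longrightarrow>
        L (\<lambda>(x, y). indicator A x * G y) = L' (\<lambda>(x, y). indicator A x * G y)"
    and F: "bounded_borel F"
  shows "L F = L' F"
proof -
  have "(\<lambda>F. L F - L' F) F = 0"
  proof (rule bounded_functional_eq0[OF bounded_functional_diff[OF L] _ _ _ _ F])
    let ?E = "{a \<times> b |a b. a \<in> sets (borel :: 'b measure) \<and> b \<in> sets (borel :: 'c measure)}"
    show "Int_stable ?E" using Int_stable_pair_measure_generator[of borel borel] by simp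
    show "sets borel = sigma_sets UNIV ?E"
      by (subst borel_prod[symmetric], subst sets_pair_measure) (auto simp: space_borel)
    show "UNIV \<in> ?E" by (auto intro!: exI[of _ UNIV])
    fix S assume "S \<in> ?E"
    then obtain A B where S: "S = A \<times> B" "A \<in> sets borel" "B \<in> sets borel" by auto
    have "(indicator S :: _ \<Rightarrow> real) = (\<lambda>(x, y). indicator A x * indicator B y)"
      by (auto simp: S indicator_def)
    then show "L (indicator S) - L' (indicator S) = 0"
      using eq[OF S(2) bounded_borel_indicator[OF S(3)]] by simp
  qed
  then show ?thesis by simp
qed

lemma bounded_borel_times:
  fixes H :: "'b::second_countable_topology \<Rightarrow> real" and G :: "'c::second_countable_topology \<Rightarrow> real"
  assumes "bounded_borel H" "bounded_borel G"
  shows "bounded_borel (\<lambda>(x, y). H x * G y)"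
proof -
  have "bounded_borel (\<lambda>z. H (fst z) * G (snd z))"
    by (intro bounded_borel_mult bounded_borel_compose[OF assms(1)] bounded_borel_compose[OF assms(2)])
       (simp_all add: borel_prod[symmetric])
  then show ?thesis by (simp add: case_prod_beta')
qed

text \<open>Freezing a factor in one coordinate leaves a functional of the same kind in the other,
  to which the uniqueness result with one coordinate fewer applies.\<close>

lemma bounded_functional_section:
  fixes L :: "('b::second_countable_topology \<times> 'c::second_countable_topology \<Rightarrow> real) \<Rightarrow> real"
  assumes L: "bounded_functional L" and H: "bounded_borel H"
  shows "bounded_functional (\<lambda>G. L (\<lambda>(x, y). H x * G y))"
  unfolding bounded_functional_def
proof (intro conjI allI impI)
  fix F G :: "'c \<Rightarrow> real" assume *: "bounded_borel F" "bounded_borel G"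
  have "(\<lambda>(x, y). H x * (F y + G y)) = (\<lambda>z. (case z of (x, y) \<Rightarrow> H x * F y) + (case z of (x, y) \<Rightarrow> H x * G y))"
    by (auto simp: algebra_simps)
  with * show "L (\<lambda>(x, y). H x * (F y + G y)) = L (\<lambda>(x, y). H x * F y) + L (\<lambda>(x, y). H x * G y)"
    by (simp add: bounded_functionalD(1)[OF L] bounded_borel_times H)
next
  fix c and F :: "'c \<Rightarrow> real" assume *: "bounded_borel F"
  have "(\<lambda>(x, y). H x * (c * F y)) = (\<lambda>z. c * (case z of (x, y) \<Rightarrow> H x * F y))"
    by (auto simp: algebra_simps)
  with * show "L (\<lambda>(x, y). H x * (c * F y)) = c * L (\<lambda>(x, y). H x * F y)"
    by (simp add: bounded_functionalD(2)[OF L] bounded_borel_times H)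
next
  fix Fn :: "nat \<Rightarrow> 'c \<Rightarrow> real" and F C
  assume *: "\<forall>n. Fn n \<in> borel_measurable borel" "\<forall>n x. \<bar>Fn n x\<bar> \<le> C" "\<forall>x. (\<lambda>n. Fn n x) \<longlonglongrightarrow> F x"
  obtain D where D: "D \<ge> 0" "\<And>x. \<bar>H x\<bar> \<le> D" using H bounded_borelE by metis
  show "(\<lambda>n. L (\<lambda>(x, y). H x * Fn n y)) \<longlonglongrightarrow> L (\<lambda>(x, y). H x * F y)"
  proof (rule bounded_functionalD(3)[OF L, of _ "D * C"])
    show "(\<lambda>(x, y). H x * Fn n y) \<in> borel_measurable borel" for n
      by (rule bounded_borel_measurable[OF bounded_borel_times[OF H]]) (use * bounded_borelI in blast)
    show "\<bar>(\<lambda>(x, y). H x * Fn n y) z\<bar> \<le> D * C" for n z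
      using D * by (auto simp: abs_mult case_prod_beta intro!: mult_mono)
    show "(\<lambda>n. (\<lambda>(x, y). H x * Fn n y) z) \<longlonglongrightarrow> (\<lambda>(x, y). H x * F y) z" for z
      using * by (auto simp: case_prod_beta intro!: tendsto_intros)
  qed
qed

lemma bounded_functional_eqI2:
  fixes L :: "('b::second_countable_topology \<times> 'c::second_countable_topology \<Rightarrow> real) \<Rightarrow> real"
  assumes L: "bounded_functional L" "bounded_functional L'"
    and eq: "\<And>A B. A \<in> sets borel \<Longrightarrow> B \<in> sets borel \<Longrightarrow>
        L (\<lambda>(x, y). indicator A x * indicator B y) = L' (\<lambda>(x, y). indicator A x * indicator B y)"
    and F: "bounded_borel F"
  shows "L F = L' F"
proof (rule bounded_functional_eqI_Times[OF L _ F])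
  fix A :: "'b set" and G :: "'c \<Rightarrow> real" assume A: "A \<in> sets borel" and G: "bounded_borel G"
  note S = bounded_functional_section[OF _ bounded_borel_indicator[OF A]]
  have "(\<lambda>G. L (\<lambda>(x, y). indicator A x * G y) - L' (\<lambda>(x, y). indicator A x * G y)) G = 0"
  proof (rule bounded_functional_eq0[OF bounded_functional_diff[OF S[OF L(1)] S[OF L(2)]] _ _ _ _ G])
    show "Int_stable (sets (borel :: 'c measure))" by (rule sets.Int_stable)
    show "sets borel = sigma_sets UNIV (sets (borel :: 'c measure))"
      by (metis sets.sigma_sets_eq space_borel)
    show "UNIV \<in> sets (borel :: 'c measure)" by simp
    show "\<And>B. B \<in> sets borel \<Longrightarrow> L (\<lambda>(x, y). indicator A x * indicator B y) - L' (\<lambda>(x, y). indicator A x * indicator B y) = 0"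
      using eq[OF A] by simp
  qed
  then show "L (\<lambda>(x, y). indicator A x * G y) = L' (\<lambda>(x, y). indicator A x * G y)" by simp
qed

lemma bounded_functional_eqI3:
  fixes L :: "('b::second_countable_topology \<times> 'c::second_countable_topology \<times> 'd::second_countable_topology \<Rightarrow> real) \<Rightarrow> real"
  assumes L: "bounded_functional L" "bounded_functional L'"
    and eq: "\<And>A B C. A \<in> sets borel \<Longrightarrow> B \<in> sets borel \<Longrightarrow> C \<in> sets borel \<Longrightarrow>
        L (\<lambda>(x, y, z). indicator A x * (indicator B y * indicator C z)) =
        L' (\<lambda>(x, y, z). indicator A x * (indicator B y * indicator C z))"
    and F: "bounded_borel F"
  shows "L F = L' F"
proof (rule bounded_functional_eqI_Times[OF L _ F])
  fix A :: "'b set" and G :: "'c \<times> 'd \<Rightarrow> real" assume A: "A \<in> sets borel" and G: "bounded_borel G"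
  note S = bounded_functional_section[OF _ bounded_borel_indicator[OF A]]
  show "L (\<lambda>(x, y). indicator A x * G y) = L' (\<lambda>(x, y). indicator A x * G y)"
  proof (rule bounded_functional_eqI2[OF S[OF L(1)] S[OF L(2)] _ G])
    fix B C assume "B \<in> sets (borel :: 'c measure)" "C \<in> sets (borel :: 'd measure)"
    from eq[OF A this]
    show "L (\<lambda>(x, y). indicator A x * (case y of (x, y) \<Rightarrow> indicator B x * indicator C y)) =
      L' (\<lambda>(x, y). indicator A x * (case y of (x, y) \<Rightarrow> indicator B x * indicator C y))"
      by (simp add: case_prod_beta')
  qed
qed

lemma bounded_functional_eqI4:
  fixes L :: "('b::second_countable_topology \<times> 'c::second_countable_topology \<times> 'd::second_countable_topology \<times> 'e::second_countable_topology \<Rightarrow> real) \<Rightarrow> real"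
  assumes L: "bounded_functional L" "bounded_functional L'"
    and eq: "\<And>A B C D. A \<in> sets borel \<Longrightarrow> B \<in> sets borel \<Longrightarrow> C \<in> sets borel \<Longrightarrow> D \<in> sets borel \<Longrightarrow>
        L (\<lambda>(x, y, z, w). indicator A x * (indicator B y * (indicator C z * indicator D w))) =
        L' (\<lambda>(x, y, z, w). indicator A x * (indicator B y * (indicator C z * indicator D w)))"
    and F: "bounded_borel F"
  shows "L F = L' F"
proof (rule bounded_functional_eqI_Times[OF L _ F])
  fix A :: "'b set" and G :: "'c \<times> 'd \<times> 'e \<Rightarrow> real" assume A: "A \<in> sets borel" and G: "bounded_borel G"
  note S = bounded_functional_section[OF _ bounded_borel_indicator[OF A]]
  show "L (\<lambda>(x, y). indicator A x * G y) = L' (\<lambda>(x, y). indicator A x * G y)"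
  proof (rule bounded_functional_eqI3[OF S[OF L(1)] S[OF L(2)] _ G])
    fix B C D assume "B \<in> sets (borel :: 'c measure)" "C \<in> sets (borel :: 'd measure)" "D \<in> sets (borel :: 'e measure)"
    from eq[OF A this]
    show "L (\<lambda>(x, y). indicator A x * (case y of (x, y, z) \<Rightarrow> indicator B x * (indicator C y * indicator D z))) =
      L' (\<lambda>(x, y). indicator A x * (case y of (x, y, z) \<Rightarrow> indicator B x * (indicator C y * indicator D z)))"
      by (simp add: case_prod_beta')
  qed
qed

text \<open>Nested functionals need measurability of sections and Fubini's theorem, and induction
  over this class reduces both to a single finite measure. \<open>cong\<close> compares values on
  bounded Borel functions only, because default values of the integral elsewhere are
  irrelevant.\<close>

inductive measure_functional :: "(('b::second_countable_topology \<Rightarrow> real) \<Rightarrow> real) \<Rightarrow> bool" where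
  base: "finite_measure \<mu> \<Longrightarrow> sets \<mu> = sets borel \<Longrightarrow> measure_functional (integral\<^sup>L \<mu>)"
| lin: "measure_functional L \<Longrightarrow> measure_functional L' \<Longrightarrow> measure_functional (\<lambda>F. a * L F + b * L' F)"
| cong: "measure_functional L \<Longrightarrow> (\<And>F. bounded_borel F \<Longrightarrow> L' F = L F) \<Longrightarrow> measure_functional L'"

lemma measure_functional_imp_bounded:
  assumes "measure_functional L" shows "bounded_functional L"
  using assms
proof induction
  case (base \<mu>)
  interpret finite_measure \<mu> by fact
  note int = integrable_bounded_borel[OF base(1) _ base(2)]
  note [measurable_cong] = base(2)
  show ?case unfolding bounded_functional_def
  proof (intro conjI allI impI)
    fix Fn :: "nat \<Rightarrow> 'a \<Rightarrow> real" and F C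
    assume *: "\<forall>n. Fn n \<in> borel_measurable borel" "\<forall>n x. \<bar>Fn n x\<bar> \<le> C" "\<forall>x. (\<lambda>n. Fn n x) \<longlonglongrightarrow> F x"
    have [measurable]: "Fn n \<in> borel_measurable borel" for n using * by auto
    have [measurable]: "F \<in> borel_measurable borel"
      by (rule borel_measurable_LIMSEQ_real[of _ Fn]) (use * in auto)
    show "(\<lambda>n. integral\<^sup>L \<mu> (Fn n)) \<longlonglongrightarrow> integral\<^sup>L \<mu> F"
      by (rule integral_dominated_convergence[of _ _ _ "\<lambda>_. C"]) (use * in auto)
  qed (simp_all add: int)
next
  case lin then show ?case by (intro bounded_functional_lin)
next
  case (cong L L')
  show ?case unfolding bounded_functional_def
  proof (intro conjI allI impI)
    fix F G :: "'a \<Rightarrow> real" assume "bounded_borel F" "bounded_borel G"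
    then show "L' (\<lambda>x. F x + G x) = L' F + L' G"
      using cong.IH by (simp add: cong.hyps bounded_borel_add bounded_functionalD(1))
  next
    fix c and F :: "'a \<Rightarrow> real" assume "bounded_borel F"
    then show "L' (\<lambda>x. c * F x) = c * L' F"
      using cong.IH by (simp add: cong.hyps bounded_borel_cmult bounded_functionalD(2))
  next
    fix Fn :: "nat \<Rightarrow> 'a \<Rightarrow> real" and F C
    assume *: "\<forall>n. Fn n \<in> borel_measurable borel" "\<forall>n x. \<bar>Fn n x\<bar> \<le> C" "\<forall>x. (\<lambda>n. Fn n x) \<longlonglongrightarrow> F x"
    have "F \<in> borel_measurable borel"
      by (rule borel_measurable_LIMSEQ_real[of _ Fn]) (use * in auto)
    moreover have "\<bar>F x\<bar> \<le> C" for x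
      using LIMSEQ_le_const2[OF tendsto_rabs, of "\<lambda>n. Fn n x" "F x" C] * by auto
    ultimately have "bounded_borel F" by (rule bounded_borelI)
    moreover have "bounded_borel (Fn n)" for n using * bounded_borelI by blast
    moreover have "(\<lambda>n. L (Fn n)) \<longlonglongrightarrow> L F"
      by (rule bounded_functionalD(3)[OF cong.IH]) (use * in auto)
    ultimately show "(\<lambda>n. L' (Fn n)) \<longlonglongrightarrow> L' F" by (simp add: cong.hyps)
  qed
qed

text \<open>Legitimises nesting: the inner functional yields an admissible argument for the outer
  one.\<close>

lemma bounded_borel_measure_functional:
  fixes F :: "'b::second_countable_topology \<times> 'c::second_countable_topology \<Rightarrow> real"
  assumes "measure_functional L" "bounded_borel F"
  shows "bounded_borel (\<lambda>x. L (\<lambda>y. F (x, y)))"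
  using assms
proof (induction)
  case (base \<mu>)
  interpret finite_measure \<mu> by fact
  note [measurable_cong] = base(2)
  have F: "F \<in> borel_measurable (borel \<Otimes>\<^sub>M borel)"
    using base(3) by (auto simp: borel_prod)
  then have F': "F \<in> borel_measurable (borel \<Otimes>\<^sub>M \<mu>)"
    by (subst measurable_cong_sets[OF sets_pair_measure_cong[OF refl base(2)] refl])
  obtain C where C: "C \<ge> 0" "\<And>x. \<bar>F x\<bar> \<le> C" using base(3) bounded_borelE by metis
  have "\<bar>\<integral>y. F (x, y) \<partial>\<mu>\<bar> \<le> C * measure \<mu> (space \<mu>)" for x
  proof -
    have "\<bar>\<integral>y. F (x, y) \<partial>\<mu>\<bar> \<le> (\<integral>y. C \<partial>\<mu>)"
      using C base(3) bounded_borel_Pair bounded_borel_const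
      by (intro integral_abs_bound[THEN order_trans] integral_mono integrable_abs integrable_bounded_borel base) auto
    then show ?thesis by (simp add: mult.commute)
  qed
  moreover have "(\<lambda>x. \<integral>y. F (x, y) \<partial>\<mu>) \<in> borel_measurable borel"
    using F' by (intro borel_measurable_lebesgue_integral) (simp add: split_def)
  ultimately show ?case by (intro bounded_borelI) auto
next
  case (lin L L' a b)
  then show ?case by (intro bounded_borel_add bounded_borel_cmult)
next
  case (cong L L')
  then show ?case by (simp add: bounded_borel_Pair)
qed

text \<open>Induction on both functionals reaches two finite measures, where Fubini identifies the
  iterated integral with the product measure. Integrability of the sections is needed when the inner
  functional is a linear combination.\<close>

lemma measure_functional_prod:
  assumes L: "measure_functional (L :: ('b::second_countable_topology \<Rightarrow> real) \<Rightarrow> real)"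
    and L': "measure_functional (L' :: ('c::second_countable_topology \<Rightarrow> real) \<Rightarrow> real)"
  shows "measure_functional (\<lambda>F. L (\<lambda>x. L' (\<lambda>y. F (x, y))))"
  using L
proof induction
  case (base \<mu>)
  interpret \<mu>: finite_measure \<mu> by fact
  note base_\<mu> = base
  show ?case using L'
  proof induction
    case (base \<nu>)
    interpret \<nu>: finite_measure \<nu> by fact
    interpret pair_sigma_finite \<mu> \<nu> ..
    have s: "sets (\<mu> \<Otimes>\<^sub>M \<nu>) = sets borel"
      using sets_pair_measure_cong[OF base_\<mu>(2) base(2)] unfolding borel_prod .
    interpret P: finite_measure "\<mu> \<Otimes>\<^sub>M \<nu>"
      by (rule finite_measure_pair_measure) fact+
    show ?case
    proof (rule measure_functional.cong[OF measure_functional.base[OF P.finite_measure_axioms s]])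
      fix F :: "'b \<times> 'c \<Rightarrow> real" assume "bounded_borel F"
      then have "integrable (\<mu> \<Otimes>\<^sub>M \<nu>) F" by (rule integrable_bounded_borel[OF P.finite_measure_axioms _ s])
      then show "(\<integral>x. \<integral>y. F (x, y) \<partial>\<nu> \<partial>\<mu>) = integral\<^sup>L (\<mu> \<Otimes>\<^sub>M \<nu>) F"
        by (rule integral_fst')
    qed
  next
    case (lin K K' a b)
    show ?case
    proof (rule measure_functional.cong[OF measure_functional.lin[OF lin.IH, of a b]])
      fix F :: "'b \<times> 'c \<Rightarrow> real" assume "bounded_borel F"
      then show "(\<integral>x. a * K (\<lambda>y. F (x, y)) + b * K' (\<lambda>y. F (x, y)) \<partial>\<mu>) =
         a * (\<integral>x. K (\<lambda>y. F (x, y)) \<partial>\<mu>) + b * (\<integral>x. K' (\<lambda>y. F (x, y)) \<partial>\<mu>)"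
        using lin.hyps base_\<mu>
        by (subst Bochner_Integration.integral_add)
           (auto intro!: integrable_bounded_borel bounded_borel_cmult bounded_borel_measure_functional)
    qed
  next
    case (cong K K')
    show ?case
      by (rule measure_functional.cong[OF cong.IH]) (simp add: cong.hyps bounded_borel_Pair)
  qed
next
  case (lin K K' a b)
  from measure_functional.lin[OF lin.IH, of a b] show ?case .
next
  case (cong K K')
  show ?case
    by (rule measure_functional.cong[OF cong.IH])
       (simp add: cong.hyps bounded_borel_measure_functional[OF L'])
qed

lemma measure_functional_push:
  fixes T :: "'b::second_countable_topology \<Rightarrow> 'c::second_countable_topology"
  assumes "measure_functional L" and T: "T \<in> borel_measurable borel"
  shows "measure_functional (\<lambda>F. L (\<lambda>x. F (T x)))"
  using assms(1)
proof induction
  case (base \<mu>)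
  interpret finite_measure \<mu> by fact
  have T': "T \<in> measurable \<mu> borel" using T base by (simp cong: measurable_cong_sets)
  interpret D: finite_measure "distr \<mu> borel T" by (rule finite_measure_distr[OF T'])
  have s: "sets (distr \<mu> borel T) = sets borel" by simp
  show ?case
    by (rule measure_functional.cong[OF measure_functional.base[OF D.finite_measure_axioms s]])
       (use T' in \<open>auto simp: integral_distr\<close>)
next
  case (lin L L' a b)
  from measure_functional.lin[OF lin.IH, of a b] show ?case .
next
  case (cong L L')
  show ?case
    by (rule measure_functional.cong[OF cong.IH]) (simp add: cong.hyps bounded_borel_compose T)
qed

section \<open>Sums over set partitions\<close>

lemma sum_Pow_insert:
  assumes "finite B" "b \<notin> B"
  shows "(\<Sum>T\<in>Pow (insert b B). f T) = (\<Sum>T\<in>Pow B. f T + f (insert b T))"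
proof -
  have "inj_on (insert b) (Pow B)" using assms(2) by (auto simp: inj_on_def)
  then show ?thesis using assms
    by (subst Pow_insert, subst sum.union_disjoint) (auto simp: sum.reindex sum.distrib)
qed

text \<open>The weight \<open>c\<close> is left free, since the recursion over blocks replaces it by
  its shift \<open>\<lambda>j. c (Suc j)\<close>.\<close>

definition partition_sum :: "(nat \<Rightarrow> real) \<Rightarrow> ('b set \<Rightarrow> real) \<Rightarrow> 'b set \<Rightarrow> real" where
  "partition_sum c m A = (\<Sum>P\<in>{P. partition_on A P}. c (card P) * (\<Prod>K\<in>P. m K))"

lemma partition_sum_empty: "partition_sum c m {} = c 0"
  by (simp add: partition_sum_def partition_on_empty)

text \<open>A partition of \<open>insert a B\<close> is sorted by the block
  \<open>insert a T\<close> that contains \<open>a\<close>. Deleting this block leaves a partition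
  of \<open>B - T\<close> with one block fewer, hence the shifted weight.\<close>

lemma partition_sum_insert:
  assumes fin: "finite B" and a: "a \<notin> B"
  shows "partition_sum c m (insert a B) =
    (\<Sum>T\<in>Pow B. m (insert a T) * partition_sum (\<lambda>j. c (Suc j)) m (B - T))"
proof -
  let ?S = "SIGMA T:Pow B. {P. partition_on (B - T) P}"
  have notin: "insert a T \<notin> P" if "T \<subseteq> B" "partition_on (B - T) P" for T P
    using that(2) a by (auto simp: partition_on_def)
  have disj: "disjnt (insert a T) (\<Union>P)" if "T \<subseteq> B" "partition_on (B - T) P" for T P
    using partition_onD1[OF that(2)] a by (auto simp: disjnt_def)
  have bij: "bij_betw (\<lambda>(T, P). insert (insert a T) P) ?S {P. partition_on (insert a B) P}"
  proof (rule bij_betwI')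
    fix x y assume "x \<in> ?S" "y \<in> ?S"
    then obtain T P T' P' where x: "x = (T, P)" "T \<subseteq> B" "partition_on (B - T) P"
      and y: "y = (T', P')" "T' \<subseteq> B" "partition_on (B - T') P'" by auto
    have P: "\<And>K. K \<in> P \<Longrightarrow> a \<notin> K" "\<And>K. K \<in> P' \<Longrightarrow> a \<notin> K"
      using partition_onD1[OF x(3)] partition_onD1[OF y(3)] a by auto
    have "T = T'" "P = P'" if *: "insert (insert a T) P = insert (insert a T') P'"
    proof -
      have "insert a T = insert a T'" using * P by (metis insertE insertI1)
      then show "T = T'" using x(2) y(2) a by (metis insert_ident subsetD)
      then show "P = P'" using * notin[OF x(2,3)] notin[OF y(2,3)] by (metis insert_ident)
    qed
    then show "((\<lambda>(T, P). insert (insert a T) P) x = (\<lambda>(T, P). insert (insert a T) P) y) = (x = y)"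
      by (auto simp: x y)
  next
    fix x assume "x \<in> ?S"
    then obtain T P where x: "x = (T, P)" "T \<subseteq> B" "partition_on (B - T) P" by auto
    moreover have "insert a B - insert a T = B - T" using a by auto
    ultimately show "(\<lambda>(T, P). insert (insert a T) P) x \<in> {P. partition_on (insert a B) P}"
      using partition_on_insert[OF disj[OF x(2,3)]] by auto
  next
    fix P assume "P \<in> {P. partition_on (insert a B) P}"
    then have P: "partition_on (insert a B) P" by simp
    then obtain K where K: "K \<in> P" "a \<in> K" using partition_onD1 by fastforce
    define P' where "P' = P - {K}"
    have P': "P = insert K P'" "K \<notin> P'" using K by (auto simp: P'_def)
    have "disjnt K (\<Union>P')"
      using partition_onD2[OF P] K(1) by (auto simp: P'_def disjoint_def disjnt_def)
    from P partition_on_insert[OF this, of "insert a B"]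
    have "partition_on (insert a B - K) P'" "K \<subseteq> insert a B" by (auto simp: P')
    moreover have "insert a B - K = B - (K - {a})" "insert a (K - {a}) = K" using K(2) a by auto
    ultimately show "\<exists>x\<in>?S. P = (\<lambda>(T, P). insert (insert a T) P) x"
      using P' by (intro bexI[of _ "(K - {a}, P')"]) auto
  qed
  have "partition_sum c m (insert a B) =
      (\<Sum>(T, P)\<in>?S. c (card (insert (insert a T) P)) * (\<Prod>K\<in>insert (insert a T) P. m K))"
    unfolding partition_sum_def
    by (subst sum.reindex_bij_betw[OF bij, symmetric]) (auto intro!: sum.cong)
  also have "\<dots> = (\<Sum>(T, P)\<in>?S. m (insert a T) * (c (Suc (card P)) * (\<Prod>K\<in>P. m K)))"
  proof (intro sum.cong refl, clarify)
    fix T P assume "T \<subseteq> B" "partition_on (B - T) P"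
    moreover from this fin have "finite P" by (meson finite_Diff finite_elements)
    ultimately show "c (card (insert (insert a T) P)) * (\<Prod>K\<in>insert (insert a T) P. m K) =
        m (insert a T) * (c (Suc (card P)) * (\<Prod>K\<in>P. m K))"
      using notin by simp
  qed
  also have "\<dots> = (\<Sum>T\<in>Pow B. \<Sum>P\<in>{P. partition_on (B - T) P}. m (insert a T) * (c (Suc (card P)) * (\<Prod>K\<in>P. m K)))"
    using fin by (subst sum.Sigma) (auto intro: finitely_many_partition_on)
  finally show ?thesis by (simp add: partition_sum_def sum_distrib_left)
qed

lemma sum_partitions_by_card:
  assumes "finite A" "A \<noteq> {}"
  shows "(\<Sum>j=1..card A. c j * (\<Sum>P\<in>{P. partition_on A P \<and> card P = j}. \<Prod>K\<in>P. m K)) = partition_sum c m A"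
proof -
  let ?S = "{P. partition_on A P}"
  have fin: "finite ?S" by (rule finitely_many_partition_on) fact
  have card: "card P \<in> {1..card A}" if "partition_on A P" for P
  proof -
    have "finite P" using assms(1) that by (rule finite_elements)
    moreover have "P \<noteq> {}" using that assms(2) by (auto simp: partition_on_def)
    \<comment> \<open>Blocks are nonempty and disjoint, so choosing one element from each is
      injective.\<close>
    moreover have "card P \<le> card A"
    proof (rule card_inj_on_le)
      show "inj_on (\<lambda>K. SOME x. x \<in> K) P"
      proof
        fix K L assume KL: "K \<in> P" "L \<in> P" "(SOME x. x \<in> K) = (SOME x. x \<in> L)"
        then have "K \<noteq> {}" "L \<noteq> {}" using partition_onD3[OF that] by auto
        then have "(SOME x. x \<in> K) \<in> K" "(SOME x. x \<in> L) \<in> L" by (simp_all add: some_in_eq)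
        then show "K = L" using partition_onD2[OF that] KL by (metis disjoint_iff disjointD)
      qed
      show "(\<lambda>K. SOME x. x \<in> K) ` P \<subseteq> A"
      proof
        fix y assume "y \<in> (\<lambda>K. SOME x. x \<in> K) ` P"
        then obtain K where K: "K \<in> P" "y = (SOME x. x \<in> K)" by auto
        then have "K \<noteq> {}" using partition_onD3[OF that] by auto
        then have "y \<in> K" using K by (simp add: some_in_eq)
        then show "y \<in> A" using partition_onD1[OF that] K by auto
      qed
    qed fact
    ultimately show ?thesis by (auto simp: Suc_le_eq card_gt_0_iff)
  qed
  have "partition_sum c m A = (\<Sum>j=1..card A. \<Sum>P\<in>{P\<in>?S. card P = j}. c (card P) * (\<Prod>K\<in>P. m K))"
    unfolding partition_sum_def
    using card by (subst sum.group[OF fin, of "{1..card A}" card]) auto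
  then show ?thesis by (auto simp: sum_distrib_left intro!: sum.cong)
qed

text \<open>The value of the Moebius function of the partition lattice between a partition with
  \<open>j\<close> blocks and the one-block partition.\<close>

definition cumulant_weight :: "nat \<Rightarrow> real" where
  "cumulant_weight j = (- 1) ^ (j - 1) * fact (j - 1)"

lemma factorial_cumulant_partition_sum:
  assumes "k \<ge> 1"
  shows "factorial_cumulant M X J k A =
     partition_sum cumulant_weight (\<lambda>K. enn2real (factorial_moment M X J K A)) {1..k}"
  using sum_partitions_by_card[of "{1..k}" cumulant_weight] assms
  by (simp add: factorial_cumulant_def cumulant_weight_def)

lemma cumulant_weight_simps:
  "cumulant_weight (Suc 0) = 1" "cumulant_weight (Suc (Suc 0)) = -1"
  "cumulant_weight (Suc (Suc (Suc 0))) = 2" "cumulant_weight (Suc (Suc (Suc (Suc 0)))) = -6"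
  by (simp_all add: cumulant_weight_def)

lemma sum_Pow_empty: "(\<Sum>T\<in>Pow {}. f T) = f {}"
  by simp

lemma partition_sum_1: "partition_sum c m {a} = m {a} * c (Suc 0)"
  by (simp only: partition_sum_insert finite.intros empty_iff not_False_eq_True sum_Pow_empty Diff_empty partition_sum_empty)

text \<open>Stated for a general weight because the expansions for three and four elements call it
  with a shifted one.\<close>

lemma partition_sum_2_aux:
  assumes "a \<noteq> b"
  shows "partition_sum c m {a, b} = m {a, b} * c (Suc 0) + m {a} * (m {b} * c (Suc (Suc 0)))"
proof -
  have "a \<notin> {b}" using assms by simp
  then show ?thesis
    by (simp only: partition_sum_insert finite.intros empty_iff not_False_eq_True sum_Pow_empty
      sum_Pow_insert Diff_empty Diff_cancel partition_sum_empty partition_sum_1 add.commute)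
qed

lemma partition_sum_2:
  assumes "a \<noteq> b"
  shows "partition_sum cumulant_weight m {a, b} = m {a, b} - m {a} * m {b}"
  using assms by (simp add: partition_sum_2_aux cumulant_weight_simps)

lemma partition_sum_3_aux:
  assumes "distinct [a, b, d]"
  shows "partition_sum c m {a, b, d} = m {a, b, d} * c (Suc 0) +
     (m {a, b} * m {d} + m {a, d} * m {b} + m {a} * m {b, d}) * c (Suc (Suc 0)) +
     m {a} * m {b} * m {d} * c (Suc (Suc (Suc 0)))"
proof -
  have "a \<notin> {b, d}" "b \<notin> {d}" "b \<noteq> d" "{b, d} - {d} = {b}" "{b, d} - {b} = {d}" using assms by auto
  then have "partition_sum c m {a, b, d} =
     m {a} * partition_sum (\<lambda>j. c (Suc j)) m {b, d} +  m {a, d} * partition_sum (\<lambda>j. c (Suc j)) m {b}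
    + (m {a, b} * partition_sum (\<lambda>j. c (Suc j)) m {d} + m {a, b, d} * partition_sum (\<lambda>j. c (Suc j)) m {})"
    by (simp only: partition_sum_insert finite.intros empty_iff not_False_eq_True sum_Pow_empty
      sum_Pow_insert Diff_empty Diff_cancel add.assoc add.left_commute add.commute)
  then show ?thesis using \<open>b \<noteq> d\<close>
    by (simp add: partition_sum_2_aux partition_sum_1 partition_sum_empty algebra_simps)
qed

lemma partition_sum_3:
  assumes "distinct [a, b, c]"
  shows "partition_sum cumulant_weight m {a, b, c} = m {a, b, c} - m {a} * m {b, c} - m {b} * m {a, c}
     - m {c} * m {a, b} + 2 * m {a} * m {b} * m {c}"
  using assms by (simp add: partition_sum_3_aux cumulant_weight_simps)

text \<open>All 15 partitions appear: one with a single block, seven with two blocks (weight -1),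
  six with three (weight 2) and the finest one (weight -6).\<close>

lemma partition_sum_4:
  assumes "distinct [a, b, c, d]"
  shows "partition_sum cumulant_weight m {a, b, c, d} = m {a, b, c, d}
     - m {a} * m {b, c, d} - m {b} * m {a, c, d} - m {c} * m {a, b, d} - m {d} * m {a, b, c}
     - m {a, b} * m {c, d} - m {a, c} * m {b, d} - m {a, d} * m {b, c}
     + 2 * m {a, b} * m {c} * m {d} + 2 * m {a, c} * m {b} * m {d} + 2 * m {a, d} * m {b} * m {c}
     + 2 * m {b, c} * m {a} * m {d} + 2 * m {b, d} * m {a} * m {c} + 2 * m {c, d} * m {a} * m {b}
     - 6 * m {a} * m {b} * m {c} * m {d}"
proof -
  let ?c = "\<lambda>j. cumulant_weight (Suc j)"
  have d: "a \<notin> {b, c, d}" "b \<notin> {c, d}" "c \<notin> {d}"  "b \<noteq> c" "b \<noteq> d" "c \<noteq> d"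
    "{b, c, d} - {d} = {b, c}" "{b, c, d} - {c} = {b, d}" "{b, c, d} - {b} = {c, d}"
    "{b, c, d} - {c, d} = {b}" "{b, c, d} - {b, d} = {c}" "{b, c, d} - {b, c} = {d}"
    using assms by auto
  then have "partition_sum cumulant_weight m {a, b, c, d} =
     m {a} * partition_sum ?c m {b, c, d} +  m {a, d} * partition_sum ?c m {b, c}
    + (m {a, c} * partition_sum ?c m {b, d} + m {a, c, d} * partition_sum ?c m {b})
    + (m {a, b} * partition_sum ?c m {c, d} + m {a, b, d} * partition_sum ?c m {c}
    + (m {a, b, c} * partition_sum ?c m {d} + m {a, b, c, d} * partition_sum ?c m {}))"
    by (simp only: partition_sum_insert finite.intros empty_iff not_False_eq_True sum_Pow_empty
      sum_Pow_insert Diff_empty Diff_cancel add.assoc add.left_commute add.commute)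
  then show ?thesis using d assms
    by (simp add: partition_sum_3_aux partition_sum_2_aux partition_sum_1 partition_sum_empty
       cumulant_weight_simps) (simp add: algebra_simps)
qed

section \<open>Sums over tuples of distinct indices\<close>

text \<open>Nested dependent products instead of injective functions: sums over tuples then split
  off their first index by \<open>sum.Sigma\<close>, and membership is countable-valued and
  measurable index by index.\<close>

definition distinct2 :: "'i set \<Rightarrow> ('i \<times> 'i) set" where
  "distinct2 I = Sigma I (\<lambda>i. I - {i})"
definition distinct3 :: "'i set \<Rightarrow> ('i \<times> 'i \<times> 'i) set" where
  "distinct3 I = Sigma I (\<lambda>i. distinct2 (I - {i}))"
definition distinct4 :: "'i set \<Rightarrow> ('i \<times> 'i \<times> 'i \<times> 'i) set" where
  "distinct4 I = Sigma I (\<lambda>i. distinct3 (I - {i}))"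

lemma finite_distinct:
  assumes "finite I" shows "finite (distinct2 I)" "finite (distinct3 I)" "finite (distinct4 I)"
  using assms by (auto simp: distinct2_def distinct3_def distinct4_def)

lemma sum_distinct2: "finite I \<Longrightarrow> (\<Sum>t\<in>distinct2 I. F t) = (\<Sum>i\<in>I. \<Sum>j\<in>I - {i}. F (i, j))"
  unfolding distinct2_def by (subst sum.Sigma) simp_all

lemma sum_distinct3: "finite I \<Longrightarrow> (\<Sum>t\<in>distinct3 I. F t) = (\<Sum>i\<in>I. \<Sum>t\<in>distinct2 (I - {i}). F (i, t))"
  unfolding distinct3_def by (subst sum.Sigma) (simp_all add: finite_distinct)

lemma sum_distinct4: "finite I \<Longrightarrow> (\<Sum>t\<in>distinct4 I. F t) = (\<Sum>i\<in>I. \<Sum>t\<in>distinct3 (I - {i}). F (i, t))"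
  unfolding distinct4_def by (subst sum.Sigma) (simp_all add: finite_distinct)

text \<open>Bridge from the injections in \<open>factorial_moment\<close> to nested tuples. An
  injection on \<open>insert a K\<close> is its value \<open>i\<close> at \<open>a\<close> together
  with an injection of \<open>K\<close> that avoids \<open>i\<close>.\<close>

lemma sum_inj_PiE_insert:
  fixes w :: "'l \<Rightarrow> 'i \<Rightarrow> 'r::comm_semiring_1"
  assumes I: "finite I" and K: "finite K" "a \<notin> K"
  shows "(\<Sum>\<iota>\<in>{\<iota>\<in>insert a K \<rightarrow>\<^sub>E I. inj_on \<iota> (insert a K)}. \<Prod>l\<in>insert a K. w l (\<iota> l)) =
    (\<Sum>i\<in>I. w a i * (\<Sum>\<iota>\<in>{\<iota>\<in>K \<rightarrow>\<^sub>E I - {i}. inj_on \<iota> K}. \<Prod>l\<in>K. w l (\<iota> l)))"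
proof -
  let ?S = "SIGMA i:I. {\<iota>\<in>K \<rightarrow>\<^sub>E I - {i}. inj_on \<iota> K}"
  let ?T = "{\<iota>\<in>insert a K \<rightarrow>\<^sub>E I. inj_on \<iota> (insert a K)}"
  have bij: "bij_betw (\<lambda>(i, \<iota>). \<iota>(a := i)) ?S ?T"
  proof (rule bij_betw_byWitness[where f'="\<lambda>\<iota>. (\<iota> a, restrict \<iota> K)"])
    show "\<forall>x\<in>?S. (\<lambda>\<iota>. (\<iota> a, restrict \<iota> K)) ((\<lambda>(i, \<iota>). \<iota>(a := i)) x) = x"
    proof (clarify, intro conjI)
      fix i \<iota> assume "\<iota> \<in> K \<rightarrow>\<^sub>E I - {i}"
      then show "restrict (\<iota>(a := i)) K = \<iota>"
        using K(2) by (auto simp: restrict_def PiE_def extensional_def fun_eq_iff)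
    qed simp
    show "\<forall>\<iota>\<in>?T. (\<lambda>(i, \<iota>). \<iota>(a := i)) (\<iota> a, restrict \<iota> K) = \<iota>"
      by (auto simp: restrict_def PiE_def extensional_def fun_eq_iff)
    show "(\<lambda>(i, \<iota>). \<iota>(a := i)) ` ?S \<subseteq> ?T"
    proof clarify
      fix i \<iota> assume *: "i \<in> I" "\<iota> \<in> K \<rightarrow>\<^sub>E I - {i}" "inj_on \<iota> K"
      have "\<iota>(a := i) \<in> insert a K \<rightarrow>\<^sub>E I"
        by (rule PiE_fun_upd) (use * in \<open>auto dest!: PiE_mem intro!: PiE_I simp: PiE_def\<close>)
      moreover have "inj_on (\<iota>(a := i)) (insert a K)"
        using * K(2) by (intro inj_on_fun_updI[THEN inj_on_insert[THEN iffD2, OF conjI]]) (auto dest: PiE_mem)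
      ultimately show "\<iota>(a := i) \<in> insert a K \<rightarrow>\<^sub>E I \<and> inj_on (\<iota>(a := i)) (insert a K)" ..
    qed
    show "(\<lambda>\<iota>. (\<iota> a, restrict \<iota> K)) ` ?T \<subseteq> ?S"
      using K(2) by (auto simp: PiE_def Pi_def inj_on_def)
  qed
  have "(\<Sum>\<iota>\<in>?T. \<Prod>l\<in>insert a K. w l (\<iota> l)) = (\<Sum>(i, \<iota>)\<in>?S. \<Prod>l\<in>insert a K. w l ((\<iota>(a := i)) l))"
    by (subst sum.reindex_bij_betw[OF bij, symmetric]) (auto intro!: sum.cong)
  also have "\<dots> = (\<Sum>(i, \<iota>)\<in>?S. w a i * (\<Prod>l\<in>K. w l (\<iota> l)))"
    using K by (intro sum.cong refl) (auto intro!: prod.cong arg_cong2[where f="(*)"])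
  also have "\<dots> = (\<Sum>i\<in>I. \<Sum>\<iota>\<in>{\<iota>\<in>K \<rightarrow>\<^sub>E I - {i}. inj_on \<iota> K}. w a i * (\<Prod>l\<in>K. w l (\<iota> l)))"
  proof (rule sum.Sigma[symmetric])
    show "\<forall>i\<in>I. finite {\<iota>\<in>K \<rightarrow>\<^sub>E I - {i}. inj_on \<iota> K}"
    proof
      fix i
      have "finite (K \<rightarrow>\<^sub>E I - {i})" using I K by (intro finite_PiE) auto
      then show "finite {\<iota>\<in>K \<rightarrow>\<^sub>E I - {i}. inj_on \<iota> K}" by (rule finite_subset[rotated]) auto
    qed
  qed fact
  also have "\<dots> = (\<Sum>i\<in>I. w a i * (\<Sum>\<iota>\<in>{\<iota>\<in>K \<rightarrow>\<^sub>E I - {i}. inj_on \<iota> K}. \<Prod>l\<in>K. w l (\<iota> l)))"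
    by (simp only: sum_distrib_left)
  finally show ?thesis .
qed

lemma sum_inj_PiE_empty:
  "(\<Sum>\<iota>\<in>{\<iota>\<in>{} \<rightarrow>\<^sub>E I. inj_on \<iota> {}}. \<Prod>l\<in>{}. w l (\<iota> l)) = (1::'r::comm_semiring_1)"
proof -
  have "{\<iota>\<in>{} \<rightarrow>\<^sub>E I. inj_on \<iota> {}} = {\<lambda>_. undefined}" by auto
  then show ?thesis by simp
qed

lemma sum_inj_PiE_1:
  fixes w :: "'l \<Rightarrow> 'i \<Rightarrow> real" assumes I: "finite I"
  shows "(\<Sum>\<iota>\<in>{\<iota>\<in>{a} \<rightarrow>\<^sub>E I. inj_on \<iota> {a}}. \<Prod>l\<in>{a}. w l (\<iota> l)) = (\<Sum>i\<in>I. w a i)"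
  by (subst sum_inj_PiE_insert[OF I]) (simp_all only: sum_inj_PiE_empty finite.emptyI empty_iff not_False_eq_True mult_1_right)

lemma sum_inj_PiE_2:
  fixes w :: "'l \<Rightarrow> 'i \<Rightarrow> real" assumes I: "finite I" and "a \<noteq> b"
  shows "(\<Sum>\<iota>\<in>{\<iota>\<in>{a, b} \<rightarrow>\<^sub>E I. inj_on \<iota> {a, b}}. \<Prod>l\<in>{a, b}. w l (\<iota> l)) =
    (\<Sum>(i, j)\<in>distinct2 I. w a i * w b j)"
  using assms by (subst sum_inj_PiE_insert) (auto simp only: sum_inj_PiE_1 finite_Diff sum_distinct2 sum_distrib_left finite.intros prod.case)

lemma sum_inj_PiE_3:
  fixes w :: "'l \<Rightarrow> 'i \<Rightarrow> real" assumes I: "finite I" and "distinct [a, b, c]"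
  shows "(\<Sum>\<iota>\<in>{\<iota>\<in>{a, b, c} \<rightarrow>\<^sub>E I. inj_on \<iota> {a, b, c}}. \<Prod>l\<in>{a, b, c}. w l (\<iota> l)) =
    (\<Sum>(i, j, k)\<in>distinct3 I. w a i * (w b j * w c k))"
proof -
  have "a \<notin> {b, c}" "b \<noteq> c" using assms by auto
  then have "(\<Sum>\<iota>\<in>{\<iota>\<in>{a, b, c} \<rightarrow>\<^sub>E I. inj_on \<iota> {a, b, c}}. \<Prod>l\<in>{a, b, c}. w l (\<iota> l)) =
      (\<Sum>i\<in>I. w a i * (\<Sum>(j, k)\<in>distinct2 (I - {i}). w b j * w c k))"
    using I by (simp only: sum_inj_PiE_insert sum_inj_PiE_2 finite_Diff finite.intros not_False_eq_True)
  then show ?thesis using I by (simp add: sum_distinct3 sum_distrib_left case_prod_beta')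
qed

lemma sum_inj_PiE_4:
  fixes w :: "'l \<Rightarrow> 'i \<Rightarrow> real" assumes I: "finite I" and "distinct [a, b, c, d]"
  shows "(\<Sum>\<iota>\<in>{\<iota>\<in>{a, b, c, d} \<rightarrow>\<^sub>E I. inj_on \<iota> {a, b, c, d}}. \<Prod>l\<in>{a, b, c, d}. w l (\<iota> l)) =
    (\<Sum>(i, j, k, l)\<in>distinct4 I. w a i * (w b j * (w c k * w d l)))"
proof -
  have "a \<notin> {b, c, d}" "distinct [b, c, d]" using assms by auto
  then have "(\<Sum>\<iota>\<in>{\<iota>\<in>{a, b, c, d} \<rightarrow>\<^sub>E I. inj_on \<iota> {a, b, c, d}}. \<Prod>l\<in>{a, b, c, d}. w l (\<iota> l)) =
      (\<Sum>i\<in>I. w a i * (\<Sum>(j, k, l)\<in>distinct3 (I - {i}). w b j * (w c k * w d l)))"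
    using I by (simp only: sum_inj_PiE_insert sum_inj_PiE_3 finite_Diff finite.intros not_False_eq_True)
  then show ?thesis using I by (simp add: sum_distinct4 sum_distrib_left case_prod_beta')
qed

text \<open>Ordered pairs are classified by what they share with \<open>{i, j}\<close>: nothing,
  exactly one of the two points, or both. The factors 2 are the two orderings of a pair.\<close>

lemma distinct2_split:
  fixes a :: "'i \<Rightarrow> 'i \<Rightarrow> real"
  assumes I: "finite I" "i \<in> I" "j \<in> I" "i \<noteq> j" and sym: "\<And>k l. a k l = a l k"
  shows "(\<Sum>(k, l)\<in>distinct2 I. a k l) = (\<Sum>(k, l)\<in>distinct2 (I - {i} - {j}). a k l)
     + 2 * (\<Sum>k\<in>I - {i} - {j}. a i k) + 2 * (\<Sum>k\<in>I - {i} - {j}. a j k) + 2 * a i j"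
proof -
  let ?R = "I - {i} - {j}"
  define h where "h k = (\<Sum>l\<in>I - {k}. a k l)" for k
  have hi: "h i = a i j + (\<Sum>k\<in>?R. a i k)"
    unfolding h_def using I by (subst sum.remove[of "I - {i}" j]) auto
  have "I - {j} - {i} = ?R" by auto
  then have hj: "h j = a i j + (\<Sum>k\<in>?R. a j k)"
    unfolding h_def using I sym[of i j] by (subst sum.remove[of "I - {j}" i]) auto
  have hk: "h k = a i k + a j k + (\<Sum>l\<in>?R - {k}. a k l)" if "k \<in> ?R" for k
  proof -
    have "I - {k} - {i} - {j} = ?R - {k}" by auto
    moreover have "sum (a k) (I - {k}) = a k i + sum (a k) (I - {k} - {i})"
      "sum (a k) (I - {k} - {i}) = a k j + sum (a k) (I - {k} - {i} - {j})"
      using I that by (auto intro!: sum.remove)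
    ultimately show ?thesis by (simp add: h_def sym[of k i] sym[of k j])
  qed
  have "(\<Sum>(k, l)\<in>distinct2 I. a k l) = (\<Sum>k\<in>I. h k)" using I by (simp add: sum_distinct2 h_def)
  also have "\<dots> = h i + (h j + (\<Sum>k\<in>?R. h k))"
    using I sum.remove[of I i h] sum.remove[of "I - {i}" j h] by simp
  also have "(\<Sum>k\<in>?R. h k) = (\<Sum>k\<in>?R. a i k) + (\<Sum>k\<in>?R. a j k) + (\<Sum>(k, l)\<in>distinct2 ?R. a k l)"
    using I by (simp add: hk sum.distrib sum_distinct2)
  finally show ?thesis by (simp add: hi hj)
qed

lemma sum_distinct2_swap:
  assumes "finite I"
  shows "(\<Sum>(i, j)\<in>distinct2 I. F i j) = (\<Sum>(i, j)\<in>distinct2 I. F j i :: 'b::comm_monoid_add)"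
  by (rule sum.reindex_bij_witness[where i="\<lambda>(i, j). (j, i)" and j="\<lambda>(i, j). (j, i)"])
     (auto simp: distinct2_def)

text \<open>Two ordered pairs of distinct indices share no index, one index or both. A single common
  index can occupy two positions in each pair, which gives 4; two common indices can be matched in 2
  ways. Symmetry of \<open>a\<close> makes the matching terms equal.\<close>

lemma sum_distinct2_square:
  fixes a :: "'i \<Rightarrow> 'i \<Rightarrow> real"
  assumes I: "finite I" and sym: "\<And>k l. a k l = a l k"
  shows "(\<Sum>(i, j)\<in>distinct2 I. a i j)\<^sup>2 = (\<Sum>(i, j, k, l)\<in>distinct4 I. a i j * a k l)
    + 4 * (\<Sum>(i, j, k)\<in>distinct3 I. a i j * a i k) + 2 * (\<Sum>(i, j)\<in>distinct2 I. (a i j)\<^sup>2)"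
proof -
  have "(\<Sum>(i, j)\<in>distinct2 I. a i j)\<^sup>2 = (\<Sum>(i, j)\<in>distinct2 I. a i j * (\<Sum>(k, l)\<in>distinct2 I. a k l))"
    by (simp add: power2_eq_square sum_distrib_right case_prod_beta')
  also have "\<dots> = (\<Sum>(i, j)\<in>distinct2 I. a i j * (\<Sum>(k, l)\<in>distinct2 (I - {i} - {j}). a k l)
     + 2 * (\<Sum>k\<in>I - {i} - {j}. a i j * a i k) + 2 * (\<Sum>k\<in>I - {i} - {j}. a i j * a j k) + 2 * (a i j)\<^sup>2)"
  proof (intro sum.cong refl, clarify)
    fix i j assume "(i, j) \<in> distinct2 I"
    then have "i \<in> I" "j \<in> I" "i \<noteq> j" by (auto simp: distinct2_def)
    note split = distinct2_split[where a=a, OF I(1) this sym]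
    show "a i j * (\<Sum>(k, l)\<in>distinct2 I. a k l) = a i j * (\<Sum>(k, l)\<in>distinct2 (I - {i} - {j}). a k l)
     + 2 * (\<Sum>k\<in>I - {i} - {j}. a i j * a i k) + 2 * (\<Sum>k\<in>I - {i} - {j}. a i j * a j k) + 2 * (a i j)\<^sup>2"
      unfolding split sum_distrib_left[symmetric] by (simp add: algebra_simps power2_eq_square)
  qed
  also have "\<dots> = (\<Sum>(i, j)\<in>distinct2 I. a i j * (\<Sum>(k, l)\<in>distinct2 (I - {i} - {j}). a k l))
     + 2 * (\<Sum>(i, j)\<in>distinct2 I. \<Sum>k\<in>I - {i} - {j}. a i j * a i k)
     + 2 * (\<Sum>(i, j)\<in>distinct2 I. \<Sum>k\<in>I - {i} - {j}. a i j * a j k) + 2 * (\<Sum>(i, j)\<in>distinct2 I. (a i j)\<^sup>2)"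
    by (simp add: sum.distrib case_prod_beta' sum_distrib_left)
  also have "(\<Sum>(i, j)\<in>distinct2 I. \<Sum>k\<in>I - {i} - {j}. a i j * a j k) =
      (\<Sum>(i, j)\<in>distinct2 I. \<Sum>k\<in>I - {i} - {j}. a i j * a i k)"
  proof -
    have "(\<Sum>k\<in>I - {j} - {i}. a j i * a i k) = (\<Sum>k\<in>I - {i} - {j}. a i j * a i k)" for i j
    proof -
      have "I - {j} - {i} = I - {i} - {j}" by auto
      then show ?thesis by (simp only: sym[of j i])
    qed
    then show ?thesis
      using sum_distinct2_swap[OF I, of "\<lambda>i j. \<Sum>k\<in>I - {i} - {j}. a i j * a j k"] by (simp only:)
  qed
  also have "(\<Sum>(i, j)\<in>distinct2 I. \<Sum>k\<in>I - {i} - {j}. a i j * a i k) = (\<Sum>(i, j, k)\<in>distinct3 I. a i j * a i k)"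
    using I by (simp add: sum_distinct2 sum_distinct3)
  also have "(\<Sum>(i, j)\<in>distinct2 I. a i j * (\<Sum>(k, l)\<in>distinct2 (I - {i} - {j}). a k l)) =
      (\<Sum>(i, j, k, l)\<in>distinct4 I. a i j * a k l)"
    using I by (simp add: sum_distinct2 sum_distinct3 sum_distinct4 sum_distrib_left)
  finally show ?thesis by simp
qed

lemma sum_distinct2_times_sum:
  fixes a :: "'i \<Rightarrow> 'i \<Rightarrow> real"
  assumes I: "finite I" and sym: "\<And>k l. a k l = a l k"
  shows "(\<Sum>(i, j)\<in>distinct2 I. a i j) * (\<Sum>i\<in>I. b i) =
    (\<Sum>(i, j, k)\<in>distinct3 I. a i j * b k) + 2 * (\<Sum>(i, j)\<in>distinct2 I. a i j * b i)"
proof -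
  have b: "(\<Sum>k\<in>I. b k) = b i + b j + (\<Sum>k\<in>I - {i} - {j}. b k)" if "(i, j) \<in> distinct2 I" for i j
    using I that sum.remove[of I i b] sum.remove[of "I - {i}" j b] by (simp add: distinct2_def)
  have "(\<Sum>(i, j)\<in>distinct2 I. a i j) * (\<Sum>i\<in>I. b i) =
      (\<Sum>(i, j)\<in>distinct2 I. a i j * b i + a i j * b j + (\<Sum>k\<in>I - {i} - {j}. a i j * b k))"
    unfolding sum_distrib_right
  proof (intro sum.cong refl, clarify)
    fix i j assume "(i, j) \<in> distinct2 I"
    from b[OF this] show "a i j * (\<Sum>i\<in>I. b i) =
        a i j * b i + a i j * b j + (\<Sum>k\<in>I - {i} - {j}. a i j * b k)"
      by (simp add: sum_distrib_left distrib_left)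
  qed
  also have "\<dots> = (\<Sum>(i, j)\<in>distinct2 I. a i j * b i) + (\<Sum>(i, j)\<in>distinct2 I. a i j * b j)
      + (\<Sum>(i, j)\<in>distinct2 I. \<Sum>k\<in>I - {i} - {j}. a i j * b k)"
    by (simp add: sum.distrib case_prod_beta')
  also have "(\<Sum>(i, j)\<in>distinct2 I. a i j * b j) = (\<Sum>(i, j)\<in>distinct2 I. a i j * b i)"
    using sym by (subst sum_distinct2_swap[OF I]) (auto intro!: sum.cong)
  also have "(\<Sum>(i, j)\<in>distinct2 I. \<Sum>k\<in>I - {i} - {j}. a i j * b k) = (\<Sum>(i, j, k)\<in>distinct3 I. a i j * b k)"
    using I by (simp add: sum_distinct2 sum_distinct3)
  finally show ?thesis by simp
qed

lemma sum_square_distinct2: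
  fixes b :: "'i \<Rightarrow> real"
  assumes I: "finite I"
  shows "(\<Sum>i\<in>I. b i)\<^sup>2 = (\<Sum>(i, j)\<in>distinct2 I. b i * b j) + (\<Sum>i\<in>I. (b i)\<^sup>2)"
proof -
  have "(\<Sum>i\<in>I. b i)\<^sup>2 = (\<Sum>i\<in>I. b i * (\<Sum>j\<in>I. b j))"
    by (simp add: power2_eq_square sum_distrib_right)
  also have "\<dots> = (\<Sum>i\<in>I. (\<Sum>j\<in>I - {i}. b i * b j) + (b i)\<^sup>2)"
    using I by (intro sum.cong refl) (auto simp: sum.remove[of I] algebra_simps sum_distrib_left power2_eq_square)
  finally show ?thesis using I by (simp add: sum.distrib sum_distinct2)
qed

text \<open>Truncated subtraction is harmless: whenever one difference would be negative, an earlier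
  factor is already zero.\<close>

lemma card_distinct:
  assumes "finite I"
  shows "card (distinct2 I) = card I * (card I - 1)"
    and "card (distinct3 I) = card I * (card I - 1) * (card I - 2)"
    and "card (distinct4 I) = card I * (card I - 1) * (card I - 2) * (card I - 3)"
proof -
  have 2: "card (distinct2 I) = card I * (card I - 1)" if "finite I" for I :: "'a set"
    using that by (simp add: distinct2_def card_SigmaI)
  have 3: "card (distinct3 I) = card I * (card I - 1) * (card I - 2)" if "finite I" for I :: "'a set"
    using that unfolding distinct3_def by (subst card_SigmaI) (simp_all add: finite_distinct 2 numeral_2_eq_2)
  have 4: "card (distinct4 I) = card I * (card I - 1) * (card I - 2) * (card I - 3)" if "finite I" for I :: "'a set"
    using that unfolding distinct4_def by (subst card_SigmaI) (simp_all add: finite_distinct 3 numeral_2_eq_2 numeral_3_eq_3)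
  show "card (distinct2 I) = card I * (card I - 1)"
    "card (distinct3 I) = card I * (card I - 1) * (card I - 2)"
    "card (distinct4 I) = card I * (card I - 1) * (card I - 2) * (card I - 3)"
    using assms by (rule 2 3 4)+
qed

section \<open>Random finite families of points\<close>

lemma pred_finite_random:
  fixes T :: "'w \<Rightarrow> 't::countable set"
  assumes T[measurable]: "\<And>t. Measurable.pred M (\<lambda>\<omega>. t \<in> T \<omega>)"
  shows "Measurable.pred M (\<lambda>\<omega>. finite (T \<omega>))"
proof -
  have "finite (T \<omega>) \<longleftrightarrow> (\<exists>N. \<forall>t. t \<in> T \<omega> \<longrightarrow> to_nat t < N)" for \<omega>
  proof
    assume "finite (T \<omega>)"
    then show "\<exists>N. \<forall>t. t \<in> T \<omega> \<longrightarrow> to_nat t < N"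
      using finite_nat_set_iff_bounded[of "to_nat ` T \<omega>"] by auto
  next
    assume "\<exists>N. \<forall>t. t \<in> T \<omega> \<longrightarrow> to_nat t < N"
    then have "finite (to_nat ` T \<omega>)" by (auto simp: finite_nat_set_iff_bounded)
    then show "finite (T \<omega>)" by (rule finite_imageD) auto
  qed
  then show ?thesis by simp
qed

text \<open>The sum is the limit of partial sums along the enumeration of the countable index type.
  The test \<open>finite (T \<omega>)\<close> in \<open>g\<close> matches the convention that a sum
  over an infinite set is 0.\<close>

lemma borel_measurable_random_sum:
  fixes T :: "'w \<Rightarrow> 't::countable set" and F :: "'t \<Rightarrow> 'w \<Rightarrow> real"
  assumes T[measurable]: "\<And>t. Measurable.pred M (\<lambda>\<omega>. t \<in> T \<omega>)"
    and F[measurable]: "\<And>t. F t \<in> borel_measurable M"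
  shows "(\<lambda>\<omega>. \<Sum>t\<in>T \<omega>. F t \<omega>) \<in> borel_measurable M"
proof (rule borel_measurable_LIMSEQ_real)
  note [measurable] = pred_finite_random[OF T]
  define g where "g N \<omega> = (\<Sum>n<N. if finite (T \<omega>) \<and> to_nat (from_nat n :: 't) = n \<and> from_nat n \<in> T \<omega>
      then F (from_nat n) \<omega> else 0)" for N \<omega>
  show "g N \<in> borel_measurable M" for N unfolding g_def[abs_def] by measurable
  fix \<omega>
  show "(\<lambda>N. g N \<omega>) \<longlonglongrightarrow> (\<Sum>t\<in>T \<omega>. F t \<omega>)"
  proof (cases "finite (T \<omega>)")
    case False
    then show ?thesis by (simp add: g_def)
  next
    case True
    then obtain N0 where N0: "\<And>t. t \<in> T \<omega> \<Longrightarrow> to_nat t < N0"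
      using finite_nat_set_iff_bounded[of "to_nat ` T \<omega>"] by auto
    have "g N \<omega> = (\<Sum>t\<in>T \<omega>. F t \<omega>)" if "N \<ge> N0" for N
    proof -
      have "g N \<omega> = (\<Sum>n\<in>to_nat ` T \<omega>. F (from_nat n) \<omega>)"
        unfolding g_def
      proof (rule sum.mono_neutral_cong_right)
        show "to_nat ` T \<omega> \<subseteq> {..<N}" using N0 that by fastforce
        show "\<forall>n\<in>{..<N} - to_nat ` T \<omega>. (if finite (T \<omega>) \<and> to_nat (from_nat n :: 't) = n \<and> from_nat n \<in> T \<omega>
            then F (from_nat n) \<omega> else 0) = 0"
          by (auto simp: image_iff) metis
      qed (use True in auto)
      then show ?thesis by (simp add: sum.reindex)
    qed
    then show ?thesis by (intro tendsto_eventually eventually_sequentiallyI[of N0])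
  qed
qed

text \<open>The integrable bound \<open>c\<close> on the number of terms, multiplied by the sup-norm
  of the function, is the dominating function throughout.\<close>

lemma bounded_functional_random_sum:
  fixes T :: "'w \<Rightarrow> 't::countable set" and Y :: "'t \<Rightarrow> 'w \<Rightarrow> 'b::second_countable_topology"
  assumes T: "\<And>t. Measurable.pred M (\<lambda>\<omega>. t \<in> T \<omega>)"
    and Y[measurable]: "\<And>t. Y t \<in> borel_measurable M"
    and c: "integrable M c" "AE \<omega> in M. real (card (T \<omega>)) \<le> c \<omega>"
  shows "bounded_functional (\<lambda>F. \<integral>\<omega>. (\<Sum>t\<in>T \<omega>. F (Y t \<omega>)) \<partial>M)"
    and "bounded_borel F \<Longrightarrow> integrable M (\<lambda>\<omega>. \<Sum>t\<in>T \<omega>. F (Y t \<omega>))"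
proof -
  have meas: "(\<lambda>\<omega>. \<Sum>t\<in>T \<omega>. F (Y t \<omega>)) \<in> borel_measurable M" if "F \<in> borel_measurable borel" for F :: "'b \<Rightarrow> real"
    using that by (intro borel_measurable_random_sum T) auto
  have bound: "AE \<omega> in M. \<bar>\<Sum>t\<in>T \<omega>. F (Y t \<omega>)\<bar> \<le> \<bar>C\<bar> * c \<omega>" if "\<And>x. \<bar>F x\<bar> \<le> C" for F :: "'b \<Rightarrow> real" and C
    using c(2)
  proof eventually_elim
    case (elim \<omega>)
    have "\<bar>\<Sum>t\<in>T \<omega>. F (Y t \<omega>)\<bar> \<le> (\<Sum>t\<in>T \<omega>. \<bar>C\<bar>)"
      by (intro sum_abs[THEN order_trans] sum_mono order_trans[OF that abs_ge_self])
    also have "\<dots> \<le> \<bar>C\<bar> * c \<omega>" using elim by (simp add: mult.commute mult_left_mono)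
    finally show ?case .
  qed
  have int: "integrable M (\<lambda>\<omega>. \<Sum>t\<in>T \<omega>. F (Y t \<omega>))" if F: "bounded_borel F" for F
  proof -
    obtain C where C: "0 \<le> C" "\<And>x. \<bar>F x\<bar> \<le> C" using bounded_borelE[OF F] by blast
    show ?thesis
    proof (rule Bochner_Integration.integrable_bound)
      show "integrable M (\<lambda>\<omega>. \<bar>C\<bar> * c \<omega>)" using c(1) by simp
      show "(\<lambda>\<omega>. \<Sum>t\<in>T \<omega>. F (Y t \<omega>)) \<in> borel_measurable M"
        by (rule meas[OF bounded_borel_measurable[OF F]])
      show "AE \<omega> in M. norm (\<Sum>t\<in>T \<omega>. F (Y t \<omega>)) \<le> norm (\<bar>C\<bar> * c \<omega>)"
        using bound[of F, OF C(2)] by eventually_elim simp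
    qed
  qed
  then show "bounded_borel F \<Longrightarrow> integrable M (\<lambda>\<omega>. \<Sum>t\<in>T \<omega>. F (Y t \<omega>))" .
  show "bounded_functional (\<lambda>F. \<integral>\<omega>. (\<Sum>t\<in>T \<omega>. F (Y t \<omega>)) \<partial>M)"
    unfolding bounded_functional_def
  proof (intro conjI allI impI)
    fix Fn :: "nat \<Rightarrow> 'b \<Rightarrow> real" and F C
    assume *: "\<forall>n. Fn n \<in> borel_measurable borel" "\<forall>n x. \<bar>Fn n x\<bar> \<le> C" "\<forall>x. (\<lambda>n. Fn n x) \<longlonglongrightarrow> F x"
    have F: "F \<in> borel_measurable borel"
      by (rule borel_measurable_LIMSEQ_real[of _ Fn]) (use * in auto)
    show "(\<lambda>n. \<integral>\<omega>. (\<Sum>t\<in>T \<omega>. Fn n (Y t \<omega>)) \<partial>M) \<longlonglongrightarrow> (\<integral>\<omega>. (\<Sum>t\<in>T \<omega>. F (Y t \<omega>)) \<partial>M)"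
    proof (rule integral_dominated_convergence[of _ _ _ "\<lambda>\<omega>. \<bar>C\<bar> * c \<omega>"])
      show "AE \<omega> in M. norm (\<Sum>t\<in>T \<omega>. Fn n (Y t \<omega>)) \<le> \<bar>C\<bar> * c \<omega>" for n
        using bound[of "Fn n" C] * by auto
      show "AE \<omega> in M. (\<lambda>n. \<Sum>t\<in>T \<omega>. Fn n (Y t \<omega>)) \<longlonglongrightarrow> (\<Sum>t\<in>T \<omega>. F (Y t \<omega>))"
        using * by (auto intro!: tendsto_sum AE_I2)
    qed (use * F c meas in auto)
  qed (simp_all add: sum.distrib sum_distrib_left[symmetric] int)
qed

section \<open>Moments of the number of points in a window\<close>

locale point_process = prob_space M
  for M :: "'w measure" and X :: "nat \<Rightarrow> 'w \<Rightarrow> 'a::euclidean_space" and J :: "'w \<Rightarrow> nat set" +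
  assumes simple: "simple_point_process M X J"
    and stationary: "kth_order_stationary M X J 4"
begin

definition pts :: "'a set \<Rightarrow> 'w \<Rightarrow> nat set" where
  "pts W \<omega> = {i \<in> J \<omega>. X i \<omega> \<in> W}"

lemma X_measurable [measurable]: "X i \<in> borel_measurable M"
  using simple by (simp add: simple_point_process_def)

lemma J_measurable [measurable]: "Measurable.pred M (\<lambda>\<omega>. i \<in> J \<omega>)"
  using simple by (simp add: simple_point_process_def pred_def)

lemma pred_pts: "W \<in> sets borel \<Longrightarrow> Measurable.pred M (\<lambda>\<omega>. i \<in> pts W \<omega>)"
  by (simp add: pts_def)

lemma AE_finite_pts:
  assumes "bounded W" shows "AE \<omega> in M. finite (pts W \<omega>)"
proof -
  have "AE \<omega> in M. \<forall>C. compact C \<longrightarrow> finite {i \<in> J \<omega>. X i \<omega> \<in> C}"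
    using simple by (simp add: simple_point_process_def)
  then show ?thesis
  proof eventually_elim
    case (elim \<omega>)
    then have "finite {i \<in> J \<omega>. X i \<omega> \<in> closure W}" using assms by simp
    then show ?case by (rule finite_subset[rotated]) (use closure_subset in \<open>auto simp: pts_def\<close>)
  qed
qed

text \<open>Injections that leave \<open>pts W \<omega>\<close> contribute 0 because every
  \<open>A l\<close> lies in \<open>W\<close>, so the integral over a possibly infinite index set is
  a finite sum.\<close>

lemma nn_integral_injections:
  assumes K: "finite K" and fin: "finite (pts W \<omega>)" and A: "\<And>l. l \<in> K \<Longrightarrow> A l \<subseteq> W"
  shows "(\<integral>\<^sup>+\<iota>. (\<Prod>l\<in>K. indicator (A l) (X (\<iota> l) \<omega>)) \<partial>count_space {\<iota> \<in> K \<rightarrow>\<^sub>E J \<omega>. inj_on \<iota> K}) =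
    ennreal (\<Sum>\<iota>\<in>{\<iota>\<in>K \<rightarrow>\<^sub>E pts W \<omega>. inj_on \<iota> K}. \<Prod>l\<in>K. indicator (A l) (X (\<iota> l) \<omega>))"
proof -
  let ?T = "{\<iota>\<in>K \<rightarrow>\<^sub>E pts W \<omega>. inj_on \<iota> K}"
  have finT: "finite ?T" using finite_PiE[OF K, of "\<lambda>_. pts W \<omega>"] fin by simp
  have sub: "?T \<subseteq> {\<iota> \<in> K \<rightarrow>\<^sub>E J \<omega>. inj_on \<iota> K}"
    by (auto simp: pts_def PiE_def Pi_def)
  have "(\<integral>\<^sup>+\<iota>. (\<Prod>l\<in>K. indicator (A l) (X (\<iota> l) \<omega>)) \<partial>count_space {\<iota> \<in> K \<rightarrow>\<^sub>E J \<omega>. inj_on \<iota> K}) =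
    (\<Sum>\<iota>\<in>?T. \<Prod>l\<in>K. indicator (A l) (X (\<iota> l) \<omega>))"
  proof (rule nn_integral_count_space'[OF finT])
    fix \<iota> assume *: "\<iota> \<in> {\<iota> \<in> K \<rightarrow>\<^sub>E J \<omega>. inj_on \<iota> K}" "\<iota> \<notin> ?T"
    then obtain l where l: "l \<in> K" "\<iota> l \<notin> pts W \<omega>" by (auto simp: PiE_def Pi_def)
    then have "X (\<iota> l) \<omega> \<notin> A l" using * A by (auto simp: pts_def PiE_def Pi_def)
    with l K show "(\<Prod>l\<in>K. indicator (A l) (X (\<iota> l) \<omega>)) = (0::ennreal)" by (auto intro!: prod_zero bexI[of _ l])
  qed (rule sub)
  also have "\<dots> = (\<Sum>\<iota>\<in>?T. ennreal (\<Prod>l\<in>K. indicator (A l) (X (\<iota> l) \<omega>)))"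
    by (intro sum.cong refl) (simp add: prod_ennreal[symmetric] ennreal_indicator)
  finally show ?thesis by (simp add: sum_ennreal prod_nonneg)
qed

lemma factorial_moment_window:
  assumes K: "finite K" and W: "bounded W" and A: "\<And>l. l \<in> K \<Longrightarrow> A l \<subseteq> W"
  shows "factorial_moment M X J K A =
    (\<integral>\<^sup>+\<omega>. ennreal (\<Sum>\<iota>\<in>{\<iota>\<in>K \<rightarrow>\<^sub>E pts W \<omega>. inj_on \<iota> K}. \<Prod>l\<in>K. indicator (A l) (X (\<iota> l) \<omega>)) \<partial>M)"
  unfolding factorial_moment_def using AE_finite_pts[OF W]
  by (intro nn_integral_cong_AE) (auto simp: nn_integral_injections[OF K _ A])

section \<open>Factorial moments of orders one to four as expectations of finite sums\<close>

lemma pred_distinct: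
  assumes "W \<in> sets borel"
  shows "Measurable.pred M (\<lambda>\<omega>. t2 \<in> distinct2 (pts W \<omega>))"
    and "Measurable.pred M (\<lambda>\<omega>. t3 \<in> distinct3 (pts W \<omega>))"
    and "Measurable.pred M (\<lambda>\<omega>. t4 \<in> distinct4 (pts W \<omega>))"
proof -
  note [measurable] = pred_pts[OF assms]
  show "Measurable.pred M (\<lambda>\<omega>. t2 \<in> distinct2 (pts W \<omega>))"
    by (cases t2) (simp add: distinct2_def)
  show "Measurable.pred M (\<lambda>\<omega>. t3 \<in> distinct3 (pts W \<omega>))"
    by (cases t3) (simp add: distinct2_def distinct3_def)
  show "Measurable.pred M (\<lambda>\<omega>. t4 \<in> distinct4 (pts W \<omega>))"
    by (cases t4) (simp add: distinct2_def distinct3_def distinct4_def)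
qed

definition X2 :: "nat \<times> nat \<Rightarrow> 'w \<Rightarrow> 'a \<times> 'a" where
  "X2 t \<omega> = (X (fst t) \<omega>, X (snd t) \<omega>)"
definition X3 :: "nat \<times> nat \<times> nat \<Rightarrow> 'w \<Rightarrow> 'a \<times> 'a \<times> 'a" where
  "X3 t \<omega> = (X (fst t) \<omega>, X2 (snd t) \<omega>)"
definition X4 :: "nat \<times> nat \<times> nat \<times> nat \<Rightarrow> 'w \<Rightarrow> 'a \<times> 'a \<times> 'a \<times> 'a" where
  "X4 t \<omega> = (X (fst t) \<omega>, X3 (snd t) \<omega>)"

lemma X234_measurable [measurable]:
  "X2 t2 \<in> borel_measurable M" "X3 t3 \<in> borel_measurable M" "X4 t4 \<in> borel_measurable M"
  unfolding X4_def[abs_def] X3_def[abs_def] X2_def[abs_def] by (simp_all flip: borel_prod)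

lemma factorial_moment_1:
  assumes W: "bounded W" and A: "A a \<subseteq> W"
  shows "factorial_moment M X J {a} A = (\<integral>\<^sup>+\<omega>. ennreal (\<Sum>i\<in>pts W \<omega>. indicator (A a) (X i \<omega>)) \<partial>M)"
proof -
  have "factorial_moment M X J {a} A =
    (\<integral>\<^sup>+\<omega>. ennreal (\<Sum>\<iota>\<in>{\<iota>\<in>{a} \<rightarrow>\<^sub>E pts W \<omega>. inj_on \<iota> {a}}. \<Prod>l\<in>{a}. indicator (A l) (X (\<iota> l) \<omega>)) \<partial>M)"
    by (rule factorial_moment_window[OF _ W]) (use A in auto)
  also have "\<dots> = (\<integral>\<^sup>+\<omega>. ennreal (\<Sum>i\<in>pts W \<omega>. indicator (A a) (X i \<omega>)) \<partial>M)"
    using AE_finite_pts[OF W]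
    by (intro nn_integral_cong_AE, eventually_elim)
       (simp only: sum_inj_PiE_1[where w="\<lambda>l i. indicator (A l) (X i _)"])
  finally show ?thesis .
qed

lemma factorial_moment_2:
  assumes W: "bounded W" and A: "A a \<subseteq> W" "A b \<subseteq> W" and ab: "a \<noteq> b"
  shows "factorial_moment M X J {a, b} A =
    (\<integral>\<^sup>+\<omega>. ennreal (\<Sum>t\<in>distinct2 (pts W \<omega>). case X2 t \<omega> of (x, y) \<Rightarrow> indicator (A a) x * indicator (A b) y) \<partial>M)"
proof -
  have "factorial_moment M X J {a, b} A =
    (\<integral>\<^sup>+\<omega>. ennreal (\<Sum>\<iota>\<in>{\<iota>\<in>{a, b} \<rightarrow>\<^sub>E pts W \<omega>. inj_on \<iota> {a, b}}. \<Prod>l\<in>{a, b}. indicator (A l) (X (\<iota> l) \<omega>)) \<partial>M)"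
    by (rule factorial_moment_window[OF _ W]) (use A in auto)
  also have "\<dots> = (\<integral>\<^sup>+\<omega>. ennreal (\<Sum>(i, j)\<in>distinct2 (pts W \<omega>). indicator (A a) (X i \<omega>) * indicator (A b) (X j \<omega>)) \<partial>M)"
    using AE_finite_pts[OF W]
    by (intro nn_integral_cong_AE, eventually_elim)
       (simp only: sum_inj_PiE_2[where w="\<lambda>l i. indicator (A l) (X i _)", OF _ ab])
  finally show ?thesis by (simp add: X2_def case_prod_beta')
qed

lemma factorial_moment_3:
  assumes W: "bounded W" and A: "A a \<subseteq> W" "A b \<subseteq> W" "A c \<subseteq> W" and ab: "distinct [a, b, c]"
  shows "factorial_moment M X J {a, b, c} A =
    (\<integral>\<^sup>+\<omega>. ennreal (\<Sum>t\<in>distinct3 (pts W \<omega>). case X3 t \<omega> of (x, y, z) \<Rightarrow> indicator (A a) x * (indicator (A b) y * indicator (A c) z)) \<partial>M)"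
proof -
  have "factorial_moment M X J {a, b, c} A =
    (\<integral>\<^sup>+\<omega>. ennreal (\<Sum>\<iota>\<in>{\<iota>\<in>{a, b, c} \<rightarrow>\<^sub>E pts W \<omega>. inj_on \<iota> {a, b, c}}. \<Prod>l\<in>{a, b, c}. indicator (A l) (X (\<iota> l) \<omega>)) \<partial>M)"
    by (rule factorial_moment_window[OF _ W]) (use A in auto)
  also have "\<dots> = (\<integral>\<^sup>+\<omega>. ennreal (\<Sum>(i, j, k)\<in>distinct3 (pts W \<omega>). indicator (A a) (X i \<omega>) * (indicator (A b) (X j \<omega>) * indicator (A c) (X k \<omega>))) \<partial>M)"
    using AE_finite_pts[OF W]
    by (intro nn_integral_cong_AE, eventually_elim)
       (simp only: sum_inj_PiE_3[where w="\<lambda>l i. indicator (A l) (X i _)", OF _ ab])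
  finally show ?thesis by (simp add: X3_def X2_def case_prod_beta')
qed

lemma factorial_moment_4:
  assumes W: "bounded W" and A: "A a \<subseteq> W" "A b \<subseteq> W" "A c \<subseteq> W" "A d \<subseteq> W" and ab: "distinct [a, b, c, d]"
  shows "factorial_moment M X J {a, b, c, d} A =
    (\<integral>\<^sup>+\<omega>. ennreal (\<Sum>t\<in>distinct4 (pts W \<omega>). case X4 t \<omega> of (x, y, z, w) \<Rightarrow>
       indicator (A a) x * (indicator (A b) y * (indicator (A c) z * indicator (A d) w))) \<partial>M)"
proof -
  have "factorial_moment M X J {a, b, c, d} A =
    (\<integral>\<^sup>+\<omega>. ennreal (\<Sum>\<iota>\<in>{\<iota>\<in>{a, b, c, d} \<rightarrow>\<^sub>E pts W \<omega>. inj_on \<iota> {a, b, c, d}}. \<Prod>l\<in>{a, b, c, d}. indicator (A l) (X (\<iota> l) \<omega>)) \<partial>M)"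
    by (rule factorial_moment_window[OF _ W]) (use A in auto)
  also have "\<dots> = (\<integral>\<^sup>+\<omega>. ennreal (\<Sum>(i, j, k, l)\<in>distinct4 (pts W \<omega>). indicator (A a) (X i \<omega>) * (indicator (A b) (X j \<omega>) * (indicator (A c) (X k \<omega>) * indicator (A d) (X l \<omega>)))) \<partial>M)"
    using AE_finite_pts[OF W]
    by (intro nn_integral_cong_AE, eventually_elim)
       (simp only: sum_inj_PiE_4[where w="\<lambda>l i. indicator (A l) (X i _)", OF _ ab])
  finally show ?thesis by (simp add: X4_def X3_def X2_def case_prod_beta')
qed

section \<open>Finite fourth moments of the counts in bounded sets\<close>

lemma Icc_1_4: "{1..4} = {1, 2, 3, 4::nat}" and Icc_1_3: "{1..3} = {1, 2, 3::nat}" and Icc_1_2: "{1..2} = {1, 2::nat}"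
  by auto

lemma factorial_moment_card4:
  assumes "bounded Q"
  shows "factorial_moment M X J {1..4} (\<lambda>_. Q) = (\<integral>\<^sup>+\<omega>. ennreal (real (card (distinct4 (pts Q \<omega>)))) \<partial>M)"
proof -
  have "(\<Sum>t\<in>distinct4 (pts Q \<omega>). case X4 t \<omega> of (x, y, z, w) \<Rightarrow>
       indicator Q x * (indicator Q y * (indicator Q z * indicator Q w))) = real (card (distinct4 (pts Q \<omega>)))" for \<omega>
    by (subst real_of_card, rule sum.cong)
       (auto simp: distinct4_def distinct3_def distinct2_def pts_def X4_def X3_def X2_def)
  with factorial_moment_4[OF assms, of "\<lambda>_. Q" 1 2 3 4] show ?thesis by (simp only: Icc_1_4) simp
qed

text \<open>The fourth power dominates the number of ordered k-tuples of distinct points for every k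
  from 1 to 4, so one condition serves all orders.\<close>

definition moment4_finite :: "'a set \<Rightarrow> bool" where
  "moment4_finite Q \<longleftrightarrow> (\<integral>\<^sup>+\<omega>. ennreal (real (card (pts Q \<omega>)) ^ 4) \<partial>M) < \<infinity>"

lemma card_pts_measurable:
  assumes "Q \<in> sets borel"
  shows "(\<lambda>\<omega>. real (card (pts Q \<omega>))) \<in> borel_measurable M"
  using borel_measurable_random_sum[where M=M and T="pts Q" and F="\<lambda>_ _. 1"] pred_pts[OF assms] by simp

lemma moment4_finiteI:
  assumes Q: "bounded Q" "Q \<in> sets borel" and fin: "factorial_moment M X J {1..4} (\<lambda>_. Q) < \<infinity>"
  shows "moment4_finite Q"
proof -
  \<comment> \<open>256 is \<open>4 ^ 4\<close>, for counts up to 4. Beyond that \<open>n\<close> is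
    at most 2, 2 and 4 times the last three factors, and the product of these constants is
    16.\<close>
  have nat: "n ^ 4 \<le> 256 + 16 * (n * (n - 1) * (n - 2) * (n - 3))" for n :: nat
  proof (cases "n \<le> 4")
    case True
    then have "n ^ 4 \<le> 4 ^ 4" by (rule power_mono) simp
    then show ?thesis by simp
  next
    case False
    then have "n \<le> 2 * (n - 1)" "n \<le> 2 * (n - 2)" "n \<le> 4 * (n - 3)" by auto
    then have "n * n * n * n \<le> n * (2 * (n - 1)) * (2 * (n - 2)) * (4 * (n - 3))" by (intro mult_mono) auto
    then show ?thesis by (simp add: power4_eq_xxxx algebra_simps)
  qed
  let ?c = "\<lambda>\<omega>. real (card (distinct4 (pts Q \<omega>)))"
  have c: "AE \<omega> in M. ennreal (real (card (pts Q \<omega>)) ^ 4) \<le> 256 + 16 * ennreal (?c \<omega>)"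
    using AE_finite_pts[OF Q(1)]
  proof eventually_elim
    case (elim \<omega>)
    have "real (card (pts Q \<omega>)) ^ 4 \<le> 256 + 16 * ?c \<omega>"
      using of_nat_mono[OF nat[of "card (pts Q \<omega>)"], where ?'a=real]
      by (simp add: card_distinct(3)[OF elim])
    then have "ennreal (real (card (pts Q \<omega>)) ^ 4) \<le> ennreal (256 + 16 * ?c \<omega>)" by (rule ennreal_leI)
    then show ?case by (simp add: ennreal_mult)
  qed
  have m: "?c \<in> borel_measurable M"
    using borel_measurable_random_sum[where M=M and T="\<lambda>\<omega>. distinct4 (pts Q \<omega>)" and F="\<lambda>_ _. 1"] pred_distinct(3)[OF Q(2)] by simp
  have "(\<integral>\<^sup>+\<omega>. ennreal (real (card (pts Q \<omega>)) ^ 4) \<partial>M) \<le> (\<integral>\<^sup>+\<omega>. 256 + 16 * ennreal (?c \<omega>) \<partial>M)"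
    using c by (rule nn_integral_mono_AE)
  also have "\<dots> = 256 + 16 * (\<integral>\<^sup>+\<omega>. ennreal (?c \<omega>) \<partial>M)"
    using m by (simp add: nn_integral_add nn_integral_cmult emeasure_space_1)
  also have "\<dots> < \<infinity>"
    using fin unfolding factorial_moment_card4[OF Q(1)] by (simp add: ennreal_mult_less_top)
  finally show ?thesis by (simp add: moment4_finite_def)
qed

lemma moment4_finite_mono:
  assumes "moment4_finite Q" "bounded Q" "W \<subseteq> Q"
  shows "moment4_finite W"
proof -
  have "(\<integral>\<^sup>+\<omega>. ennreal (real (card (pts W \<omega>)) ^ 4) \<partial>M) \<le> (\<integral>\<^sup>+\<omega>. ennreal (real (card (pts Q \<omega>)) ^ 4) \<partial>M)"
    using AE_finite_pts[OF assms(2)]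
  proof (intro nn_integral_mono_AE, eventually_elim)
    case (elim \<omega>)
    have "card (pts W \<omega>) \<le> card (pts Q \<omega>)"
      by (rule card_mono[OF elim(2)]) (use assms(3) in \<open>auto simp: pts_def\<close>)
    then show ?case by (intro ennreal_leI power_mono) auto
  qed
  then show ?thesis using assms(1) by (simp add: moment4_finite_def less_le_trans le_less_trans)
qed

lemma moment4_finite_Un:
  assumes "moment4_finite P" "moment4_finite Q" "P \<in> sets borel" "Q \<in> sets borel"
  shows "moment4_finite (P \<union> Q)"
proof -
  have "(\<integral>\<^sup>+\<omega>. ennreal (real (card (pts (P \<union> Q) \<omega>)) ^ 4) \<partial>M) \<le>
      (\<integral>\<^sup>+\<omega>. 8 * ennreal (real (card (pts P \<omega>)) ^ 4) + 8 * ennreal (real (card (pts Q \<omega>)) ^ 4) \<partial>M)"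
  proof (rule nn_integral_mono)
    fix \<omega>
    \<comment> \<open>Applied twice, to \<open>x\<close>, \<open>y\<close> and to their squares,
      this gives the constant 8 in the fourth-power inequality.\<close>
    have sq: "(x + y)\<^sup>2 \<le> 2 * (x\<^sup>2 + y\<^sup>2)" for x y :: real
      using sum_squares_bound[of x y] by (simp add: power2_sum)
    have p4: "(x + y) ^ 4 \<le> 8 * x ^ 4 + 8 * y ^ 4" for x y :: real
    proof -
      have "((x + y)\<^sup>2)\<^sup>2 \<le> (2 * (x\<^sup>2 + y\<^sup>2))\<^sup>2" by (rule power_mono[OF sq]) simp
      also have "\<dots> = 4 * (x\<^sup>2 + y\<^sup>2)\<^sup>2" by (simp only: power_mult_distrib) simp
      also have "\<dots> \<le> 4 * (2 * ((x\<^sup>2)\<^sup>2 + (y\<^sup>2)\<^sup>2))" using sq[of "x\<^sup>2" "y\<^sup>2"] by simp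
      finally show ?thesis by simp
    qed
    have "pts (P \<union> Q) \<omega> = pts P \<omega> \<union> pts Q \<omega>" by (auto simp: pts_def)
    then have "real (card (pts (P \<union> Q) \<omega>)) \<le> real (card (pts P \<omega>)) + real (card (pts Q \<omega>))"
      using card_Un_le[of "pts P \<omega>" "pts Q \<omega>"] by simp
    then have "real (card (pts (P \<union> Q) \<omega>)) ^ 4 \<le> (real (card (pts P \<omega>)) + real (card (pts Q \<omega>))) ^ 4"
      by (intro power_mono) auto
    also note p4
    finally have "ennreal (real (card (pts (P \<union> Q) \<omega>)) ^ 4) \<le>
       ennreal (8 * real (card (pts P \<omega>)) ^ 4 + 8 * real (card (pts Q \<omega>)) ^ 4)" by (rule ennreal_leI)
    then show "ennreal (real (card (pts (P \<union> Q) \<omega>)) ^ 4) \<le>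
      8 * ennreal (real (card (pts P \<omega>)) ^ 4) + 8 * ennreal (real (card (pts Q \<omega>)) ^ 4)"
      by (simp add: ennreal_mult)
  qed
  also have "\<dots> = 8 * (\<integral>\<^sup>+\<omega>. ennreal (real (card (pts P \<omega>)) ^ 4) \<partial>M) + 8 * (\<integral>\<^sup>+\<omega>. ennreal (real (card (pts Q \<omega>)) ^ 4) \<partial>M)"
    using card_pts_measurable[OF assms(3)] card_pts_measurable[OF assms(4)]
    by (simp add: nn_integral_add nn_integral_cmult)
  also have "\<dots> < \<infinity>" using assms by (simp add: moment4_finite_def ennreal_mult_less_top)
  finally show ?thesis by (simp add: moment4_finite_def)
qed

lemma unit_cube_alt: "(unit_cube :: 'a set) = (\<Inter>b\<in>Basis. {x. 0 \<le> x \<bullet> b} \<inter> {x. x \<bullet> b < 1})"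
  by (auto simp: unit_cube_def)

lemma unit_cube_borel [measurable]: "(unit_cube :: 'a set) \<in> sets borel"
  unfolding unit_cube_alt by (intro sets.finite_INT) auto

lemma bounded_unit_cube: "bounded (unit_cube :: 'a set)"
proof (rule bounded_subset[OF bounded_cbox])
  show "unit_cube \<subseteq> cbox 0 (One :: 'a)" by (auto simp: unit_cube_def mem_box less_imp_le)
qed

lemma emeasure_atom_measure:
  assumes "Q \<in> sets borel"
  shows "emeasure (atom_measure X J \<omega>) Q = emeasure (count_space UNIV) (pts Q \<omega>)"
proof -
  have "emeasure (atom_measure X J \<omega>) Q = emeasure (count_space (J \<omega>)) (pts Q \<omega>)"
    unfolding atom_measure_def using assms
    by (subst emeasure_distr) (auto simp: pts_def intro!: arg_cong2[where f=emeasure])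
  also have "\<dots> = emeasure (count_space UNIV) (pts Q \<omega>)"
    by (cases "finite (pts Q \<omega>)") (auto simp: emeasure_count_space pts_def)
  finally show ?thesis .
qed

lemma moment4_finite_unit_cube: "moment4_finite unit_cube"
proof -
  have "(\<integral>\<^sup>+\<omega>. emeasure (atom_measure X J \<omega>) unit_cube ^ 4 \<partial>M) < \<infinity>"
    using stationary by (simp add: kth_order_stationary_def)
  also have "(\<integral>\<^sup>+\<omega>. emeasure (atom_measure X J \<omega>) unit_cube ^ 4 \<partial>M) =
      (\<integral>\<^sup>+\<omega>. ennreal (real (card (pts unit_cube \<omega>)) ^ 4) \<partial>M)"
    using AE_finite_pts[OF bounded_unit_cube]
    by (intro nn_integral_cong_AE, eventually_elim)
       (simp add: emeasure_atom_measure ennreal_of_nat_eq_real_of_nat ennreal_power)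
  finally show ?thesis by (simp add: moment4_finite_def)
qed

lemma factorial_moment_shift:
  assumes "j \<in> {1..4}" "\<And>l. l \<in> {1..j} \<Longrightarrow> A l \<in> sets borel"
  shows "factorial_moment M X J {1..j} (\<lambda>l. (\<lambda>y. y + x) ` A l) = factorial_moment M X J {1..j} A"
  using stationary assms unfolding kth_order_stationary_def by blast

lemma shift_borel: "A \<in> sets borel \<Longrightarrow> (\<lambda>y. y + x) ` A \<in> sets (borel :: 'a measure)"
proof -
  assume A: "A \<in> sets borel"
  have "(\<lambda>y. y + x) ` A = (\<lambda>y. y - x) -` A \<inter> space borel"
    by (auto intro: image_eqI[of _ _ "_ - x"])
  then show ?thesis using measurable_sets[OF _ A, of "\<lambda>y. y - x" borel] by simp
qed

text \<open>Stationarity is available for factorial moment measures only. The fourth moment of the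
  unit cube therefore bounds the fourth factorial moment, which is shift invariant, and
  \<open>moment4_finiteI\<close> returns to the fourth moment of the translate.\<close>

lemma moment4_finite_shifted_cube: "moment4_finite ((\<lambda>y. y + x) ` unit_cube)"
proof -
  have "factorial_moment M X J {1..4} (\<lambda>_. unit_cube) = (\<integral>\<^sup>+\<omega>. ennreal (real (card (distinct4 (pts unit_cube \<omega>)))) \<partial>M)"
    by (rule factorial_moment_card4[OF bounded_unit_cube])
  also have "\<dots> \<le> (\<integral>\<^sup>+\<omega>. ennreal (real (card (pts unit_cube \<omega>)) ^ 4) \<partial>M)"
    using AE_finite_pts[OF bounded_unit_cube]
  proof (intro nn_integral_mono_AE, eventually_elim)
    case (elim \<omega>)
    let ?n = "card (pts unit_cube \<omega>)"
    have "?n * (?n - 1) * (?n - 2) * (?n - 3) \<le> ?n * ?n * ?n * ?n" by (intro mult_mono) auto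
    then have "card (distinct4 (pts unit_cube \<omega>)) \<le> ?n ^ 4"
      using card_distinct(3)[OF elim(2)] by (simp add: power4_eq_xxxx)
    then have "real (card (distinct4 (pts unit_cube \<omega>))) \<le> real (?n ^ 4)" by (rule of_nat_mono)
    then show ?case by (intro ennreal_leI) simp
  qed
  also have "\<dots> < \<infinity>" using moment4_finite_unit_cube by (simp add: moment4_finite_def)
  finally have "factorial_moment M X J {1..4} (\<lambda>_. (\<lambda>y. y + x) ` unit_cube) < \<infinity>"
    using factorial_moment_shift[of 4 "\<lambda>_. unit_cube"] by simp
  moreover have "bounded ((\<lambda>y. y + x) ` (unit_cube :: 'a set))"
    using bounded_translation[OF bounded_unit_cube, of x] by (simp add: add.commute)
  ultimately show ?thesis by (intro moment4_finiteI) (auto intro: shift_borel)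
qed

text \<open>The compact closure is covered by finitely many translated cubes. Open boxes serve for
  compactness, and each lies in the corresponding half-open cube.\<close>

lemma moment4_finite_bounded:
  assumes "bounded W" shows "moment4_finite W"
proof -
  let ?Q = "\<lambda>x. (\<lambda>y. y + x) ` (unit_cube :: 'a set)"
  have "compact (closure W)" using assms by simp
  moreover have "closure W \<subseteq> (\<Union>x\<in>UNIV. box x (x + One))"
  proof
    fix z :: 'a
    have "z \<in> box (z - (1/2) *\<^sub>R One) (z - (1/2) *\<^sub>R One + One)" by (auto simp: mem_box algebra_simps)
    then show "z \<in> (\<Union>x\<in>UNIV. box x (x + One))" by blast
  qed
  ultimately obtain S where S: "finite S" "closure W \<subseteq> (\<Union>x\<in>S. box x (x + One :: 'a))"
    by (elim compactE_image[where f="\<lambda>x. box x (x + One)"]) auto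
  have box: "box x (x + One) \<subseteq> ?Q x" for x
  proof
    fix z assume "z \<in> box x (x + One)"
    then have "z - x \<in> unit_cube" by (auto simp: unit_cube_def mem_box algebra_simps less_imp_le)
    then show "z \<in> ?Q x" by (intro image_eqI[of _ _ "z - x"]) auto
  qed
  have b: "bounded (\<Union>x\<in>S. ?Q x)"
    using S(1) bounded_translation[OF bounded_unit_cube] by (auto simp: add.commute)
  have "moment4_finite (\<Union>x\<in>S. ?Q x)"
    using S(1)
  proof (induction S rule: finite_induct)
    case empty
    show ?case by (simp add: moment4_finite_def pts_def)
  next
    case (insert x S)
    have "(\<Union>x\<in>S. ?Q x) \<in> sets borel" using insert by (intro sets.finite_UN) (auto intro: shift_borel)
    then show ?case using insert moment4_finite_shifted_cube[of x]
      by (simp only: UN_insert) (intro moment4_finite_Un, auto intro: shift_borel)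
  qed
  moreover have "W \<subseteq> (\<Union>x\<in>S. ?Q x)" using S(2) box closure_subset by blast
  ultimately show ?thesis by (rule moment4_finite_mono[OF _ b])
qed

section \<open>Integration against the factorial moment measures of a window\<close>

lemma integrable_card4:
  assumes "bounded W" "W \<in> sets borel"
  shows "integrable M (\<lambda>\<omega>. real (card (pts W \<omega>)) ^ 4)"
  using moment4_finite_bounded[OF assms(1)] card_pts_measurable[OF assms(2)]
  by (intro integrableI_bounded) (simp_all add: moment4_finite_def)

text \<open>\<open>avg1\<close> to \<open>avg4\<close> are the integrals of \<open>F\<close> against
  the factorial moment measures of orders one to four, restricted to the powers of the
  window.\<close>

definition avg1 :: "'a set \<Rightarrow> ('a \<Rightarrow> real) \<Rightarrow> real" where
  "avg1 W F = (\<integral>\<omega>. (\<Sum>t\<in>pts W \<omega>. F (X t \<omega>)) \<partial>M)"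
definition avg2 :: "'a set \<Rightarrow> ('a \<times> 'a \<Rightarrow> real) \<Rightarrow> real" where
  "avg2 W F = (\<integral>\<omega>. (\<Sum>t\<in>distinct2 (pts W \<omega>). F (X2 t \<omega>)) \<partial>M)"
definition avg3 :: "'a set \<Rightarrow> ('a \<times> 'a \<times> 'a \<Rightarrow> real) \<Rightarrow> real" where
  "avg3 W F = (\<integral>\<omega>. (\<Sum>t\<in>distinct3 (pts W \<omega>). F (X3 t \<omega>)) \<partial>M)"
definition avg4 :: "'a set \<Rightarrow> ('a \<times> 'a \<times> 'a \<times> 'a \<Rightarrow> real) \<Rightarrow> real" where
  "avg4 W F = (\<integral>\<omega>. (\<Sum>t\<in>distinct4 (pts W \<omega>). F (X4 t \<omega>)) \<partial>M)"

lemma AE_card_distinct_le: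
  assumes "bounded W"
  shows "AE \<omega> in M. real (card (pts W \<omega>)) \<le> real (card (pts W \<omega>)) ^ 4"
    and "AE \<omega> in M. real (card (distinct2 (pts W \<omega>))) \<le> real (card (pts W \<omega>)) ^ 4"
    and "AE \<omega> in M. real (card (distinct3 (pts W \<omega>))) \<le> real (card (pts W \<omega>)) ^ 4"
    and "AE \<omega> in M. real (card (distinct4 (pts W \<omega>))) \<le> real (card (pts W \<omega>)) ^ 4"
proof -
  have pow: "real n ^ k \<le> real n ^ 4" if "1 \<le> k" "k \<le> 4" for n k
  proof (cases "n = 0")
    case False
    then show ?thesis using that by (intro power_increasing) auto
  qed (use that in \<open>simp add: zero_power\<close>)
  have le: "real (n * (n - 1)) \<le> real n ^ 2" "real (n * (n - 1) * (n - 2)) \<le> real n ^ 3"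
    "real (n * (n - 1) * (n - 2) * (n - 3)) \<le> real n ^ 4" for n
    unfolding of_nat_mult power2_eq_square power3_eq_cube power4_eq_xxxx by (intro mult_mono; simp)+
  show "AE \<omega> in M. real (card (pts W \<omega>)) \<le> real (card (pts W \<omega>)) ^ 4"
    using pow[of 1] by simp
  note fin = AE_finite_pts[OF assms]
  show "AE \<omega> in M. real (card (distinct2 (pts W \<omega>))) \<le> real (card (pts W \<omega>)) ^ 4"
    using fin by eventually_elim (simp only: card_distinct, rule order_trans[OF le(1) pow], simp_all)
  show "AE \<omega> in M. real (card (distinct3 (pts W \<omega>))) \<le> real (card (pts W \<omega>)) ^ 4"
    using fin by eventually_elim (simp only: card_distinct, rule order_trans[OF le(2) pow], simp_all)
  show "AE \<omega> in M. real (card (distinct4 (pts W \<omega>))) \<le> real (card (pts W \<omega>)) ^ 4"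
    using fin by eventually_elim (simp only: card_distinct, rule le(3))
qed

lemma bounded_functional_avg:
  assumes W: "bounded W" "W \<in> sets borel"
  shows "bounded_functional (avg1 W)" "bounded_functional (avg2 W)"
    "bounded_functional (avg3 W)" "bounded_functional (avg4 W)"
  unfolding avg1_def[abs_def] avg2_def[abs_def] avg3_def[abs_def] avg4_def[abs_def]
  by (rule bounded_functional_random_sum(1)[OF _ _ integrable_card4[OF W]];
      use pred_pts[OF W(2)] pred_distinct[OF W(2)] AE_card_distinct_le[OF W(1)] in simp)+

lemma integrable_random_sums:
  assumes W: "bounded W" "W \<in> sets borel"
  shows "bounded_borel F1 \<Longrightarrow> integrable M (\<lambda>\<omega>. \<Sum>t\<in>pts W \<omega>. F1 (X t \<omega>))"
    and "bounded_borel F2 \<Longrightarrow> integrable M (\<lambda>\<omega>. \<Sum>t\<in>distinct2 (pts W \<omega>). F2 (X2 t \<omega>))"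
    and "bounded_borel F3 \<Longrightarrow> integrable M (\<lambda>\<omega>. \<Sum>t\<in>distinct3 (pts W \<omega>). F3 (X3 t \<omega>))"
    and "bounded_borel F4 \<Longrightarrow> integrable M (\<lambda>\<omega>. \<Sum>t\<in>distinct4 (pts W \<omega>). F4 (X4 t \<omega>))"
  by (rule bounded_functional_random_sum(2)[OF _ _ integrable_card4[OF W]];
      use pred_pts[OF W(2)] pred_distinct[OF W(2)] AE_card_distinct_le[OF W(1)] in simp)+

lemma factorial_moment_avg:
  assumes W: "bounded W" "W \<in> sets borel" and A: "\<And>l. l \<in> {a, b, c, d} \<Longrightarrow> A l \<in> sets borel \<and> A l \<subseteq> W"
  shows "enn2real (factorial_moment M X J {a} A) = avg1 W (indicator (A a))"
    and "a \<noteq> b \<Longrightarrow> enn2real (factorial_moment M X J {a, b} A) =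
      avg2 W (\<lambda>(x, y). indicator (A a) x * indicator (A b) y)"
    and "distinct [a, b, c] \<Longrightarrow> enn2real (factorial_moment M X J {a, b, c} A) =
      avg3 W (\<lambda>(x, y, z). indicator (A a) x * (indicator (A b) y * indicator (A c) z))"
    and "distinct [a, b, c, d] \<Longrightarrow> enn2real (factorial_moment M X J {a, b, c, d} A) =
      avg4 W (\<lambda>(x, y, z, w). indicator (A a) x * (indicator (A b) y * (indicator (A c) z * indicator (A d) w)))"
proof -
  have b: "bounded_borel (indicator (A l))" if "l \<in> {a, b, c, d}" for l
    using A[OF that] by (intro bounded_borel_indicator) auto
  note bb = b bounded_borel_times
  have *: "enn2real (\<integral>\<^sup>+\<omega>. ennreal (h \<omega>) \<partial>M) = integral\<^sup>L M h" if "integrable M h" "\<And>\<omega>. 0 \<le> h \<omega>" for h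
    using that by (simp add: nn_integral_eq_integral integral_nonneg_AE)
  show "enn2real (factorial_moment M X J {a} A) = avg1 W (indicator (A a))"
    unfolding avg1_def using A
    by (subst factorial_moment_1[OF W(1)], simp, intro * integrable_random_sums[OF W] bb) (auto intro: sum_nonneg)
  show "enn2real (factorial_moment M X J {a, b} A) =
      avg2 W (\<lambda>(x, y). indicator (A a) x * indicator (A b) y)" if "a \<noteq> b"
    unfolding avg2_def using A that
    by (subst factorial_moment_2[OF W(1)], simp, simp, simp, intro * integrable_random_sums[OF W] bb) (auto intro!: sum_nonneg simp: case_prod_beta)
  show "enn2real (factorial_moment M X J {a, b, c} A) =
      avg3 W (\<lambda>(x, y, z). indicator (A a) x * (indicator (A b) y * indicator (A c) z))" if "distinct [a, b, c]"
  proof -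
    have "bounded_borel (\<lambda>(x, y, z). indicator (A a) x * (indicator (A b) y * indicator (A c) z :: real))"
      using bounded_borel_times[OF b[of a] bounded_borel_times[OF b[of b] b[of c]]] by (simp add: case_prod_beta')
    note int = integrable_random_sums(3)[OF W this]
    have "factorial_moment M X J {a,b,c} A = (\<integral>\<^sup>+\<omega>. ennreal (\<Sum>t\<in>distinct3 (pts W \<omega>). case X3 t \<omega> of (x, y, z) \<Rightarrow> indicator (A a) x * (indicator (A b) y * indicator (A c) z)) \<partial>M)"
      by (rule factorial_moment_3[OF W(1)]) (use A that in auto)
    then show ?thesis
      unfolding avg3_def by (simp only:) (rule *[OF int], auto intro!: sum_nonneg simp: case_prod_beta)
  qed
  show "enn2real (factorial_moment M X J {a, b, c, d} A) =
      avg4 W (\<lambda>(x, y, z, w). indicator (A a) x * (indicator (A b) y * (indicator (A c) z * indicator (A d) w)))" if "distinct [a, b, c, d]"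
  proof -
    have "bounded_borel (\<lambda>(x, y, z, w). indicator (A a) x * (indicator (A b) y * (indicator (A c) z * indicator (A d) w) :: real))"
      using bounded_borel_times[OF b[of a] bounded_borel_times[OF b[of b] bounded_borel_times[OF b[of c] b[of d]]]] by (simp add: case_prod_beta')
    note int = integrable_random_sums(4)[OF W this]
    have "factorial_moment M X J {a,b,c,d} A = (\<integral>\<^sup>+\<omega>. ennreal (\<Sum>t\<in>distinct4 (pts W \<omega>). case X4 t \<omega> of (x, y, z, w) \<Rightarrow> indicator (A a) x * (indicator (A b) y * (indicator (A c) z * indicator (A d) w))) \<partial>M)"
      by (rule factorial_moment_4[OF W(1)]) (use A that in auto)
    then show ?thesis
      unfolding avg4_def by (simp only:) (rule *[OF int], auto intro!: sum_nonneg simp: case_prod_beta)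
  qed
qed

end

section \<open>Diagonally invariant measures\<close>

lemma nn_integral_lborel_shift:
  fixes f :: "'a::euclidean_space \<Rightarrow> ennreal"
  assumes [measurable]: "f \<in> borel_measurable borel"
  shows "(\<integral>\<^sup>+t. f (x + t) \<partial>lborel) = (\<integral>\<^sup>+t. f t \<partial>lborel)"
  by (subst (2) lborel_distr_plus[of x, symmetric]) (simp add: nn_integral_distr)

lemma nn_integral_lborel_reflect:
  fixes f :: "'a::euclidean_space \<Rightarrow> ennreal"
  assumes [measurable]: "f \<in> borel_measurable borel"
  shows "(\<integral>\<^sup>+t. f (x - t) \<partial>lborel) = (\<integral>\<^sup>+t. f t \<partial>lborel)"
proof -
  have "(lborel :: 'a measure) = distr lborel borel (\<lambda>t. x - t)"
    using lborel_affine[of "-1" x] by (simp add: density_1)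
  then have "(\<integral>\<^sup>+t. f t \<partial>lborel) = (\<integral>\<^sup>+t. f t \<partial>distr lborel borel (\<lambda>t. x - t))" by simp
  also have "\<dots> = (\<integral>\<^sup>+t. f (x - t) \<partial>lborel)" by (subst nn_integral_distr) simp_all
  finally show ?thesis ..
qed

lemma nn_integral_distr_eq:
  assumes "T \<in> measurable M N" "f \<in> borel_measurable N"
  shows "integral\<^sup>N (distr M N T) f = (\<integral>\<^sup>+x. f (T x) \<partial>M)"
  using assms by (simp add: nn_integral_distr)

lemma ball_Times_borel [simp]:
  "ball (a::'b::euclidean_space) r \<times> ball (b::'c::euclidean_space) s \<in> sets borel"
  by (intro borel_open open_Times open_ball)

lemma emeasure_unit_cube: "emeasure lborel (unit_cube :: 'a::euclidean_space set) = 1"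
proof (rule antisym)
  have "emeasure lborel (unit_cube :: 'a set) \<le> emeasure lborel (cbox 0 (One :: 'a))"
    by (rule emeasure_mono) (auto simp: unit_cube_def mem_box less_imp_le)
  then show "emeasure lborel (unit_cube :: 'a set) \<le> 1" by (simp add: emeasure_lborel_cbox_eq)
  have "(unit_cube :: 'a set) = (\<Inter>b\<in>Basis. {x. 0 \<le> x \<bullet> b} \<inter> {x. x \<bullet> b < 1})" by (auto simp: unit_cube_def)
  also have "\<dots> \<in> sets borel" by (intro sets.finite_INT) auto
  finally have "emeasure lborel (box 0 (One :: 'a)) \<le> emeasure lborel (unit_cube :: 'a set)"
    by (intro emeasure_mono) (auto simp: unit_cube_def mem_box less_imp_le)
  then show "1 \<le> emeasure lborel (unit_cube :: 'a set)" by (simp add: emeasure_lborel_box_eq)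
qed

text \<open>Averaging over all translates of the unit cube replaces the second coordinate by Lebesgue measure.\<close>

lemma nn_integral_shift_invariant:
  fixes \<nu> :: "('c::second_countable_topology \<times> 'a::euclidean_space) measure"
  assumes sf: "sigma_finite_measure \<nu>" and s: "sets \<nu> = sets borel"
    and inv: "\<And>t. distr \<nu> borel (\<lambda>(z, x). (z, x + t)) = \<nu>"
    and H: "H \<in> borel_measurable borel"
    and Q: "(unit_cube :: 'a set) \<in> sets borel"
  shows "(\<integral>\<^sup>+p. H p \<partial>\<nu>) = (\<integral>\<^sup>+p. indicator unit_cube (snd p) * (\<integral>\<^sup>+t. H (fst p, t) \<partial>lborel) \<partial>\<nu>)"
proof -
  interpret sigma_finite_measure \<nu> by fact
  interpret pair_sigma_finite "lborel :: 'a measure" \<nu> ..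
  note s' = s[folded borel_prod]
  note [measurable_cong] = s'
  have [measurable]: "H \<in> borel_measurable (borel \<Otimes>\<^sub>M borel)" using H by (simp add: borel_prod)
  note [measurable] = Q
  let ?Q = "indicator unit_cube :: 'a \<Rightarrow> ennreal"
  have "(\<integral>\<^sup>+p. ?Q (snd p) * (\<integral>\<^sup>+t. H (fst p, t) \<partial>lborel) \<partial>\<nu>) =
      (\<integral>\<^sup>+p. (\<integral>\<^sup>+t. ?Q (snd p) * H (fst p, snd p + t) \<partial>lborel) \<partial>\<nu>)"
  proof (intro nn_integral_cong)
    fix p :: "'c \<times> 'a"
    have "(\<integral>\<^sup>+t. H (fst p, t) \<partial>lborel) = (\<integral>\<^sup>+t. H (fst p, snd p + t) \<partial>lborel)"
      by (rule nn_integral_lborel_shift[symmetric]) measurable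
    then show "?Q (snd p) * (\<integral>\<^sup>+t. H (fst p, t) \<partial>lborel) = (\<integral>\<^sup>+t. ?Q (snd p) * H (fst p, snd p + t) \<partial>lborel)"
      by (simp add: nn_integral_cmult)
  qed
  also have "\<dots> = (\<integral>\<^sup>+t. (\<integral>\<^sup>+p. ?Q (snd p) * H (fst p, snd p + t) \<partial>\<nu>) \<partial>lborel)"
    by (rule Fubini') measurable
  \<comment> \<open>Invariance of \<open>\<nu>\<close> moves the shift from \<open>H\<close> to the
    cube. Afterwards \<open>t\<close> occurs in the cube alone, and integrating over it gives the
    volume 1.\<close>
  also have "\<dots> = (\<integral>\<^sup>+t. (\<integral>\<^sup>+p. ?Q (snd p - t) * H p \<partial>\<nu>) \<partial>lborel)"
  proof (rule nn_integral_cong)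
    fix t
    have m: "(\<lambda>(z, x). (z, x + t)) \<in> measurable \<nu> borel"
      by (subst borel_prod[symmetric]) measurable
    have m2: "(\<lambda>p. ?Q (snd p - t) * H p) \<in> borel_measurable borel"
      by (subst borel_prod[symmetric]) measurable
    have "(\<integral>\<^sup>+p. ?Q (snd p - t) * H p \<partial>\<nu>) = (\<integral>\<^sup>+p. ?Q (snd p - t) * H p \<partial>distr \<nu> borel (\<lambda>(z, x). (z, x + t)))"
      by (simp only: inv)
    also have "\<dots> = (\<integral>\<^sup>+p. ?Q (snd p) * H (fst p, snd p + t) \<partial>\<nu>)"
      by (subst nn_integral_distr_eq[OF m m2]) (simp add: case_prod_beta)
    finally show "(\<integral>\<^sup>+p. ?Q (snd p) * H (fst p, snd p + t) \<partial>\<nu>) = (\<integral>\<^sup>+p. ?Q (snd p - t) * H p \<partial>\<nu>)" ..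
  qed
  also have "\<dots> = (\<integral>\<^sup>+p. (\<integral>\<^sup>+t. ?Q (snd p - t) * H p \<partial>lborel) \<partial>\<nu>)"
    by (rule Fubini'[symmetric]) measurable
  also have "\<dots> = (\<integral>\<^sup>+p. H p \<partial>\<nu>)"
  proof (intro nn_integral_cong)
    fix p
    have "(\<integral>\<^sup>+t. ?Q (snd p - t) * H p \<partial>lborel) = (\<integral>\<^sup>+t. ?Q (snd p - t) \<partial>lborel) * H p"
      by (rule nn_integral_multc) measurable
    also have "(\<integral>\<^sup>+t. ?Q (snd p - t) \<partial>lborel) = (\<integral>\<^sup>+t. ?Q t \<partial>lborel)"
      by (rule nn_integral_lborel_reflect) measurable
    also have "\<dots> = 1" using Q by (simp add: emeasure_unit_cube)
    finally show "(\<integral>\<^sup>+t. ?Q (snd p - t) * H p \<partial>lborel) = H p" by simp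
  qed
  finally show ?thesis ..
qed

lemma measure_eqI_boxes:
  fixes \<mu> \<nu> :: "('b::euclidean_space \<times> 'c::euclidean_space) measure"
  assumes s: "sets \<mu> = sets borel" "sets \<nu> = sets borel"
    and eq: "\<And>A B. A \<in> sets borel \<Longrightarrow> B \<in> sets borel \<Longrightarrow> emeasure \<mu> (A \<times> B) = emeasure \<nu> (A \<times> B)"
    and fin: "\<And>n::nat. emeasure \<mu> (ball 0 (real n) \<times> ball 0 (real n)) < \<infinity>"
  shows "\<mu> = \<nu>"
proof (rule measure_eqI_generator_eq)
  let ?E = "{a \<times> b |a b. a \<in> sets (borel :: 'b measure) \<and> b \<in> sets (borel :: 'c measure)}"
  have E: "sets borel = sigma_sets UNIV ?E"
    by (subst borel_prod[symmetric], subst sets_pair_measure) (auto simp: space_borel)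
  show "Int_stable ?E" using Int_stable_pair_measure_generator[of borel borel] by simp
  show "?E \<subseteq> Pow UNIV" by simp
  show "sets \<mu> = sigma_sets UNIV ?E" "sets \<nu> = sigma_sets UNIV ?E" using s E by simp_all
  show "\<And>X. X \<in> ?E \<Longrightarrow> emeasure \<mu> X = emeasure \<nu> X" using eq by auto
  show "range (\<lambda>n. ball 0 (real n) \<times> ball 0 (real n)) \<subseteq> ?E"
  proof safe
    fix n :: nat
    show "\<exists>a b. ball 0 (real n) \<times> ball 0 (real n) = a \<times> b \<and> a \<in> sets (borel :: 'b measure) \<and> b \<in> sets (borel :: 'c measure)"
      by (intro exI conjI, rule refl) simp_all
  qed
  show "(\<Union>n. ball 0 (real n) \<times> ball 0 (real n)) = (UNIV :: ('b \<times> 'c) set)"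
  proof safe
    fix x :: 'b and y :: 'c
    obtain n :: nat where "max (norm x) (norm y) < real n" using reals_Archimedean2 by blast
    then show "(x, y) \<in> (\<Union>n. ball 0 (real n) \<times> ball 0 (real n))" by (auto intro!: exI[of _ n])
  qed simp
  show "emeasure \<mu> (ball 0 (real i) \<times> ball 0 (real i)) \<noteq> \<infinity>" for i using fin[of i] by simp
qed

lemma sigma_finite_measure_balls:
  fixes \<mu> :: "'b::euclidean_space measure"
  assumes s: "sets \<mu> = sets borel" and fin: "\<And>n::nat. emeasure \<mu> (ball 0 (real n)) < \<infinity>"
  shows "sigma_finite_measure \<mu>"
proof
  have "(\<Union>n. ball 0 (real n)) = (UNIV :: 'b set)"
    using reals_Archimedean2 by (auto simp: dist_norm)
  moreover have "space \<mu> = UNIV" using sets_eq_imp_space_eq[OF s] by simp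
  ultimately show "\<exists>A. countable A \<and> A \<subseteq> sets \<mu> \<and> \<Union>A = space \<mu> \<and> (\<forall>a\<in>A. emeasure \<mu> a \<noteq> \<infinity>)"
    using fin by (intro exI[of _ "range (\<lambda>n. ball 0 (real n))"]) (auto simp: s less_top)
qed

lemma sigma_finite_measure_boxes:
  fixes \<mu> :: "('b::euclidean_space \<times> 'c::euclidean_space) measure"
  assumes s: "sets \<mu> = sets borel"
    and fin: "\<And>n::nat. emeasure \<mu> (ball 0 (real n) \<times> ball 0 (real n)) < \<infinity>"
  shows "sigma_finite_measure \<mu>"
proof (rule sigma_finite_measure_balls[OF s])
  fix n :: nat
  let ?B = "ball 0 (real n) :: 'b set" and ?C = "ball 0 (real n) :: 'c set"
  have "ball 0 (real n) \<subseteq> ?B \<times> ?C"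
  proof
    fix p :: "'b \<times> 'c" assume "p \<in> ball 0 (real n)"
    then show "p \<in> ?B \<times> ?C"
      using norm_fst_le[of "fst p" "snd p"] norm_snd_le[of "snd p" "fst p"] by (cases p) simp
  qed
  moreover have "?B \<times> ?C \<in> sets \<mu>" by (simp add: s)
  ultimately have "emeasure \<mu> (ball 0 (real n)) \<le> emeasure \<mu> (?B \<times> ?C)"
    by (rule emeasure_mono)
  also note fin[of n]
  finally show "emeasure \<mu> (ball 0 (real n)) < \<infinity>" .
qed

section \<open>Intensity measure and reduced second moment measure\<close>

context point_process
begin

text \<open>The intensity measure of the random family of points \<open>Y t\<close> with
  \<open>t \<in> T \<omega>\<close>. Writing it as an image of counting measure times
  \<open>M\<close> makes Fubini's theorem available, as counting measure on a countable type is
  sigma-finite.\<close>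

definition family_measure :: "('w \<Rightarrow> 't::countable set) \<Rightarrow> ('t \<Rightarrow> 'w \<Rightarrow> 'b::topological_space) \<Rightarrow> 'b measure" where
  "family_measure T Y = distr (density (count_space UNIV \<Otimes>\<^sub>M M) (\<lambda>(t, \<omega>). indicator (T \<omega>) t)) borel (\<lambda>(t, \<omega>). Y t \<omega>)"

lemma sets_family_measure [simp, measurable_cong]: "sets (family_measure T Y) = sets borel"
  by (simp add: family_measure_def)

lemma nn_integral_family_measure:
  assumes T[measurable]: "\<And>t. Measurable.pred M (\<lambda>\<omega>. t \<in> T \<omega>)"
    and Y[measurable]: "\<And>t. Y t \<in> borel_measurable M"
    and F[measurable]: "F \<in> borel_measurable borel"
  shows "(\<integral>\<^sup>+x. F x \<partial>family_measure T Y) = (\<integral>\<^sup>+\<omega>. (\<integral>\<^sup>+t. F (Y t \<omega>) \<partial>count_space (T \<omega>)) \<partial>M)"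
proof -
  interpret C: sigma_finite_measure "count_space (UNIV :: 'b set)"
    by (rule sigma_finite_measure_count_space_countable) simp
  interpret pair_sigma_finite "count_space (UNIV :: 'b set)" M ..
  have T': "(\<lambda>\<omega>. indicator (T \<omega>) t :: ennreal) \<in> borel_measurable M" for t
    unfolding indicator_def by measurable
  have [measurable]: "(\<lambda>(t, \<omega>). Y t \<omega>) \<in> borel_measurable (count_space UNIV \<Otimes>\<^sub>M M)"
    "(\<lambda>(t, \<omega>). indicator (T \<omega>) t :: ennreal) \<in> borel_measurable (count_space UNIV \<Otimes>\<^sub>M M)"
    using T' by (auto intro!: measurable_pair_measure_countable1)
  have "(\<integral>\<^sup>+x. F x \<partial>family_measure T Y) =
      (\<integral>\<^sup>+p. (case p of (t, \<omega>) \<Rightarrow> indicator (T \<omega>) t) * F (case p of (t, \<omega>) \<Rightarrow> Y t \<omega>) \<partial>(count_space UNIV \<Otimes>\<^sub>M M))"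
    unfolding family_measure_def by (simp add: nn_integral_distr nn_integral_density)
  also have "\<dots> = (\<integral>\<^sup>+\<omega>. (\<integral>\<^sup>+t. indicator (T \<omega>) t * F (Y t \<omega>) \<partial>count_space UNIV) \<partial>M)"
    by (subst nn_integral_snd[symmetric]) auto
  finally show ?thesis
    by (simp add: nn_integral_count_space_indicator mult.commute)
qed

text \<open>\<open>moment1\<close> and \<open>moment2\<close> are the first and second factorial
  moment measures on the whole space, as genuine measures rather than values on boxes.\<close>

definition moment1 :: "'a measure" where "moment1 = family_measure J X"
definition moment2 :: "('a \<times> 'a) measure" where "moment2 = family_measure (\<lambda>\<omega>. distinct2 (J \<omega>)) X2"

lemma sets_moment [simp, measurable_cong]: "sets moment1 = sets borel" "sets moment2 = sets borel"
  by (simp_all add: moment1_def moment2_def)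

lemma space_moment [simp]: "space moment1 = UNIV" "space moment2 = UNIV"
  using sets_eq_imp_space_eq[OF sets_moment(1)] sets_eq_imp_space_eq[OF sets_moment(2)] by simp_all

lemma nn_integral_moment1:
  "F \<in> borel_measurable borel \<Longrightarrow> (\<integral>\<^sup>+x. F x \<partial>moment1) = (\<integral>\<^sup>+\<omega>. (\<integral>\<^sup>+t. F (X t \<omega>) \<partial>count_space (J \<omega>)) \<partial>M)"
  unfolding moment1_def by (rule nn_integral_family_measure) auto

lemma nn_integral_moment2:
  "F \<in> borel_measurable borel \<Longrightarrow> (\<integral>\<^sup>+x. F x \<partial>moment2) = (\<integral>\<^sup>+\<omega>. (\<integral>\<^sup>+t. F (X2 t \<omega>) \<partial>count_space (distinct2 (J \<omega>))) \<partial>M)"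
  unfolding moment2_def by (rule nn_integral_family_measure) (auto simp: distinct2_def)

lemma emeasure_moment1:
  assumes A: "A \<in> sets borel" shows "emeasure moment1 A = factorial_moment M X J {1..1} (\<lambda>_. A)"
proof -
  have bij: "bij_betw (\<lambda>i. \<lambda>l\<in>{1::nat}. i) (J \<omega>) {\<iota> \<in> {1..1} \<rightarrow>\<^sub>E J \<omega>. inj_on \<iota> {1..1}}" for \<omega>
    by (rule bij_betw_byWitness[where f'="\<lambda>\<iota>. \<iota> 1"]) (auto simp: PiE_def extensional_def fun_eq_iff)
  have "factorial_moment M X J {1..1} (\<lambda>_. A) = (\<integral>\<^sup>+\<omega>. (\<integral>\<^sup>+t. indicator A (X t \<omega>) \<partial>count_space (J \<omega>)) \<partial>M)"
    unfolding factorial_moment_def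
    by (subst nn_integral_bij_count_space[OF bij, symmetric]) simp
  also have "\<dots> = (\<integral>\<^sup>+x. indicator A x \<partial>moment1)"
    by (rule nn_integral_moment1[symmetric]) (use A in measurable)
  also have "\<dots> = emeasure moment1 A" using A by simp
  finally show ?thesis ..
qed

lemma emeasure_moment2:
  assumes A: "A 1 \<in> sets borel" "A 2 \<in> sets borel"
  shows "emeasure moment2 (A 1 \<times> A 2) = factorial_moment M X J {1..2} A"
proof -
  have bij: "bij_betw (\<lambda>t. \<lambda>l\<in>{1..2::nat}. if l = 1 then fst t else snd t) (distinct2 (J \<omega>))
      {\<iota> \<in> {1..2} \<rightarrow>\<^sub>E J \<omega>. inj_on \<iota> {1..2}}" for \<omega>
  proof (rule bij_betw_byWitness[where f'="\<lambda>\<iota>. (\<iota> 1, \<iota> 2)"])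
    show "\<forall>\<iota>\<in>{\<iota> \<in> {1..2::nat} \<rightarrow>\<^sub>E J \<omega>. inj_on \<iota> {1..2}}. (\<lambda>l\<in>{1..2::nat}. if l = 1 then fst (\<iota> 1, \<iota> 2) else snd (\<iota> 1, \<iota> 2)) = \<iota>"
    proof (intro ballI ext)
      fix \<iota> l assume "\<iota> \<in> {\<iota> \<in> {1..2} \<rightarrow>\<^sub>E J \<omega>. inj_on \<iota> {1..2::nat}}"
      then show "(\<lambda>l\<in>{1..2::nat}. if l = 1 then fst (\<iota> 1, \<iota> 2) else snd (\<iota> 1, \<iota> 2)) l = \<iota> l"
        unfolding Icc_1_2 by (cases "l \<in> {1, 2}") (auto simp: PiE_def extensional_def)
    qed
    show "(\<lambda>\<iota>. (\<iota> 1, \<iota> 2)) ` {\<iota> \<in> {1..2::nat} \<rightarrow>\<^sub>E J \<omega>. inj_on \<iota> {1..2}} \<subseteq> distinct2 (J \<omega>)"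
      unfolding Icc_1_2 by (auto simp: distinct2_def PiE_def Pi_def inj_on_def)
  qed (auto simp: distinct2_def PiE_def inj_on_def split: if_splits)
  have "factorial_moment M X J {1..2} A = (\<integral>\<^sup>+\<omega>. (\<integral>\<^sup>+t. indicator (A 1 \<times> A 2) (X2 t \<omega>) \<partial>count_space (distinct2 (J \<omega>))) \<partial>M)"
    unfolding factorial_moment_def
    by (subst nn_integral_bij_count_space[OF bij, symmetric]) (simp add: Icc_1_2[unfolded One_nat_def] X2_def indicator_times)
  also have "\<dots> = (\<integral>\<^sup>+x. indicator (A 1 \<times> A 2) x \<partial>moment2)"
    by (rule nn_integral_moment2[symmetric]) (use A in \<open>simp flip: borel_prod\<close>)
  also have "\<dots> = emeasure moment2 (A 1 \<times> A 2)" using A by (simp flip: borel_prod)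
  finally show ?thesis ..
qed

lemma moment_finite:
  assumes "bounded W" "W \<in> sets borel"
  shows "emeasure moment1 W < \<infinity>" "emeasure moment2 (W \<times> W) < \<infinity>"
proof -
  have fin: "(\<integral>\<^sup>+\<omega>. ennreal (h \<omega>) \<partial>M) < \<infinity>" if "integrable M h" "\<And>\<omega>. 0 \<le> h \<omega>" for h
    using nn_integral_eq_integral[OF that(1)] that(2) by simp
  have "emeasure moment1 W = (\<integral>\<^sup>+\<omega>. ennreal (\<Sum>i\<in>pts W \<omega>. indicator W (X i \<omega>)) \<partial>M)"
    using emeasure_moment1[OF assms(2)] factorial_moment_1[OF assms(1), of "\<lambda>_. W" 1] by simp
  also have "\<dots> < \<infinity>"
    by (intro fin integrable_random_sums assms bounded_borel_indicator) (auto intro: sum_nonneg)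
  finally show "emeasure moment1 W < \<infinity>" .
  have "emeasure moment2 (W \<times> W) = (\<integral>\<^sup>+\<omega>. ennreal (\<Sum>t\<in>distinct2 (pts W \<omega>). case X2 t \<omega> of (x, y) \<Rightarrow> indicator W x * indicator W y) \<partial>M)"
    using emeasure_moment2[of "\<lambda>_. W"] factorial_moment_2[OF assms(1), of "\<lambda>_. W" 1 2] assms(2) by (simp only: Icc_1_2)
  also have "\<dots> < \<infinity>"
    by (intro fin integrable_random_sums assms bounded_borel_times bounded_borel_indicator)
       (auto intro!: sum_nonneg simp: case_prod_beta)
  finally show "emeasure moment2 (W \<times> W) < \<infinity>" .
qed

section \<open>Stationarity and disintegration of the first two moment measures\<close>

lemma moment1_shift: "distr moment1 borel (\<lambda>x. x + t) = moment1"
proof (rule measure_eqI)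
  fix A assume "A \<in> sets (distr moment1 borel (\<lambda>x. x + t))"
  then have A: "A \<in> sets borel" by simp
  have pre: "(\<lambda>x. x + t) -` A \<in> sets borel"
    using measurable_sets[of "\<lambda>x. x + t" borel borel A] A by simp
  have *: "(\<lambda>y. y + t) ` ((\<lambda>x. x + t) -` A) = A" by (auto intro: image_eqI[of _ _ "_ - t"])
  have "emeasure (distr moment1 borel (\<lambda>x. x + t)) A = factorial_moment M X J {1..1} (\<lambda>_. (\<lambda>x. x + t) -` A)"
    using A pre emeasure_moment1[OF pre] by (subst emeasure_distr) (auto cong: measurable_cong_sets)
  also have "\<dots> = factorial_moment M X J {1..1} (\<lambda>_. A)"
    using factorial_moment_shift[of 1 "\<lambda>_. (\<lambda>x. x + t) -` A" t] pre * by simp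
  finally show "emeasure (distr moment1 borel (\<lambda>x. x + t)) A = emeasure moment1 A"
    using emeasure_moment1[OF A] by simp
qed simp

lemma moment2_shift: "distr moment2 borel (\<lambda>(y, x). (y + t, x + t)) = moment2"
proof (rule sym, rule measure_eqI_boxes)
  have m: "(\<lambda>(y, x). (y + t, x + t)) \<in> measurable moment2 borel"
    by (subst borel_prod[symmetric]) (simp add: measurable_cong_sets[OF sets_moment(2)[folded borel_prod] refl])
  fix A B :: "'a set" assume A: "A \<in> sets borel" "B \<in> sets borel"
  have pre: "(\<lambda>x. x + t) -` C \<in> sets borel" if "C \<in> sets borel" for C :: "'a set"
    using measurable_sets[of "\<lambda>x. x + t" borel borel C] that by simp
  have *: "(\<lambda>y. y + t) ` ((\<lambda>x. x + t) -` C) = C" for C by (auto intro: image_eqI[of _ _ "_ - t"])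
  define D where "D l = (if l = 1 then A else B)" for l :: nat
  have D: "D l \<in> sets borel" for l using A by (simp add: D_def)
  have "emeasure (distr moment2 borel (\<lambda>(y, x). (y + t, x + t))) (A \<times> B) =
      emeasure moment2 (((\<lambda>x. x + t) -` A) \<times> ((\<lambda>x. x + t) -` B))"
    using A by (subst emeasure_distr[OF m]) (auto simp flip: borel_prod intro!: arg_cong2[where f=emeasure])
  also have "\<dots> = factorial_moment M X J {1..2} (\<lambda>l. (\<lambda>x. x + t) -` D l)"
    using emeasure_moment2[of "\<lambda>l. (\<lambda>x. x + t) -` D l"] pre A by (simp add: D_def)
  also have "\<dots> = factorial_moment M X J {1..2} D"
    using factorial_moment_shift[of 2 "\<lambda>l. (\<lambda>x. x + t) -` D l" t] pre[OF D] * by simp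
  finally show "emeasure moment2 (A \<times> B) = emeasure (distr moment2 borel (\<lambda>(y, x). (y + t, x + t))) (A \<times> B)"
    using emeasure_moment2[of D] A by (simp add: D_def)
qed (auto intro: moment_finite(2)[simplified])

text \<open>The conversion by \<open>enn2real\<close> in \<open>intensity\<close> loses nothing,
  because the bounded unit cube has finite mean count.\<close>

lemma intensity_finite: "emeasure moment1 unit_cube = ennreal (intensity M X J)"
proof -
  have "emeasure moment1 unit_cube = (\<integral>\<^sup>+x. indicator unit_cube x \<partial>moment1)" by simp
  also have "\<dots> = (\<integral>\<^sup>+\<omega>. (\<integral>\<^sup>+t. indicator unit_cube (X t \<omega>) \<partial>count_space (J \<omega>)) \<partial>M)"
    by (rule nn_integral_moment1) measurable
  also have "\<dots> = (\<integral>\<^sup>+\<omega>. emeasure (atom_measure X J \<omega>) unit_cube \<partial>M)"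
  proof (intro nn_integral_cong)
    fix \<omega>
    have "emeasure (atom_measure X J \<omega>) unit_cube = (\<integral>\<^sup>+x. indicator unit_cube x \<partial>atom_measure X J \<omega>)"
      by (simp add: atom_measure_def)
    also have "\<dots> = (\<integral>\<^sup>+t. indicator unit_cube (X t \<omega>) \<partial>count_space (J \<omega>))"
      unfolding atom_measure_def by (rule nn_integral_distr) auto
    finally show "(\<integral>\<^sup>+t. indicator unit_cube (X t \<omega>) \<partial>count_space (J \<omega>)) = emeasure (atom_measure X J \<omega>) unit_cube" ..
  qed
  finally show ?thesis
    using moment_finite(1)[OF bounded_unit_cube unit_cube_borel] by (simp add: intensity_def less_top)
qed

text \<open>A shift-invariant locally finite measure is a multiple of Lebesgue measure. It is read
  off from \<open>nn_integral_shift_invariant\<close> by adding a dummy first coordinate 0.\<close>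

lemma nn_integral_moment1_lborel:
  assumes H[measurable]: "H \<in> borel_measurable borel"
  shows "(\<integral>\<^sup>+x. H x \<partial>moment1) = ennreal (intensity M X J) * (\<integral>\<^sup>+x. H x \<partial>lborel)"
proof -
  let ?T = "\<lambda>x. (0::'a, x)"
  have T[measurable]: "?T \<in> measurable moment1 borel"
    by (subst borel_prod[symmetric]) (simp add: measurable_cong_sets[OF sets_moment(1) refl])
  define \<nu> where "\<nu> = distr moment1 borel ?T"
  have s: "sets \<nu> = sets borel" by (simp add: \<nu>_def)
  have sf: "sigma_finite_measure \<nu>"
  proof (rule sigma_finite_measure_boxes[OF s])
    fix n :: nat
    have "emeasure \<nu> (ball 0 (real n) \<times> ball 0 (real n)) = emeasure moment1 (?T -` (ball 0 (real n) \<times> ball 0 (real n)))"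
      unfolding \<nu>_def by (subst emeasure_distr[OF T]) auto
    also have "\<dots> \<le> emeasure moment1 (ball 0 (real n))" by (rule emeasure_mono) auto
    also have "\<dots> < \<infinity>" by (rule moment_finite) auto
    finally show "emeasure \<nu> (ball 0 (real n) \<times> ball 0 (real n)) < \<infinity>" .
  qed
  have inv: "distr \<nu> borel (\<lambda>(z, x). (z, x + t)) = \<nu>" for t
  proof -
    have m: "(\<lambda>(z::'a, x::'a). (z, x + t)) \<in> measurable borel borel"
      by (simp flip: borel_prod)
    have "distr \<nu> borel (\<lambda>(z, x). (z, x + t)) = distr moment1 borel (\<lambda>x. (0, x + t))"
      unfolding \<nu>_def by (subst distr_distr[OF m T]) (simp add: comp_def)
    also have "\<dots> = distr (distr moment1 borel (\<lambda>x. x + t)) borel ?T"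
      by (subst distr_distr) (auto simp: comp_def measurable_cong_sets[OF sets_moment(1) refl] simp flip: borel_prod)
    finally show ?thesis by (simp add: moment1_shift \<nu>_def)
  qed
  have m1: "(\<lambda>p. H (snd p)) \<in> borel_measurable (borel :: ('a \<times> 'a) measure)" by (simp flip: borel_prod)
  have m2: "(\<lambda>p::'a\<times>'a. indicator unit_cube (snd p) * (\<integral>\<^sup>+t. H t \<partial>lborel)) \<in> borel_measurable borel" by (simp flip: borel_prod)
  have "(\<integral>\<^sup>+x. H x \<partial>moment1) = (\<integral>\<^sup>+p. H (snd p) \<partial>\<nu>)"
    unfolding \<nu>_def by (subst nn_integral_distr_eq[OF T m1]) simp
  also have "\<dots> = (\<integral>\<^sup>+p. indicator unit_cube (snd p) * (\<integral>\<^sup>+t. H t \<partial>lborel) \<partial>\<nu>)"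
    using nn_integral_shift_invariant[OF sf s inv m1 unit_cube_borel] by simp
  also have "\<dots> = (\<integral>\<^sup>+x. indicator unit_cube x * (\<integral>\<^sup>+t. H t \<partial>lborel) \<partial>moment1)"
    unfolding \<nu>_def by (subst nn_integral_distr_eq[OF T m2]) simp
  also have "\<dots> = emeasure moment1 unit_cube * (\<integral>\<^sup>+t. H t \<partial>lborel)"
    by (subst nn_integral_multc) simp_all
  finally show ?thesis by (simp add: intensity_finite)
qed

text \<open>A Palm-type measure: it counts differences of pairs whose second point lies in the unit
  cube. By the disintegration below it is the intensity times a reduced second moment
  measure.\<close>

definition palm2 :: "'a measure" where
  "palm2 = distr (density moment2 (\<lambda>p. indicator unit_cube (snd p))) borel (\<lambda>p. fst p - snd p)"

lemma palm2_measurable: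
  "(\<lambda>p. indicator unit_cube (snd p) :: ennreal) \<in> borel_measurable moment2"
  "(\<lambda>p. fst p - snd p) \<in> measurable moment2 borel"
  by (simp_all add: measurable_cong_sets[OF sets_moment(2)[folded borel_prod] refl])

text \<open>In the coordinates (difference, second point) the diagonal shift moves the second
  coordinate only, so \<open>nn_integral_shift_invariant\<close> applies.\<close>

lemma nn_integral_moment2_palm2:
  assumes H: "H \<in> borel_measurable borel"
  shows "(\<integral>\<^sup>+p. H p \<partial>moment2) = (\<integral>\<^sup>+z. (\<integral>\<^sup>+x. H (z + x, x) \<partial>lborel) \<partial>palm2)"
proof -
  let ?T = "\<lambda>p. (fst p - snd p, snd p) :: 'a \<times> 'a"
  have [measurable]: "H \<in> borel_measurable (borel \<Otimes>\<^sub>M borel)" using H by (simp add: borel_prod)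
  have T: "?T \<in> measurable moment2 borel"
    unfolding measurable_cong_sets[OF sets_moment(2) refl] by (simp flip: borel_prod)
  define \<nu> where "\<nu> = distr moment2 borel ?T"
  have s: "sets \<nu> = sets borel" by (simp add: \<nu>_def)
  have sf: "sigma_finite_measure \<nu>"
  proof (rule sigma_finite_measure_boxes[OF s])
    fix n :: nat
    have "emeasure \<nu> (ball 0 (real n) \<times> ball 0 (real n)) = emeasure moment2 (?T -` (ball 0 (real n) \<times> ball 0 (real n)))"
      unfolding \<nu>_def by (subst emeasure_distr[OF T]) auto
    also have "\<dots> \<le> emeasure moment2 (ball 0 (2 * real n) \<times> ball 0 (2 * real n))"
    proof (rule emeasure_mono)
      show "?T -` (ball 0 (real n) \<times> ball 0 (real n)) \<subseteq> ball 0 (2 * real n) \<times> ball 0 (2 * real n)"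
      proof
        fix p :: "'a \<times> 'a" assume "p \<in> ?T -` (ball 0 (real n) \<times> ball 0 (real n))"
        then have "norm (fst p - snd p) < real n" "norm (snd p) < real n" by auto
        moreover have "norm (fst p) \<le> norm (fst p - snd p) + norm (snd p)"
          using norm_triangle_ineq[of "fst p - snd p" "snd p"] by simp
        ultimately show "p \<in> ball 0 (2 * real n) \<times> ball 0 (2 * real n)" by (cases p) auto
      qed
    qed auto
    also have "\<dots> < \<infinity>" by (rule moment_finite) auto
    finally show "emeasure \<nu> (ball 0 (real n) \<times> ball 0 (real n)) < \<infinity>" .
  qed
  have inv: "distr \<nu> borel (\<lambda>(z, x). (z, x + t)) = \<nu>" for t
  proof -
    have m: "(\<lambda>(z::'a, x::'a). (z, x + t)) \<in> measurable borel borel" "?T \<in> measurable borel borel"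
      by (simp_all flip: borel_prod)
    have m': "(\<lambda>(y, x). (y + t, x + t)) \<in> measurable moment2 borel"
      unfolding measurable_cong_sets[OF sets_moment(2) refl] by (simp flip: borel_prod)
    have "distr \<nu> borel (\<lambda>(z, x). (z, x + t)) = distr moment2 borel (\<lambda>p. (fst p - snd p, snd p + t))"
      unfolding \<nu>_def by (subst distr_distr[OF m(1) T]) (simp add: comp_def)
    also have "\<dots> = distr (distr moment2 borel (\<lambda>(y, x). (y + t, x + t))) borel ?T"
      by (subst distr_distr[OF m(2) m']) (simp add: comp_def case_prod_beta)
    finally show ?thesis by (simp add: moment2_shift \<nu>_def)
  qed
  let ?G = "\<lambda>p. H (fst p + snd p, snd p)"
  have G: "?G \<in> borel_measurable borel" by (simp flip: borel_prod)
  have G2: "(\<lambda>z. \<integral>\<^sup>+t. ?G (z, t) \<partial>lborel) \<in> borel_measurable borel" by measurable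
  have G3: "(\<lambda>p::'a\<times>'a. indicator unit_cube (snd p) * (\<integral>\<^sup>+t. ?G (fst p, t) \<partial>lborel)) \<in> borel_measurable borel"
  proof -
    define K where "K z = (\<integral>\<^sup>+t. ?G (z, t) \<partial>lborel)" for z
    have [measurable]: "K \<in> borel_measurable borel" using G2 by (simp add: K_def[abs_def])
    have "(\<lambda>p::'a\<times>'a. indicator unit_cube (snd p) * K (fst p)) \<in> borel_measurable (borel \<Otimes>\<^sub>M borel)"
      by measurable
    then show ?thesis by (simp add: K_def borel_prod)
  qed
  have "(\<integral>\<^sup>+p. H p \<partial>moment2) = (\<integral>\<^sup>+p. ?G p \<partial>\<nu>)"
    unfolding \<nu>_def by (subst nn_integral_distr_eq[OF T G]) simp
  also have "\<dots> = (\<integral>\<^sup>+p. indicator unit_cube (snd p) * (\<integral>\<^sup>+t. ?G (fst p, t) \<partial>lborel) \<partial>\<nu>)"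
    by (rule nn_integral_shift_invariant[OF sf s inv G unit_cube_borel])
  also have "\<dots> = (\<integral>\<^sup>+p. indicator unit_cube (snd p) * (\<integral>\<^sup>+t. H (fst p - snd p + t, t) \<partial>lborel) \<partial>moment2)"
    unfolding \<nu>_def by (subst nn_integral_distr_eq[OF T G3]) simp
  also have "\<dots> = (\<integral>\<^sup>+z. (\<integral>\<^sup>+t. ?G (z, t) \<partial>lborel) \<partial>palm2)"
    unfolding palm2_def using palm2_measurable G2
    by (simp add: nn_integral_distr nn_integral_density measurable_compose[OF palm2_measurable(2) G2])
  finally show ?thesis by simp
qed

lemma sets_palm2 [simp, measurable_cong]: "sets palm2 = sets borel"
  by (simp add: palm2_def)

lemma sigma_finite_palm2: "sigma_finite_measure palm2"
proof (rule sigma_finite_measure_balls)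
  fix n :: nat
  let ?W = "ball 0 (real n + 2 * real DIM('a) + 1) :: 'a set"
  obtain c where c: "\<And>x::'a. x \<in> unit_cube \<Longrightarrow> norm x \<le> c"
    using bounded_unit_cube by (auto simp: bounded_iff)
  define W where "W = (ball 0 (real n + c + 1) :: 'a set)"
  have 0: "(0::'a) \<in> unit_cube" by (auto simp: unit_cube_def)
  have "emeasure palm2 (ball 0 (real n)) =
     (\<integral>\<^sup>+p. indicator unit_cube (snd p) * indicator (ball 0 (real n)) (fst p - snd p) \<partial>moment2)"
  proof -
    have "emeasure palm2 (ball 0 (real n)) = (\<integral>\<^sup>+z. indicator (ball 0 (real n)) z \<partial>palm2)" by simp
    also have "\<dots> = (\<integral>\<^sup>+p. indicator (ball 0 (real n)) (fst p - snd p) \<partial>density moment2 (\<lambda>p. indicator unit_cube (snd p)))"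
      unfolding palm2_def using palm2_measurable(2) by (intro nn_integral_distr_eq) (auto intro!: borel_measurable_indicator)
    also have "\<dots> = (\<integral>\<^sup>+p. indicator unit_cube (snd p) * indicator (ball 0 (real n)) (fst p - snd p) \<partial>moment2)"

      by (intro nn_integral_density palm2_measurable measurable_compose[OF palm2_measurable(2)] borel_measurable_indicator) simp
    finally show ?thesis .
  qed
  also have "\<dots> \<le> (\<integral>\<^sup>+p. indicator (W \<times> W) p \<partial>moment2)"
  proof (intro nn_integral_mono)
    fix p :: "'a \<times> 'a"
    have "p \<in> W \<times> W" if "snd p \<in> unit_cube" "fst p - snd p \<in> ball 0 (real n)"
    proof -
      have "norm (fst p) \<le> norm (fst p - snd p) + norm (snd p)"
          using norm_triangle_ineq[of "fst p - snd p" "snd p"] by simp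
      with that c[of "snd p"] show ?thesis by (cases p) (auto simp: W_def)
    qed
    then show "indicator unit_cube (snd p) * indicator (ball 0 (real n)) (fst p - snd p) \<le> (indicator (W \<times> W) p :: ennreal)"
      by (auto simp: indicator_def)
  qed
  also have "\<dots> = emeasure moment2 (W \<times> W)" by (auto simp: W_def intro!: nn_integral_indicator)
  also have "\<dots> < \<infinity>" by (rule moment_finite) (auto simp: W_def)
  finally show "emeasure palm2 (ball 0 (real n)) < \<infinity>" .
qed simp

lemma Ico_1_2: "{1..<2} = {1::nat}" by auto

text \<open>Shows that the choice in \<open>reduced_moment\<close> has a candidate:
  \<open>palm2\<close> divided by the intensity, transported to one-element tuples. Fubini exchanges
  the roles of difference and base point.\<close>

lemma is_reduced_moment_exists:
  assumes pos: "intensity M X J > 0"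
  shows "\<exists>\<mu>. is_reduced_moment M X J 2 \<mu>"
proof -
  interpret S: sigma_finite_measure palm2 by (rule sigma_finite_palm2)
  interpret pair_sigma_finite palm2 "lborel :: 'a measure" ..
  let ?l = "ennreal (intensity M X J)"
  let ?T = "\<lambda>z::'a. \<lambda>l\<in>{1..<2::nat}. z"
  have T: "?T \<in> measurable palm2 (tuples 2)"
    by (intro measurable_restrict) (simp add: measurable_cong_sets[OF sets_palm2 refl])
  define \<mu> where "\<mu> = density (distr palm2 (tuples 2) ?T) (\<lambda>_. 1 / ?l)"
  have l: "?l * (1 / ?l) = 1" using pos by (simp add: ennreal_times_divide)
  have "is_reduced_moment M X J 2 \<mu>"
    unfolding is_reduced_moment_def
  proof (intro conjI allI impI)
    show "sets \<mu> = sets (tuples 2)" by (simp add: \<mu>_def)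
    fix A :: "nat \<Rightarrow> 'a set" assume "\<forall>l\<in>{1..2}. A l \<in> sets borel"
    then have A[measurable]: "A 1 \<in> sets borel" "A 2 \<in> sets borel" by auto
    have box: "emeasure \<mu> (shifted_box 2 A x) = (1 / ?l) * (\<integral>\<^sup>+z. indicator (A 1) (z + x) \<partial>palm2)" for x
    proof -
      have sh: "(\<lambda>y. y - x) ` A 1 = (\<lambda>z. z + x) -` A 1" by (auto intro: image_eqI[of _ _ "_ + x"])
      have sh': "(\<lambda>y. y - x) ` A 1 \<in> sets borel"
        unfolding sh using measurable_sets[of "\<lambda>z. z + x" borel borel "A 1"] A by simp
      have S: "shifted_box 2 A x \<in> sets (tuples 2)"
        unfolding Ico_1_2 by (intro sets_PiM_I_finite) (use sh' in auto)
      have "emeasure \<mu> (shifted_box 2 A x) = (1 / ?l) * emeasure (distr palm2 (tuples 2) ?T) (shifted_box 2 A x)"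
        unfolding \<mu>_def using S by (subst emeasure_density) (simp_all add: nn_integral_cmult_indicator)
      also have "emeasure (distr palm2 (tuples 2) ?T) (shifted_box 2 A x) = emeasure palm2 (?T -` shifted_box 2 A x \<inter> space palm2)"
        by (rule emeasure_distr[OF T S])
      also have "?T -` shifted_box 2 A x \<inter> space palm2 = (\<lambda>z. z + x) -` A 1"
        unfolding Ico_1_2 sh using sets_eq_imp_space_eq[OF sets_palm2]
        by (auto simp: PiE_def sh[unfolded One_nat_def])
      also have "emeasure palm2 ((\<lambda>z. z + x) -` A 1) = (\<integral>\<^sup>+z. indicator ((\<lambda>z. z + x) -` A 1) z \<partial>palm2)"
        using sh' unfolding sh by simp
      finally show ?thesis by (simp add: indicator_def)
    qed
    have "factorial_moment M X J {1..2} A = (\<integral>\<^sup>+p. indicator (A 1 \<times> A 2) p \<partial>moment2)"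
      using emeasure_moment2[of A] A by (simp flip: borel_prod)
    also have "\<dots> = (\<integral>\<^sup>+z. (\<integral>\<^sup>+x. indicator (A 1) (z + x) * indicator (A 2) x \<partial>lborel) \<partial>palm2)"
      by (subst nn_integral_moment2_palm2[OF borel_measurable_indicator[OF pair_measureI[OF A, unfolded borel_prod]]])
         (simp add: indicator_times)
    also have "\<dots> = (\<integral>\<^sup>+x. (\<integral>\<^sup>+z. indicator (A 1) (z + x) * indicator (A 2) x \<partial>palm2) \<partial>lborel)"
      by (rule Fubini'[symmetric]) measurable
    also have "\<dots> = (\<integral>\<^sup>+x. (\<integral>\<^sup>+z. indicator (A 1) (z + x) \<partial>palm2) * indicator (A 2) x \<partial>lborel)"
      by (intro nn_integral_cong nn_integral_multc) measurable
    also have "\<dots> = (\<integral>\<^sup>+x. ?l * (emeasure \<mu> (shifted_box 2 A x) * indicator (A 2) x) \<partial>lborel)"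
      unfolding box using l by (intro nn_integral_cong) (metis (no_types, lifting) mult.assoc mult_1)
    also have "\<dots> = ?l * (\<integral>\<^sup>+x\<in>A 2. emeasure \<mu> (shifted_box 2 A x) \<partial>lborel)"
      unfolding box by (intro nn_integral_cmult) measurable
    finally show "factorial_moment M X J {1..2} A = ?l * (\<integral>\<^sup>+x\<in>A 2. emeasure \<mu> (shifted_box 2 A x) \<partial>lborel)" .
  qed
  then show ?thesis ..
qed

text \<open>Tuples of order 2 are indexed by the single number 1; evaluating there moves the chosen
  reduced measure to the space of points.\<close>

definition reduced2 :: "'a measure" where
  "reduced2 = distr (reduced_moment M X J 2) borel (\<lambda>u. u 1)"

lemma sets_reduced2 [simp, measurable_cong]: "sets reduced2 = sets borel"
  by (simp add: reduced2_def)

section \<open>The chosen reduced second moment measure\<close>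

context
  assumes pos: "intensity M X J > 0"
begin

lemma is_reduced_moment_reduced: "is_reduced_moment M X J 2 (reduced_moment M X J 2)"
  unfolding reduced_moment_def by (rule someI_ex[OF is_reduced_moment_exists[OF pos]])

lemma emeasure_reduced2:
  assumes S: "S \<in> sets borel"
  shows "emeasure reduced2 S = emeasure (reduced_moment M X J 2) (\<Pi>\<^sub>E l\<in>{1..<2}. S)"
proof -
  have s: "sets (reduced_moment M X J 2) = sets (tuples 2)"
    using is_reduced_moment_reduced by (simp add: is_reduced_moment_def)
  have m: "(\<lambda>u. u 1) \<in> measurable (reduced_moment M X J 2) borel"
    unfolding measurable_cong_sets[OF s refl] by (rule measurable_component_singleton) auto
  have "(\<lambda>u. u 1) -` S \<inter> space (reduced_moment M X J 2) = (\<Pi>\<^sub>E l\<in>{1..<2}. S)"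
    unfolding sets_eq_imp_space_eq[OF s] Ico_1_2 by (auto simp: space_PiM PiE_def)
  then show ?thesis unfolding reduced2_def emeasure_distr[OF m S] by (simp only:)
qed

lemma moment2_box:
  assumes A: "A \<in> sets borel" "B \<in> sets borel"
  shows "emeasure moment2 (A \<times> B) =
    ennreal (intensity M X J) * (\<integral>\<^sup>+x\<in>B. emeasure reduced2 ((\<lambda>z. z + x) -` A) \<partial>lborel)"
proof -
  define D where "D l = (if l = 1 then A else B)" for l :: nat
  have D: "D l \<in> sets borel" for l using A by (simp add: D_def)
  have sh: "(\<lambda>y. y - x) ` A = (\<lambda>z. z + x) -` A" for x by (auto intro: image_eqI[of _ _ "_ + x"])
  have "shifted_box 2 D x = (\<Pi>\<^sub>E l\<in>{1..<2}. (\<lambda>z. z + x) -` A)" for x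
    unfolding Ico_1_2 by (intro PiE_cong) (simp add: D_def sh)
  moreover have "(\<lambda>z. z + x) -` A \<in> sets borel" for x
    using measurable_sets[of "\<lambda>z. z + x" borel borel A] A by simp
  ultimately have box: "emeasure (reduced_moment M X J 2) (shifted_box 2 D x) = emeasure reduced2 ((\<lambda>z. z + x) -` A)" for x
    by (simp only: emeasure_reduced2)
  have "emeasure moment2 (A \<times> B) = factorial_moment M X J {1..2} D"
    using emeasure_moment2[of D, OF D D] by (simp add: D_def)
  also have "\<dots> = ennreal (intensity M X J) * (\<integral>\<^sup>+x\<in>D 2. emeasure (reduced_moment M X J 2) (shifted_box 2 D x) \<partial>lborel)"
    using is_reduced_moment_reduced D unfolding is_reduced_moment_def by blast
  finally show ?thesis unfolding box by (simp add: D_def)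
qed

text \<open>The chosen measure is known only through the box identity, so local finiteness has to be
  extracted from it: for every \<open>x\<close> in the unit ball the ball of radius \<open>n\<close>
  is contained in the ball of radius \<open>n + 1\<close> shifted by \<open>-x\<close>.\<close>

lemma sigma_finite_reduced2: "sigma_finite_measure reduced2"
proof (rule sigma_finite_measure_balls)
  fix n :: nat
  let ?l = "ennreal (intensity M X J)"
  let ?A = "ball 0 (real n + 1) :: 'a set" and ?B = "ball 0 1 :: 'a set"
  have lb: "emeasure lborel ?B > 0"
    using open_not_negligible[of ?B] by (simp add: negligible_iff_null_sets null_sets_completion_iff null_sets_def zero_less_iff_neq_zero)
  have "emeasure reduced2 (ball 0 (real n)) * (?l * emeasure lborel ?B) =
      ?l * (\<integral>\<^sup>+x\<in>?B. emeasure reduced2 (ball 0 (real n)) \<partial>lborel)"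
    by (subst nn_integral_cmult_indicator) (simp_all add: mult_ac)
  also have "\<dots> \<le> ?l * (\<integral>\<^sup>+x\<in>?B. emeasure reduced2 ((\<lambda>z. z + x) -` ?A) \<partial>lborel)"
  proof (intro mult_left_mono nn_integral_mono)
    fix x :: 'a
    have "emeasure reduced2 (ball 0 (real n)) \<le> emeasure reduced2 ((\<lambda>z. z + x) -` ?A)" if "x \<in> ?B"
    proof (rule emeasure_mono)
      show "ball 0 (real n) \<subseteq> (\<lambda>z. z + x) -` ?A"
      proof
        fix z :: 'a assume "z \<in> ball 0 (real n)"
        then show "z \<in> (\<lambda>z. z + x) -` ?A" using that norm_triangle_ineq[of z x] by simp
      qed
      show "(\<lambda>z. z + x) -` ?A \<in> sets reduced2"
        using measurable_sets[of "\<lambda>z. z + x" borel borel ?A] by simp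
    qed
    then show "emeasure reduced2 (ball 0 (real n)) * indicator ?B x \<le> emeasure reduced2 ((\<lambda>z. z + x) -` ?A) * indicator ?B x"
      by (auto simp: indicator_def)
  qed simp
  also have "\<dots> = emeasure moment2 (?A \<times> ?B)" by (rule moment2_box[symmetric]) auto
  also have "\<dots> \<le> emeasure moment2 (?A \<times> ?A)" by (rule emeasure_mono) auto
  also have "\<dots> < \<infinity>" by (rule moment_finite) auto
  finally have fin: "emeasure reduced2 (ball 0 (real n)) * (?l * emeasure lborel ?B) < \<infinity>" .
  have "?l * emeasure lborel ?B \<noteq> 0" using lb pos by auto
  with fin show "emeasure reduced2 (ball 0 (real n)) < \<infinity>"
    by (auto simp: ennreal_mult_less_top ennreal_mult_eq_top_iff less_top)
qed simp

text \<open>Agreement on boxes identifies two locally finite measures, which extends the defining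
  identity to functions that are not products, such as the edge-corrected weight.\<close>

lemma nn_integral_moment2_reduced2:
  assumes H: "H \<in> borel_measurable borel"
  shows "(\<integral>\<^sup>+p. H p \<partial>moment2) = ennreal (intensity M X J) * (\<integral>\<^sup>+z. (\<integral>\<^sup>+x. H (z + x, x) \<partial>lborel) \<partial>reduced2)"
proof -
  interpret S: sigma_finite_measure reduced2 by (rule sigma_finite_reduced2)
  interpret pair_sigma_finite reduced2 "lborel :: 'a measure" ..
  let ?l = "ennreal (intensity M X J)"
  let ?T = "\<lambda>p. (fst p + snd p, snd p) :: 'a \<times> 'a"
  have s: "sets (reduced2 \<Otimes>\<^sub>M (lborel :: 'a measure)) = sets (borel \<Otimes>\<^sub>M borel)" by (intro sets_pair_measure_cong) simp_all
  have T: "?T \<in> measurable (reduced2 \<Otimes>\<^sub>M lborel) borel"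
    unfolding measurable_cong_sets[OF s refl] by (simp flip: borel_prod)
  define \<nu> where "\<nu> = distr (density (reduced2 \<Otimes>\<^sub>M lborel) (\<lambda>_. ?l)) borel ?T"
  have nu: "(\<integral>\<^sup>+p. F p \<partial>\<nu>) = ?l * (\<integral>\<^sup>+z. (\<integral>\<^sup>+x. F (z + x, x) \<partial>lborel) \<partial>reduced2)" if F: "F \<in> borel_measurable borel" for F
  proof -
    have FT: "(\<lambda>p. F (?T p)) \<in> borel_measurable (reduced2 \<Otimes>\<^sub>M lborel)"
      by (rule measurable_compose[OF T F])
    have "(\<integral>\<^sup>+p. F p \<partial>\<nu>) = (\<integral>\<^sup>+p. F (?T p) \<partial>density (reduced2 \<Otimes>\<^sub>M lborel) (\<lambda>_. ?l))"
      unfolding \<nu>_def by (rule nn_integral_distr_eq) (use T F in auto)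
    also have "\<dots> = ?l * (\<integral>\<^sup>+p. F (?T p) \<partial>(reduced2 \<Otimes>\<^sub>M lborel))"
      using FT by (simp add: nn_integral_density nn_integral_cmult)
    also have "(\<integral>\<^sup>+p. F (?T p) \<partial>(reduced2 \<Otimes>\<^sub>M lborel)) = (\<integral>\<^sup>+z. (\<integral>\<^sup>+x. F (z + x, x) \<partial>lborel) \<partial>reduced2)"
      by (subst lborel.nn_integral_fst[OF FT, symmetric]) simp
    finally show ?thesis .
  qed
  have "moment2 = \<nu>"
  proof (rule measure_eqI_boxes)
    fix A B :: "'a set" assume A[measurable]: "A \<in> sets borel" "B \<in> sets borel"
    have AB: "A \<times> B \<in> sets borel" by (simp flip: borel_prod)
    have "emeasure \<nu> (A \<times> B) = (\<integral>\<^sup>+p. indicator (A \<times> B) p \<partial>\<nu>)" using AB by (simp add: \<nu>_def)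
    also have "\<dots> = ?l * (\<integral>\<^sup>+z. (\<integral>\<^sup>+x. indicator A (z + x) * indicator B x \<partial>lborel) \<partial>reduced2)"
      by (subst nu) (use AB in \<open>auto simp: indicator_times intro!: borel_measurable_indicator\<close>)
    also have "(\<integral>\<^sup>+z. (\<integral>\<^sup>+x. indicator A (z + x) * indicator B x \<partial>lborel) \<partial>reduced2) =
       (\<integral>\<^sup>+x. (\<integral>\<^sup>+z. indicator A (z + x) * indicator B x \<partial>reduced2) \<partial>lborel)"
      by (rule Fubini'[symmetric]) measurable
    also have "\<dots> = (\<integral>\<^sup>+x\<in>B. emeasure reduced2 ((\<lambda>z. z + x) -` A) \<partial>lborel)"
    proof (rule nn_integral_cong)
      fix x
      have pre: "(\<lambda>z. z + x) -` A \<in> sets reduced2"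
        using measurable_sets[of "\<lambda>z. z + x" borel borel A] A by simp
      have "(\<integral>\<^sup>+z. indicator A (z + x) * indicator B x \<partial>reduced2) = (\<integral>\<^sup>+z. indicator ((\<lambda>z. z + x) -` A) z * indicator B x \<partial>reduced2)"
        by (simp add: indicator_def)
      also have "\<dots> = emeasure reduced2 ((\<lambda>z. z + x) -` A) * indicator B x"
        using pre by (subst nn_integral_multc) simp_all
      finally show "(\<integral>\<^sup>+z. indicator A (z + x) * indicator B x \<partial>reduced2) = emeasure reduced2 ((\<lambda>z. z + x) -` A) * indicator B x" .
    qed
    finally show "emeasure moment2 (A \<times> B) = emeasure \<nu> (A \<times> B)"
      using moment2_box[OF A] by simp
  qed (auto intro: moment_finite(2)[simplified] simp: \<nu>_def)
  then show ?thesis using nu[OF H] by simp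
qed

end

end

section \<open>Moment functionals in terms of reduced cumulants\<close>

lemma measure_functional_indicator:
  assumes "measure_functional L" and E: "E \<in> sets borel"
  shows "measure_functional (\<lambda>F. L (\<lambda>x. indicator E x * F x))"
  using assms(1)
proof induction
  case (base \<mu>)
  interpret finite_measure \<mu> by fact
  note [measurable_cong] = base(2)
  have [measurable]: "E \<in> sets \<mu>" using E base by simp
  have s: "sets (density \<mu> (\<lambda>x. indicator E x)) = sets borel" using base(2) by simp
  have f: "finite_measure (density \<mu> (\<lambda>x. indicator E x))"
    by (rule finite_measureI) (simp add: emeasure_density)
  show ?case
  proof (rule measure_functional.cong[OF measure_functional.base[OF f s]])
    fix F :: "'a \<Rightarrow> real" assume F: "bounded_borel F"
    have "integral\<^sup>L (density \<mu> (\<lambda>x. ennreal (indicator E x))) F = (\<integral>x. indicator E x *\<^sub>R F x \<partial>\<mu>)"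
      using F by (intro integral_density) auto
    then show "(\<integral>x. indicator E x * F x \<partial>\<mu>) = integral\<^sup>L (density \<mu> (\<lambda>x. indicator E x)) F"
      by (simp add: ennreal_indicator)
  qed
next
  case (lin L L' a b)
  from measure_functional.lin[OF lin.IH, of a b] show ?case .
next
  case (cong L L')
  show ?case
    by (rule measure_functional.cong[OF cong.IH])
       (simp add: cong.hyps bounded_borel_mult bounded_borel_indicator E)
qed

text \<open>Undoes the reduction: \<open>x\<close> is the base point in \<open>W\<close>,
  \<open>u\<close> the relative positions distributed by \<open>P\<close>, and \<open>S u x\<close>
  the resulting tuple. \<open>E\<close> is later a power of \<open>W\<close>, which keeps all
  coordinates in the window.\<close>

definition shift_functional ::
  "'a::euclidean_space set \<Rightarrow> ('u \<Rightarrow> 'a \<Rightarrow> 'b) \<Rightarrow> 'b set \<Rightarrow> 'u measure \<Rightarrow> ('b \<Rightarrow> real) \<Rightarrow> real" where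
  "shift_functional W S E P F = (\<integral>x. indicator W x * (\<integral>u. indicator E (S u x) * F (S u x) \<partial>P) \<partial>lborel)"

text \<open>The underlying finite measure is the image under \<open>S\<close> of Lebesgue measure on
  \<open>W\<close> times \<open>P\<close>, cut down to \<open>E\<close>.\<close>

lemma measure_functional_shift:
  fixes W :: "'a::euclidean_space set" and S :: "'u \<Rightarrow> 'a \<Rightarrow> 'b::second_countable_topology"
  assumes P: "finite_measure P" and W: "bounded W" "W \<in> sets borel" and E: "E \<in> sets borel"
    and S: "(\<lambda>(x, u). S u x) \<in> measurable (borel \<Otimes>\<^sub>M P) borel"
  shows "measure_functional (shift_functional W S E P)"
proof -
  interpret P: finite_measure P by fact
  define V where "V = density lborel (\<lambda>x::'a. indicator W x)"
  have V: "sets V = sets borel" by (simp add: V_def)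
  have "emeasure lborel W < \<infinity>" by (rule emeasure_bounded_finite[OF W(1)])
  then have fV: "finite_measure V"
    unfolding V_def using W by (intro finite_measureI) (simp add: emeasure_density)
  interpret V: finite_measure V by fact
  interpret VP: pair_sigma_finite V P ..
  have S': "(\<lambda>(x, u). S u x) \<in> measurable (V \<Otimes>\<^sub>M P) borel"
    using S by (simp add: measurable_cong_sets[OF sets_pair_measure_cong[OF V refl] refl])
  interpret VPf: finite_measure "V \<Otimes>\<^sub>M P" by (rule finite_measure_pair_measure) fact+
  interpret D: finite_measure "distr (V \<Otimes>\<^sub>M P) borel (\<lambda>(x, u). S u x)"
    by (rule VPf.finite_measure_distr[OF S'])
  have "measure_functional (\<lambda>F. integral\<^sup>L (distr (V \<Otimes>\<^sub>M P) borel (\<lambda>(x, u). S u x)) (\<lambda>x. indicator E x * F x))"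
    by (intro measure_functional_indicator[OF measure_functional.base] E D.finite_measure_axioms) simp
  then show ?thesis
  proof (rule measure_functional.cong)
    fix F :: "'b \<Rightarrow> real" assume F: "bounded_borel F"
    let ?H = "\<lambda>x. indicator E x * F x"
    have H: "bounded_borel ?H" using F E by (intro bounded_borel_mult bounded_borel_indicator)
    have int: "integrable (V \<Otimes>\<^sub>M P) (\<lambda>p. ?H (case p of (x, u) \<Rightarrow> S u x))"
      by (rule integrable_distr[OF S' integrable_bounded_borel[OF D.finite_measure_axioms H]]) simp
    have "integral\<^sup>L (distr (V \<Otimes>\<^sub>M P) borel (\<lambda>(x, u). S u x)) ?H = (\<integral>p. ?H (case p of (x, u) \<Rightarrow> S u x) \<partial>(V \<Otimes>\<^sub>M P))"
      using H by (intro integral_distr S') auto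
    also have "\<dots> = (\<integral>x. (\<integral>u. ?H (S u x) \<partial>P) \<partial>V)"
      using VP.integral_fst'[OF int] by simp
    also have "\<dots> = (\<integral>x. indicator W x *\<^sub>R (\<integral>u. ?H (S u x) \<partial>P) \<partial>lborel)"
    proof -
      have "(\<lambda>(x, u). ?H (S u x)) \<in> borel_measurable (borel \<Otimes>\<^sub>M P)"
        using measurable_compose[OF S bounded_borel_measurable[OF H]] by (simp add: case_prod_beta)
      then have "(\<lambda>x. \<integral>u. ?H (S u x) \<partial>P) \<in> borel_measurable borel"
        by (rule P.borel_measurable_lebesgue_integral)
      then show ?thesis
        unfolding V_def ennreal_indicator[symmetric] using W by (intro integral_density) auto
    qed
    finally show "shift_functional W S E P F = integral\<^sup>L (distr (V \<Otimes>\<^sub>M P) borel (\<lambda>(x, u). S u x)) ?H"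
      by (simp add: shift_functional_def)
  qed
qed

text \<open>Integrability of \<open>f\<close> may fail, since its integral is then 0 and the
  dominating integral is nonnegative. This spares integrability proofs in the bounds that
  follow.\<close>

lemma abs_integral_le:
  fixes f g :: "'b \<Rightarrow> real"
  assumes "integrable N g" "\<And>x. x \<in> space N \<Longrightarrow> \<bar>f x\<bar> \<le> g x"
  shows "\<bar>integral\<^sup>L N f\<bar> \<le> integral\<^sup>L N g"
proof (cases "integrable N f")
  case True
  have "\<bar>integral\<^sup>L N f\<bar> \<le> (\<integral>x. \<bar>f x\<bar> \<partial>N)" by (rule integral_abs_bound)
  also have "\<dots> \<le> integral\<^sup>L N g" using True assms by (intro integral_mono) auto
  finally show ?thesis .
next
  case False
  have "0 \<le> integral\<^sup>L N g" using assms(2) by (intro Bochner_Integration.integral_nonneg) (meson abs_ge_zero order_trans)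
  then show ?thesis using False by (simp add: not_integrable_integral_eq)
qed

text \<open>The bound \<open>h\<close> depends on the base point alone, so the integration over
  relative positions contributes exactly the total mass of \<open>P\<close>. This is how finite
  total variation enters the variance estimates.\<close>

lemma shift_functional_bound:
  assumes P: "finite_measure P" and h: "integrable lborel (\<lambda>x. indicator W x * h x)"
    and F: "\<And>x u. x \<in> W \<Longrightarrow> \<bar>F (S u x)\<bar> \<le> h x"
  shows "\<bar>shift_functional W S E P F\<bar> \<le> measure P (space P) * (\<integral>x. indicator W x * h x \<partial>lborel)"
proof -
  interpret P: finite_measure P by fact
  have inner: "\<bar>\<integral>u. indicator E (S u x) * F (S u x) \<partial>P\<bar> \<le> measure P (space P) * h x" if "x \<in> W" for x
  proof -
    have "\<bar>\<integral>u. indicator E (S u x) * F (S u x) \<partial>P\<bar> \<le> (\<integral>u. h x \<partial>P)"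
    proof (rule abs_integral_le)
      fix u
      show "\<bar>indicator E (S u x) * F (S u x)\<bar> \<le> h x"
        using F[OF that, of u] by (auto simp: indicator_def intro: order_trans[OF abs_ge_zero])
    qed simp
    then show ?thesis by simp
  qed
  have "\<bar>shift_functional W S E P F\<bar> \<le> (\<integral>x. measure P (space P) * (indicator W x * h x) \<partial>lborel)"
    unfolding shift_functional_def
    by (rule abs_integral_le) (use h inner in \<open>auto simp: indicator_def\<close>)
  then show ?thesis by simp
qed

lemma shift_functional_mult:
  "shift_functional W S E P (\<lambda>x. c * F x) = c * shift_functional W S E P F"
  by (simp add: shift_functional_def mult.left_commute[of _ c])

section \<open>Cumulant functionals and the moment-cumulant expansion\<close>

locale B4_process = point_process M X J
  for M :: "'w measure" and X :: "nat \<Rightarrow> 'w \<Rightarrow> 'a::euclidean_space" and J :: "'w \<Rightarrow> nat set" +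
  assumes mixing: "B4_mixing M X J" and pos: "intensity M X J > 0"
begin

abbreviation lam :: real where "lam \<equiv> intensity M X J"

lemma cumulant_sets:
  assumes "k \<in> {2, 3, 4}"
  shows "sets (fst (reduced_cumulant M X J k)) = sets (tuples k)"
    "sets (snd (reduced_cumulant M X J k)) = sets (tuples k)"
  using mixing assms unfolding B4_mixing_def is_reduced_cumulant_def by blast+

lemma cumulant_finite:
  assumes "k \<in> {2, 3, 4}"
  shows "finite_measure (fst (reduced_cumulant M X J k))" "finite_measure (snd (reduced_cumulant M X J k))"
proof -
  have "total_variation (reduced_cumulant M X J k) < \<infinity>"
    using mixing assms unfolding B4_mixing_def by blast
  then show "finite_measure (fst (reduced_cumulant M X J k))" "finite_measure (snd (reduced_cumulant M X J k))"
    by (auto intro!: finite_measureI simp: total_variation_def)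
qed

definition variation :: "nat \<Rightarrow> real" where
  "variation k = measure (fst (reduced_cumulant M X J k)) (space (fst (reduced_cumulant M X J k)))
     + measure (snd (reduced_cumulant M X J k)) (space (snd (reduced_cumulant M X J k)))"

lemma variation_nonneg: "0 \<le> variation k"
  by (simp add: variation_def)

text \<open>Integration against a factorial cumulant measure, with the positive and negative Jordan
  parts of the reduced measure integrated separately.\<close>

definition cumulant_functional ::
  "nat \<Rightarrow> ((nat \<Rightarrow> 'a) \<Rightarrow> 'a \<Rightarrow> 'b) \<Rightarrow> 'b set \<Rightarrow> 'a set \<Rightarrow> ('b \<Rightarrow> real) \<Rightarrow> real" where
  "cumulant_functional k S E W F = lam * (shift_functional W S E (fst (reduced_cumulant M X J k)) F -
      shift_functional W S E (snd (reduced_cumulant M X J k)) F)"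

lemma measure_functional_cumulant:
  fixes S :: "(nat \<Rightarrow> 'a) \<Rightarrow> 'a \<Rightarrow> 'b::second_countable_topology"
  assumes k: "k \<in> {2, 3, 4}" and W: "bounded W" "W \<in> sets borel" and E: "E \<in> sets borel"
    and S: "(\<lambda>(x, u). S u x) \<in> measurable (borel \<Otimes>\<^sub>M tuples k) borel"
  shows "measure_functional (cumulant_functional k S E W)"
proof -
  have S1: "(\<lambda>(x, u). S u x) \<in> measurable (borel \<Otimes>\<^sub>M fst (reduced_cumulant M X J k)) borel"
    "(\<lambda>(x, u). S u x) \<in> measurable (borel \<Otimes>\<^sub>M snd (reduced_cumulant M X J k)) borel"
    using S by (simp_all add: measurable_cong_sets[OF sets_pair_measure_cong[OF refl cumulant_sets(1)[OF k]] refl]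
        measurable_cong_sets[OF sets_pair_measure_cong[OF refl cumulant_sets(2)[OF k]] refl])
  from measure_functional.lin[OF measure_functional_shift[OF cumulant_finite(1)[OF k] W E S1(1)]
     measure_functional_shift[OF cumulant_finite(2)[OF k] W E S1(2)], of lam "-lam"]
  show ?thesis
    by (rule measure_functional.cong) (simp add: cumulant_functional_def algebra_simps)
qed

lemma cumulant_functional_bound:
  assumes k: "k \<in> {2, 3, 4}" and h: "integrable lborel (\<lambda>x. indicator W x * h x)"
    and F: "\<And>x u. x \<in> W \<Longrightarrow> \<bar>F (S u x)\<bar> \<le> h x"
  shows "\<bar>cumulant_functional k S E W F\<bar> \<le> lam * variation k * (\<integral>x. indicator W x * h x \<partial>lborel)"
proof -
  have "\<bar>cumulant_functional k S E W F\<bar> \<le> lam * (\<bar>shift_functional W S E (fst (reduced_cumulant M X J k)) F\<bar> +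
      \<bar>shift_functional W S E (snd (reduced_cumulant M X J k)) F\<bar>)"
    unfolding cumulant_functional_def abs_mult using pos by (intro mult_mono abs_triangle_ineq4) auto
  also have "\<dots> \<le> lam * (measure (fst (reduced_cumulant M X J k)) (space (fst (reduced_cumulant M X J k))) * (\<integral>x. indicator W x * h x \<partial>lborel)
     + measure (snd (reduced_cumulant M X J k)) (space (snd (reduced_cumulant M X J k))) * (\<integral>x. indicator W x * h x \<partial>lborel))"
    using pos by (intro mult_left_mono add_mono shift_functional_bound cumulant_finite k h F) auto
  finally show ?thesis by (simp add: variation_def algebra_simps)
qed

lemma cumulant_functional_mult:
  "cumulant_functional k S E W (\<lambda>x. c * F x) = c * cumulant_functional k S E W F"
  by (simp add: cumulant_functional_def shift_functional_mult algebra_simps)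

lemma integral_shifted_box:
  assumes P: "finite_measure P" "sets P = sets (tuples k)"
    and A: "\<And>l. l \<in> {1..<k} \<Longrightarrow> A l \<in> sets borel"
  shows "measure P (shifted_box k A x) = (\<integral>u. (\<Prod>l\<in>{1..<k}. indicator (A l) (u l + x)) \<partial>P)"
proof -
  interpret finite_measure P by fact
  have sh: "(\<lambda>y. y - x) ` A l = (\<lambda>z. z + x) -` A l" for l by (auto intro: image_eqI[of _ _ "_ + x"])
  have sh': "(\<lambda>y. y - x) ` A l \<in> sets borel" if "l \<in> {1..<k}" for l
    unfolding sh using measurable_sets[of "\<lambda>z. z + x" borel borel "A l"] A[OF that] by simp
  have S: "shifted_box k A x \<in> sets P"
    unfolding P(2) by (intro sets_PiM_I_finite) (use sh' in auto)
  have "measure P (shifted_box k A x) = (\<integral>u. indicator (shifted_box k A x) u \<partial>P)"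
    using S by simp
  also have "\<dots> = (\<integral>u. (\<Prod>l\<in>{1..<k}. indicator (A l) (u l + x)) \<partial>P)"
  proof (rule Bochner_Integration.integral_cong[OF refl])
    fix u assume "u \<in> space P"
    then have "u \<in> extensional {1..<k}" using sets_eq_imp_space_eq[OF P(2)] by (auto simp: space_PiM PiE_def)
    then have "u \<in> shifted_box k A x \<longleftrightarrow> (\<forall>l\<in>{1..<k}. u l + x \<in> A l)"
      by (auto simp: sh PiE_def Pi_def)
    moreover have "(\<Prod>l\<in>{1..<k}. indicator (A l) (u l + x) :: real) = (if \<forall>l\<in>{1..<k}. u l + x \<in> A l then 1 else 0)"
      by (auto simp: indicator_def prod_zero_iff)
    ultimately show "indicator (shifted_box k A x) u = (\<Prod>l\<in>{1..<k}. indicator (A l) (u l + x) :: real)"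
      by (simp add: indicator_def)
  qed
  finally show ?thesis .
qed

text \<open>The defining identity of the reduced cumulant enters here. Finiteness of both Jordan
  parts permits splitting the signed integral into two.\<close>

lemma cumulant_functional_box:
  assumes k: "k \<in> {2, 3, 4}" and A: "\<And>l. l \<in> {1..k} \<Longrightarrow> A l \<in> sets borel \<and> bounded (A l)"
    and F: "\<And>x u. indicator W x * (indicator E (S u x) * F (S u x)) = indicator (A k) x * (\<Prod>l\<in>{1..<k}. indicator (A l) (u l + x))"
  shows "cumulant_functional k S E W F = factorial_cumulant M X J k A"
proof -
  let ?G = "reduced_cumulant M X J k"
  have "factorial_cumulant M X J k A = lam * (LINT x:A k|lborel. signed_value ?G (shifted_box k A x))"
    using mixing k A unfolding B4_mixing_def is_reduced_cumulant_def by blast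
  have A': "A l \<in> sets borel" if "l \<in> {1..<k}" for l using A that by auto
  let ?I = "\<lambda>P x. indicator (A k) x * measure P (shifted_box k A x)"
  have half: "shift_functional W S E P F = (\<integral>x. ?I P x \<partial>lborel)" "integrable lborel (?I P)"
    if P: "finite_measure P" "sets P = sets (tuples k)" for P
  proof -
    interpret P: finite_measure P by fact
    have "indicator W x * (\<integral>u. indicator E (S u x) * F (S u x) \<partial>P) = ?I P x" for x
    proof -
      have "indicator W x * (\<integral>u. indicator E (S u x) * F (S u x) \<partial>P) =
          (\<integral>u. indicator W x * (indicator E (S u x) * F (S u x)) \<partial>P)" by (rule integral_mult_right_zero[symmetric])
      also have "\<dots> = (\<integral>u. indicator (A k) x * (\<Prod>l\<in>{1..<k}. indicator (A l) (u l + x)) \<partial>P)" by (simp only: F)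
      also have "\<dots> = indicator (A k) x * (\<integral>u. (\<Prod>l\<in>{1..<k}. indicator (A l) (u l + x)) \<partial>P)" by (rule integral_mult_right_zero)
      finally show ?thesis by (simp only: integral_shifted_box[OF P A'])
    qed
    then show "shift_functional W S E P F = (\<integral>x. ?I P x \<partial>lborel)" by (simp add: shift_functional_def)
    have "(\<lambda>x. \<integral>u. (\<Prod>l\<in>{1..<k}. indicator (A l) (u l + x)) \<partial>P :: real) \<in> borel_measurable borel"
    proof (rule P.borel_measurable_lebesgue_integral)
      have "(\<lambda>(x, u). (\<Prod>l\<in>{1..<k}. indicator (A l) (u l + x) :: real)) \<in> borel_measurable (borel \<Otimes>\<^sub>M tuples k)"
        unfolding case_prod_beta
      proof (rule borel_measurable_prod)
        fix l assume l: "l \<in> {1..<k}"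
        have "(\<lambda>p. snd p l + fst p) \<in> measurable (borel \<Otimes>\<^sub>M tuples k) borel"
          using l by measurable
        then show "(\<lambda>p. indicator (A l) (snd p l + fst p) :: real) \<in> borel_measurable (borel \<Otimes>\<^sub>M tuples k)"
          by (rule measurable_compose) (simp add: A'[OF l] borel_measurable_indicator)
      qed
      then show "(\<lambda>(x, u). (\<Prod>l\<in>{1..<k}. indicator (A l) (u l + x) :: real)) \<in> borel_measurable (borel \<Otimes>\<^sub>M P)"
        by (subst measurable_cong_sets[OF sets_pair_measure_cong[OF refl P(2)] refl])
    qed
    then have m: "(\<lambda>x. measure P (shifted_box k A x)) \<in> borel_measurable borel"
      by (simp only: integral_shifted_box[OF P A'])
    have Ak: "A k \<in> sets borel" "bounded (A k)" using A k by auto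
    have "integrable lborel (\<lambda>x. measure P (space P) * indicator (A k) x :: real)"
      using Ak emeasure_bounded_finite[OF Ak(2)] by (intro integrable_mult_right) simp
    then show "integrable lborel (?I P)"
      by (rule Bochner_Integration.integrable_bound) (use m Ak P.bounded_measure in \<open>auto simp: indicator_def\<close>)
  qed
  have "cumulant_functional k S E W F = lam * (\<integral>x. ?I (fst ?G) x - ?I (snd ?G) x \<partial>lborel)"
    using half[OF cumulant_finite(1)[OF k] cumulant_sets(1)[OF k]] half[OF cumulant_finite(2)[OF k] cumulant_sets(2)[OF k]]
    by (simp add: cumulant_functional_def)
  also have "\<dots> = lam * (LINT x:A k|lborel. signed_value ?G (shifted_box k A x))"
    by (simp add: set_lebesgue_integral_def signed_value_def algebra_simps)
  finally show ?thesis using \<open>factorial_cumulant M X J k A = _\<close> by simp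
qed

text \<open>\<open>g1\<close> to \<open>g4\<close> integrate against the factorial cumulant measures
  of orders one to four on powers of \<open>W\<close>; in \<open>g2\<close> to \<open>g4\<close> the
  last coordinate is the base point. The first cumulant is the intensity measure itself.\<close>

definition g1 :: "'a set \<Rightarrow> ('a \<Rightarrow> real) \<Rightarrow> real" where
  "g1 W F = lam * (\<integral>x. indicator W x * F x \<partial>lborel)"
definition g2 :: "'a set \<Rightarrow> ('a \<times> 'a \<Rightarrow> real) \<Rightarrow> real" where
  "g2 W = cumulant_functional 2 (\<lambda>u x. (u 1 + x, x)) (W \<times> W) W"
definition g3 :: "'a set \<Rightarrow> ('a \<times> 'a \<times> 'a \<Rightarrow> real) \<Rightarrow> real" where
  "g3 W = cumulant_functional 3 (\<lambda>u x. (u 1 + x, u 2 + x, x)) (W \<times> W \<times> W) W"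
definition g4 :: "'a set \<Rightarrow> ('a \<times> 'a \<times> 'a \<times> 'a \<Rightarrow> real) \<Rightarrow> real" where
  "g4 W = cumulant_functional 4 (\<lambda>u x. (u 1 + x, u 2 + x, u 3 + x, x)) (W \<times> W \<times> W \<times> W) W"

context
  fixes W :: "'a set"
  assumes W: "bounded W" "W \<in> sets borel"
begin

lemma measure_functional_g:
  "measure_functional (g1 W)" "measure_functional (g2 W)" "measure_functional (g3 W)" "measure_functional (g4 W)"
proof -
  have P: "finite_measure (density lborel (\<lambda>x::'a. ennreal (indicator W x)))"
    using W emeasure_bounded_finite[OF W(1)] by (intro finite_measureI) (simp add: emeasure_density ennreal_indicator)
  have L: "measure_functional (integral\<^sup>L (density lborel (\<lambda>x::'a. ennreal (indicator W x))))"
    by (rule measure_functional.base[OF P]) simp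
  show "measure_functional (g1 W)"
  proof (rule measure_functional.cong[OF measure_functional.lin[OF L L, of lam 0]])
    fix F :: "'a \<Rightarrow> real" assume "bounded_borel F"
    then have "integral\<^sup>L (density lborel (\<lambda>x::'a. ennreal (indicator W x))) F = (\<integral>x. indicator W x *\<^sub>R F x \<partial>lborel)"
      using W by (intro integral_density) auto
    then show "g1 W F = lam * integral\<^sup>L (density lborel (\<lambda>x. ennreal (indicator W x))) F +
         0 * integral\<^sup>L (density lborel (\<lambda>x. ennreal (indicator W x))) F"
      by (simp add: g1_def)
  qed
  have W2: "W \<times> W \<in> sets borel" using W by (simp flip: borel_prod)
  then have W3: "W \<times> W \<times> W \<in> sets borel" using W by (simp flip: borel_prod)
  then have W4: "W \<times> W \<times> W \<times> W \<in> sets borel" using W by (simp flip: borel_prod)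
  show "measure_functional (g2 W)" unfolding g2_def
  proof (rule measure_functional_cumulant[OF _ W W2])
    show "(\<lambda>(x, u). (u 1 + x, x)) \<in> borel \<Otimes>\<^sub>M tuples 2 \<rightarrow>\<^sub>M borel"
      by (subst borel_prod[symmetric]) measurable
  qed simp
  show "measure_functional (g3 W)" unfolding g3_def
  proof (rule measure_functional_cumulant[OF _ W W3])
    show "(\<lambda>(x, u). (u 1 + x, u 2 + x, x)) \<in> borel \<Otimes>\<^sub>M tuples 3 \<rightarrow>\<^sub>M borel"
      unfolding borel_prod[symmetric] by measurable
  qed simp
  show "measure_functional (g4 W)" unfolding g4_def
  proof (rule measure_functional_cumulant[OF _ W W4])
    show "(\<lambda>(x, u). (u 1 + x, u 2 + x, u 3 + x, x)) \<in> borel \<Otimes>\<^sub>M tuples 4 \<rightarrow>\<^sub>M borel"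
      unfolding borel_prod[symmetric] by measurable
  qed simp
qed

lemma avg_cong:
  shows "(\<And>x y. x \<in> W \<Longrightarrow> y \<in> W \<Longrightarrow> F2 (x, y) = F2' (x, y)) \<Longrightarrow> avg2 W F2 = avg2 W F2'"
    and "(\<And>x y z. x \<in> W \<Longrightarrow> y \<in> W \<Longrightarrow> z \<in> W \<Longrightarrow> F3 (x, y, z) = F3' (x, y, z)) \<Longrightarrow> avg3 W F3 = avg3 W F3'"
    and "(\<And>x y z w. x \<in> W \<Longrightarrow> y \<in> W \<Longrightarrow> z \<in> W \<Longrightarrow> w \<in> W \<Longrightarrow> F4 (x, y, z, w) = F4' (x, y, z, w)) \<Longrightarrow> avg4 W F4 = avg4 W F4'"
    and "(\<And>x. x \<in> W \<Longrightarrow> F1 x = F1' x) \<Longrightarrow> avg1 W F1 = avg1 W F1'"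
  unfolding avg1_def avg2_def avg3_def avg4_def
  by (intro Bochner_Integration.integral_cong refl sum.cong;
      auto simp: distinct2_def distinct3_def distinct4_def pts_def X2_def X3_def X4_def)+

text \<open>Projections instead of patterns, so that \<open>fst_conv\<close> and
  \<open>snd_conv\<close> evaluate the box on permuted tuples.\<close>

definition box2 :: "'a set \<Rightarrow> 'a set \<Rightarrow> 'a \<times> 'a \<Rightarrow> real" where
  "box2 A B = (\<lambda>p. indicator A (fst p) * indicator B (snd p))"
definition box3 :: "'a set \<Rightarrow> 'a set \<Rightarrow> 'a set \<Rightarrow> 'a \<times> 'a \<times> 'a \<Rightarrow> real" where
  "box3 A B C = (\<lambda>p. indicator A (fst p) * (indicator B (fst (snd p)) * indicator C (snd (snd p))))"
definition box4 :: "'a set \<Rightarrow> 'a set \<Rightarrow> 'a set \<Rightarrow> 'a set \<Rightarrow> 'a \<times> 'a \<times> 'a \<times> 'a \<Rightarrow> real" where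
  "box4 A B C D = (\<lambda>p. indicator A (fst p) * (indicator B (fst (snd p)) *
     (indicator C (fst (snd (snd p))) * indicator D (snd (snd (snd p))))))"

lemma factorial_moment_box:
  assumes A: "\<And>l. A l \<in> sets borel"
  defines "m \<equiv> \<lambda>K. enn2real (factorial_moment M X J K (\<lambda>l. A l \<inter> W))"
  shows "m {a} = avg1 W (indicator (A a))"
    and "a \<noteq> b \<Longrightarrow> m {a, b} = avg2 W (box2 (A a) (A b))"
    and "distinct [a, b, c] \<Longrightarrow> m {a, b, c} = avg3 W (box3 (A a) (A b) (A c))"
    and "distinct [a, b, c, d] \<Longrightarrow> m {a, b, c, d} = avg4 W (box4 (A a) (A b) (A c) (A d))"
proof -
  have A': "A l \<inter> W \<in> sets borel \<and> A l \<inter> W \<subseteq> W" for l using A W by auto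
  note fm = factorial_moment_avg[OF W, where A="\<lambda>l. A l \<inter> W", OF A']
  show "m {a} = avg1 W (indicator (A a))"
    unfolding m_def fm(1) by (rule avg_cong) (simp add: indicator_def)
  show "m {a, b} = avg2 W (box2 (A a) (A b))" if "a \<noteq> b"
    unfolding m_def fm(2)[OF that] by (rule avg_cong) (simp add: indicator_def box2_def)
  show "m {a, b, c} = avg3 W (box3 (A a) (A b) (A c))" if "distinct [a, b, c]"
    unfolding m_def fm(3)[OF that] by (rule avg_cong) (simp add: indicator_def box3_def)
  show "m {a, b, c, d} = avg4 W (box4 (A a) (A b) (A c) (A d))" if "distinct [a, b, c, d]"
    unfolding m_def fm(4)[OF that] by (rule avg_cong) (simp add: indicator_def box4_def)
qed

lemma g1_box:
  assumes "A \<in> sets borel" shows "g1 W (indicator A) = avg1 W (indicator A)"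
proof -
  have AW: "A \<inter> W \<in> sets borel" "bounded (A \<inter> W)" using assms W by (auto intro: bounded_subset)
  have "avg1 W (indicator A) = enn2real (factorial_moment M X J {1} (\<lambda>l. A \<inter> W))"
    using factorial_moment_box(1)[of "\<lambda>_. A" 1] assms by simp
  also have "\<dots> = enn2real (emeasure moment1 (A \<inter> W))"
    using emeasure_moment1[OF AW(1)] by simp
  also have "emeasure moment1 (A \<inter> W) = (\<integral>\<^sup>+x. indicator (A \<inter> W) x \<partial>moment1)" using AW by simp
  also have "\<dots> = ennreal lam * emeasure lborel (A \<inter> W)"
    using AW by (subst nn_integral_moment1_lborel) (auto intro!: borel_measurable_indicator)
  also have "enn2real \<dots> = lam * measure lborel (A \<inter> W)"
    using pos by (simp add: enn2real_mult measure_def)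
  also have "measure lborel (A \<inter> W) = (\<integral>x. indicator W x * indicator A x \<partial>lborel)"
    using AW by (simp add: indicator_inter_arith[symmetric] Int_commute)
  finally show ?thesis by (simp add: g1_def)
qed

text \<open>The reduced cumulant speaks about bounded sets only, hence the sets are first cut down
  to \<open>W\<close>; the functional does not see the difference. The definition of the cumulant
  then becomes the explicit partition formula.\<close>

lemma g2_box:
  assumes A: "A \<in> sets borel" "B \<in> sets borel"
  shows "g2 W (box2 A B) = avg2 W (box2 A B) - avg1 W (indicator A) * avg1 W (indicator B)"
proof -
  define D where "D l = (if l = 1 then A else B)" for l :: nat
  have D: "D l \<in> sets borel" for l using A by (simp add: D_def)
  have DW: "D l \<inter> W \<in> sets borel \<and> bounded (D l \<inter> W)" for l using D W by (auto intro: bounded_subset)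
  have I: "{1..<2} = {1::nat}" by auto
  have "g2 W (box2 A B) = factorial_cumulant M X J 2 (\<lambda>l. D l \<inter> W)"
    unfolding g2_def
    by (rule cumulant_functional_box[OF _ DW], simp, unfold I) (auto simp: indicator_def box2_def D_def)
  also have "\<dots> = partition_sum cumulant_weight (\<lambda>K. enn2real (factorial_moment M X J K (\<lambda>l. D l \<inter> W))) {1, 2}"
    by (simp only: factorial_cumulant_partition_sum Icc_1_2 one_le_numeral)
  also have "\<dots> = avg2 W (box2 (D 1) (D 2)) - avg1 W (indicator (D 1)) * avg1 W (indicator (D 2))"
    by (subst partition_sum_2) (simp_all add: factorial_moment_box[where A=D, OF D])
  finally show ?thesis by (simp add: D_def)
qed

lemma g3_box:
  assumes A: "A \<in> sets borel" "B \<in> sets borel" "C \<in> sets borel"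
  shows "g3 W (box3 A B C) = avg3 W (box3 A B C) - avg1 W (indicator A) * avg2 W (box2 B C)
     - avg1 W (indicator B) * avg2 W (box2 A C) - avg1 W (indicator C) * avg2 W (box2 A B)
     + 2 * avg1 W (indicator A) * avg1 W (indicator B) * avg1 W (indicator C)"
proof -
  define D where "D l = (if l = 1 then A else if l = 2 then B else C)" for l :: nat
  have D: "D l \<in> sets borel" for l using A by (simp add: D_def)
  have DW: "D l \<inter> W \<in> sets borel \<and> bounded (D l \<inter> W)" for l using D W by (auto intro: bounded_subset)
  have I: "{1..<3} = {1, 2::nat}" by auto
  have "g3 W (box3 A B C) = factorial_cumulant M X J 3 (\<lambda>l. D l \<inter> W)"
    unfolding g3_def
    by (rule cumulant_functional_box[OF _ DW], simp, unfold I) (auto simp: indicator_def box3_def D_def)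
  also have "\<dots> = partition_sum cumulant_weight (\<lambda>K. enn2real (factorial_moment M X J K (\<lambda>l. D l \<inter> W))) {1, 2, 3}"
    by (simp only: factorial_cumulant_partition_sum Icc_1_3 one_le_numeral)
  also have "\<dots> = avg3 W (box3 (D 1) (D 2) (D 3)) - avg1 W (indicator (D 1)) * avg2 W (box2 (D 2) (D 3))
     - avg1 W (indicator (D 2)) * avg2 W (box2 (D 1) (D 3)) - avg1 W (indicator (D 3)) * avg2 W (box2 (D 1) (D 2))
     + 2 * avg1 W (indicator (D 1)) * avg1 W (indicator (D 2)) * avg1 W (indicator (D 3))"
    by (subst partition_sum_3) (simp_all add: factorial_moment_box[where A=D, OF D])
  finally show ?thesis by (simp add: D_def)
qed

lemma g4_box:
  assumes A: "A \<in> sets borel" "B \<in> sets borel" "C \<in> sets borel" "D \<in> sets borel"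
  defines "a \<equiv> \<lambda>S. avg1 W (indicator S)"
  shows "g4 W (box4 A B C D) = avg4 W (box4 A B C D)
     - a A * avg3 W (box3 B C D) - a B * avg3 W (box3 A C D) - a C * avg3 W (box3 A B D) - a D * avg3 W (box3 A B C)
     - avg2 W (box2 A B) * avg2 W (box2 C D) - avg2 W (box2 A C) * avg2 W (box2 B D) - avg2 W (box2 A D) * avg2 W (box2 B C)
     + 2 * avg2 W (box2 A B) * a C * a D + 2 * avg2 W (box2 A C) * a B * a D + 2 * avg2 W (box2 A D) * a B * a C
     + 2 * avg2 W (box2 B C) * a A * a D + 2 * avg2 W (box2 B D) * a A * a C + 2 * avg2 W (box2 C D) * a A * a B
     - 6 * a A * a B * a C * a D"
proof -
  define Z where "Z l = (if l = 1 then A else if l = 2 then B else if l = 3 then C else D)" for l :: nat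
  have Z: "Z l \<in> sets borel" for l using A by (simp add: Z_def)
  have ZW: "Z l \<inter> W \<in> sets borel \<and> bounded (Z l \<inter> W)" for l using Z W by (auto intro: bounded_subset)
  have I: "{1..<4} = {1, 2, 3::nat}" by auto
  have "g4 W (box4 A B C D) = factorial_cumulant M X J 4 (\<lambda>l. Z l \<inter> W)"
    unfolding g4_def
    by (rule cumulant_functional_box[OF _ ZW], simp, unfold I) (auto simp: indicator_def box4_def Z_def)
  also have "\<dots> = partition_sum cumulant_weight (\<lambda>K. enn2real (factorial_moment M X J K (\<lambda>l. Z l \<inter> W))) {1, 2, 3, 4}"
    by (simp only: factorial_cumulant_partition_sum Icc_1_4 one_le_numeral)
  also note partition_sum_4[of 1 2 3 4, simplified]
  finally show ?thesis
    by (simp only: factorial_moment_box(1,2)[where A=Z, OF Z] factorial_moment_box(3,4)[where A=Z, OF Z, simplified]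
        one_eq_numeral_iff numeral_eq_one_iff numeral_eq_iff semiring_norm not_False_eq_True simp_thms)
       (simp add: Z_def a_def)
qed

lemma g_mult:
  "g1 W (\<lambda>x. c * F1 x) = c * g1 W F1" "g2 W (\<lambda>x. c * F2 x) = c * g2 W F2" "g3 W (\<lambda>x. c * F3 x) = c * g3 W F3"
  by (simp_all add: g1_def g2_def g3_def cumulant_functional_mult mult.left_commute[of _ c])

text \<open>The positions in which a constant factor appears once a coordinate of a product has been
  integrated out.\<close>

lemma g_mult':
  "g1 W (\<lambda>x. F1 x * c) = c * g1 W F1"
  "g2 W (\<lambda>x. F2 x * c) = c * g2 W F2"
  "g2 W (\<lambda>x. F2 x * (c * G2 x)) = c * g2 W (\<lambda>x. F2 x * G2 x)"
  "g2 W (\<lambda>x. F2 x * (G2 x * c)) = c * g2 W (\<lambda>x. F2 x * G2 x)"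
  "g3 W (\<lambda>x. F3 x * c) = c * g3 W F3"
  "g3 W (\<lambda>x. F3 x * (c * G3 x)) = c * g3 W (\<lambda>x. F3 x * G3 x)"
  "g3 W (\<lambda>x. F3 x * (G3 x * c)) = c * g3 W (\<lambda>x. F3 x * G3 x)"
  "g3 W (\<lambda>x. F3 x * (G3 x * (c * H3 x))) = c * g3 W (\<lambda>x. F3 x * (G3 x * H3 x))"
  "g3 W (\<lambda>x. F3 x * (G3 x * (H3 x * c))) = c * g3 W (\<lambda>x. F3 x * (G3 x * H3 x))"
  unfolding g_mult[symmetric] by (simp_all add: mult_ac)

text \<open>\<open>T\<close> rearranges the coordinates of two blocks into one tuple, which covers
  every way of distributing the arguments of \<open>F\<close> over the blocks of a
  partition.\<close>

lemma measure_functional_prod_push: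
  assumes "(\<lambda>p. T (fst p) (snd p)) \<in> borel_measurable (borel \<Otimes>\<^sub>M borel)"
    and "measure_functional (L :: ('x::second_countable_topology \<Rightarrow> real) \<Rightarrow> real)"
    and "measure_functional (L' :: ('y::second_countable_topology \<Rightarrow> real) \<Rightarrow> real)"
  shows "measure_functional (\<lambda>F. L (\<lambda>x. L' (\<lambda>y. F (T x y :: 'z::second_countable_topology))))"
proof -
  have "(\<lambda>p. T (fst p) (snd p)) \<in> borel_measurable borel" using assms(1) by (simp add: borel_prod)
  from measure_functional_push[OF measure_functional_prod[OF assms(2,3)] this] show ?thesis by simp
qed

lemma measure_functional_g11: "measure_functional (\<lambda>F. g1 W (\<lambda>x. g1 W (\<lambda>y. F (x, y))))"
  by (rule measure_functional_prod[OF measure_functional_g(1) measure_functional_g(1)])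

lemma avg1_decomposition:
  assumes "bounded_borel F"
  shows "avg1 W F = g1 W F"
proof -
  have a: "bounded_functional (avg1 W)" by (rule bounded_functional_avg[OF W])
  have b: "bounded_functional (g1 W)" by (rule measure_functional_imp_bounded[OF measure_functional_g(1)])
  have "avg1 W F - g1 W F = 0"
  proof (rule bounded_functional_eq0[OF bounded_functional_diff[OF a b], where E="sets borel", OF _ _ _ _ assms])
    show "Int_stable (sets (borel :: 'a measure))" by (rule sets.Int_stable)
    show "sets borel = sigma_sets UNIV (sets (borel :: 'a measure))"
      by (metis sets.sigma_sets_eq space_borel)
  qed (auto simp: g1_box)
  then show ?thesis by simp
qed

text \<open>Moments as sums over set partitions of products of cumulants, the inverse of the
  cumulant formula. Both sides are bounded functionals, so the verification takes place on
  boxes.\<close>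

lemma avg2_decomposition:
  assumes "bounded_borel F"
  shows "avg2 W F = g2 W F + g1 W (\<lambda>x. g1 W (\<lambda>y. F (x, y)))"
proof (rule bounded_functional_eqI2[OF _ _ _ assms])
  show "bounded_functional (avg2 W)" by (rule bounded_functional_avg[OF W])
  show "bounded_functional (\<lambda>F. g2 W F + g1 W (\<lambda>x. g1 W (\<lambda>y. F (x, y))))"
    by (intro bounded_functional_add measure_functional_imp_bounded measure_functional_g measure_functional_g11)
  fix A B :: "'a set" assume A: "A \<in> sets borel" "B \<in> sets borel"
  show "avg2 W (\<lambda>(x, y). indicator A x * indicator B y) = g2 W (\<lambda>(x, y). indicator A x * indicator B y) +
       g1 W (\<lambda>x. g1 W (\<lambda>y. (case (x, y) of (x, y) \<Rightarrow> indicator A x * indicator B y)))"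
  proof -
    have b: "(\<lambda>(x, y). indicator A x * indicator B y) = box2 A B" by (auto simp: box2_def)
    show ?thesis using g2_box[OF A] A unfolding b by (simp add: box2_def g_mult g_mult' g1_box)
  qed
qed

lemma avg3_decomposition:
  assumes "bounded_borel F"
  shows "avg3 W F = g3 W F
    + (g2 W (\<lambda>p. g1 W (\<lambda>z. F (fst p, snd p, z))) + g2 W (\<lambda>p. g1 W (\<lambda>y. F (fst p, y, snd p)))
      + g2 W (\<lambda>p. g1 W (\<lambda>x. F (x, fst p, snd p))))
    + g1 W (\<lambda>x. g1 W (\<lambda>y. g1 W (\<lambda>z. F (x, y, z))))"
proof (rule bounded_functional_eqI3[OF _ _ _ assms])
  show "bounded_functional (avg3 W)" by (rule bounded_functional_avg[OF W])
  have 21: "measure_functional (\<lambda>F. g2 W (\<lambda>x. g1 W (\<lambda>y. F (T x y :: 'a \<times> 'a \<times> 'a))))"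
    if "(\<lambda>p. T (fst p) (snd p)) \<in> borel_measurable (borel \<Otimes>\<^sub>M borel)" for T
    by (rule measure_functional_prod_push[OF that measure_functional_g(2,1)])
  have m: "measure_functional (\<lambda>F. g2 W (\<lambda>p. g1 W (\<lambda>z. F (fst p, snd p, z :: 'a))))"
    "measure_functional (\<lambda>F. g2 W (\<lambda>p. g1 W (\<lambda>y. F (fst p, y :: 'a, snd p))))"
    "measure_functional (\<lambda>F. g2 W (\<lambda>p. g1 W (\<lambda>x. F (x :: 'a, fst p, snd p))))"
    by (rule 21; unfold borel_prod[symmetric]; measurable)+
  show "bounded_functional (\<lambda>F. g3 W F
    + (g2 W (\<lambda>p. g1 W (\<lambda>z. F (fst p, snd p, z))) + g2 W (\<lambda>p. g1 W (\<lambda>y. F (fst p, y, snd p)))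
      + g2 W (\<lambda>p. g1 W (\<lambda>x. F (x, fst p, snd p))))
    + g1 W (\<lambda>x. g1 W (\<lambda>y. g1 W (\<lambda>z. F (x, y, z)))))"
    by (intro bounded_functional_add m[THEN measure_functional_imp_bounded] measure_functional_g[THEN measure_functional_imp_bounded]
        measure_functional_prod[OF measure_functional_g(1) measure_functional_g11, THEN measure_functional_imp_bounded])
  fix A B C :: "'a set" assume A: "A \<in> sets borel" "B \<in> sets borel" "C \<in> sets borel"
  note b3 = g3_box[OF A] and b2 = g2_box[OF A(1,2)] g2_box[OF A(1,3)] g2_box[OF A(2,3)]
  let ?F = "\<lambda>p. indicator A (fst p) * (indicator B (fst (snd p)) * indicator C (snd (snd p))) :: real"
  have "avg3 W ?F = g3 W ?F
    + (g2 W (\<lambda>p. g1 W (\<lambda>z. ?F (fst p, snd p, z))) + g2 W (\<lambda>p. g1 W (\<lambda>y. ?F (fst p, y, snd p)))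
      + g2 W (\<lambda>p. g1 W (\<lambda>x. ?F (x, fst p, snd p))))
    + g1 W (\<lambda>x. g1 W (\<lambda>y. g1 W (\<lambda>z. ?F (x, y, z))))"
    using b3 b2 A
    by (simp add: g_mult g_mult' g1_box mult.assoc flip: box2_def box3_def) (simp add: algebra_simps)
  then show "avg3 W (\<lambda>(x, y, z). indicator A x * (indicator B y * indicator C z)) =
     g3 W (\<lambda>(x, y, z). indicator A x * (indicator B y * indicator C z))
    + (g2 W (\<lambda>p. g1 W (\<lambda>z. (\<lambda>(x, y, z). indicator A x * (indicator B y * indicator C z)) (fst p, snd p, z)))
      + g2 W (\<lambda>p. g1 W (\<lambda>y. (\<lambda>(x, y, z). indicator A x * (indicator B y * indicator C z)) (fst p, y, snd p)))
      + g2 W (\<lambda>p. g1 W (\<lambda>x. (\<lambda>(x, y, z). indicator A x * (indicator B y * indicator C z)) (x, fst p, snd p))))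
    + g1 W (\<lambda>x. g1 W (\<lambda>y. g1 W (\<lambda>z. (\<lambda>(x, y, z). indicator A x * (indicator B y * indicator C z)) (x, y, z))))"
    by (simp add: case_prod_beta')
qed

text \<open>The 15 partitions of four coordinates, grouped by block sizes: 4, then 3+1 (four terms),
  2+2 (three terms), 2+1+1 (six terms) and 1+1+1+1. On boxes everything cancels except the fourth
  moment.\<close>

lemma avg4_decomposition:
  assumes "bounded_borel F"
  shows "avg4 W F = g4 W F
    + (g3 W (\<lambda>p. g1 W (\<lambda>w. F (fst p, fst (snd p), snd (snd p), w)))
      + g3 W (\<lambda>p. g1 W (\<lambda>z. F (fst p, fst (snd p), z, snd (snd p))))
      + g3 W (\<lambda>p. g1 W (\<lambda>y. F (fst p, y, fst (snd p), snd (snd p))))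
      + g3 W (\<lambda>p. g1 W (\<lambda>x. F (x, fst p, fst (snd p), snd (snd p)))))
    + (g2 W (\<lambda>p. g2 W (\<lambda>q. F (fst p, snd p, fst q, snd q)))
      + g2 W (\<lambda>p. g2 W (\<lambda>q. F (fst p, fst q, snd p, snd q)))
      + g2 W (\<lambda>p. g2 W (\<lambda>q. F (fst p, fst q, snd q, snd p))))
    + (g2 W (\<lambda>p. g1 W (\<lambda>z. g1 W (\<lambda>w. F (fst p, snd p, z, w))))
      + g2 W (\<lambda>p. g1 W (\<lambda>y. g1 W (\<lambda>w. F (fst p, y, snd p, w))))
      + g2 W (\<lambda>p. g1 W (\<lambda>y. g1 W (\<lambda>z. F (fst p, y, z, snd p))))
      + g2 W (\<lambda>p. g1 W (\<lambda>x. g1 W (\<lambda>w. F (x, fst p, snd p, w))))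
      + g2 W (\<lambda>p. g1 W (\<lambda>x. g1 W (\<lambda>z. F (x, fst p, z, snd p))))
      + g2 W (\<lambda>p. g1 W (\<lambda>x. g1 W (\<lambda>y. F (x, y, fst p, snd p)))))
    + g1 W (\<lambda>x. g1 W (\<lambda>y. g1 W (\<lambda>z. g1 W (\<lambda>w. F (x, y, z, w)))))" (is "avg4 W F = ?R F")
proof (rule bounded_functional_eqI4[where L'="?R", OF _ _ _ assms])
  show "bounded_functional (avg4 W)" by (rule bounded_functional_avg[OF W])
  have 31: "measure_functional (\<lambda>F. g3 W (\<lambda>x. g1 W (\<lambda>y. F (T x y :: 'a \<times> 'a \<times> 'a \<times> 'a))))"
    if "(\<lambda>p. T (fst p) (snd p)) \<in> borel_measurable (borel \<Otimes>\<^sub>M borel)" for T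
    by (rule measure_functional_prod_push[OF that measure_functional_g(3,1)])
  have m3: "measure_functional (\<lambda>F. g3 W (\<lambda>p. g1 W (\<lambda>w. F (fst p, fst (snd p), snd (snd p), w :: 'a))))"
    "measure_functional (\<lambda>F. g3 W (\<lambda>p. g1 W (\<lambda>z. F (fst p, fst (snd p), z :: 'a, snd (snd p)))))"
    "measure_functional (\<lambda>F. g3 W (\<lambda>p. g1 W (\<lambda>y. F (fst p, y :: 'a, fst (snd p), snd (snd p)))))"
    "measure_functional (\<lambda>F. g3 W (\<lambda>p. g1 W (\<lambda>x. F (x :: 'a, fst p, fst (snd p), snd (snd p)))))"
    by (rule 31; unfold borel_prod[symmetric]; measurable)+
  have 22: "measure_functional (\<lambda>F. g2 W (\<lambda>x. g2 W (\<lambda>y. F (T x y :: 'a \<times> 'a \<times> 'a \<times> 'a))))"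
    if "(\<lambda>p. T (fst p) (snd p)) \<in> borel_measurable (borel \<Otimes>\<^sub>M borel)" for T
    by (rule measure_functional_prod_push[OF that measure_functional_g(2,2)])
  have m2: "measure_functional (\<lambda>F. g2 W (\<lambda>p. g2 W (\<lambda>q. F (fst p, snd p, fst q, snd q :: 'a))))"
    "measure_functional (\<lambda>F. g2 W (\<lambda>p. g2 W (\<lambda>q. F (fst p, fst q, snd p, snd q :: 'a))))"
    "measure_functional (\<lambda>F. g2 W (\<lambda>p. g2 W (\<lambda>q. F (fst p, fst q, snd q, snd p :: 'a))))"
    by (rule 22; unfold borel_prod[symmetric]; measurable)+
  have 211: "measure_functional (\<lambda>F. g2 W (\<lambda>x. g1 W (\<lambda>y. g1 W (\<lambda>z. F (T x (y, z) :: 'a \<times> 'a \<times> 'a \<times> 'a)))))"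
    if "(\<lambda>p. T (fst p) (snd p)) \<in> borel_measurable (borel \<Otimes>\<^sub>M borel)" for T
    by (rule measure_functional_prod_push[OF that measure_functional_g(2) measure_functional_g11])
  have m1: "measure_functional (\<lambda>F. g2 W (\<lambda>p. g1 W (\<lambda>z. g1 W (\<lambda>w. F (fst p, snd p, z, w :: 'a)))))"
    using 211[of "\<lambda>p q. (fst p, snd p, fst q, snd q)"] by (simp flip: borel_prod)
  have m11: "measure_functional (\<lambda>F. g2 W (\<lambda>p. g1 W (\<lambda>y. g1 W (\<lambda>w. F (fst p, y, snd p, w :: 'a)))))"
    using 211[of "\<lambda>p q. (fst p, fst q, snd p, snd q)"] by (simp flip: borel_prod)
  have m12: "measure_functional (\<lambda>F. g2 W (\<lambda>p. g1 W (\<lambda>y. g1 W (\<lambda>z. F (fst p, y, z, snd p :: 'a)))))"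
    using 211[of "\<lambda>p q. (fst p, fst q, snd q, snd p)"] by (simp flip: borel_prod)
  have m13: "measure_functional (\<lambda>F. g2 W (\<lambda>p. g1 W (\<lambda>x. g1 W (\<lambda>w. F (x, fst p, snd p, w :: 'a)))))"
    using 211[of "\<lambda>p q. (fst q, fst p, snd p, snd q)"] by (simp flip: borel_prod)
  have m14: "measure_functional (\<lambda>F. g2 W (\<lambda>p. g1 W (\<lambda>x. g1 W (\<lambda>z. F (x, fst p, z, snd p :: 'a)))))"
    using 211[of "\<lambda>p q. (fst q, fst p, snd q, snd p)"] by (simp flip: borel_prod)
  have m15: "measure_functional (\<lambda>F. g2 W (\<lambda>p. g1 W (\<lambda>x. g1 W (\<lambda>y. F (x, y, fst p, snd p :: 'a)))))"
    using 211[of "\<lambda>p q. (fst q, snd q, fst p, snd p)"] by (simp flip: borel_prod)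
  note g111 = measure_functional_prod[OF measure_functional_g(1) measure_functional_g11]
  note g1111 = measure_functional_prod[OF measure_functional_g(1) g111]
  show "bounded_functional ?R"
    by (intro bounded_functional_add m3[THEN measure_functional_imp_bounded] m2[THEN measure_functional_imp_bounded]
        m1[THEN measure_functional_imp_bounded] m11[THEN measure_functional_imp_bounded] m12[THEN measure_functional_imp_bounded]
        m13[THEN measure_functional_imp_bounded] m14[THEN measure_functional_imp_bounded] m15[THEN measure_functional_imp_bounded]
        measure_functional_g[THEN measure_functional_imp_bounded] g1111[THEN measure_functional_imp_bounded])
  fix A B C D :: "'a set" assume A: "A \<in> sets borel" "B \<in> sets borel" "C \<in> sets borel" "D \<in> sets borel"
  have f: "(\<lambda>(x, y, z, w). indicator A x * (indicator B y * (indicator C z * indicator D w))) = box4 A B C D"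
    by (auto simp: box4_def)
  define a where "a S = avg1 W (indicator S)" for S
  note g1_box' = g1_box[folded a_def]
  note g2_box' = g2_box[folded a_def, unfolded box2_def]
  note g3_box' = g3_box[folded a_def, unfolded box2_def box3_def]
  note b4 = g4_box[OF A, folded a_def, unfolded box2_def box3_def box4_def]
  have R: "?R (box4 A B C D) = avg4 W (box4 A B C D)"
    unfolding box4_def using A
    by (simp only: fst_conv snd_conv mult.assoc g_mult g_mult' g1_box' g2_box' g3_box' b4) (simp add: algebra_simps)
  show "avg4 W (\<lambda>(x, y, z, w). indicator A x * (indicator B y * (indicator C z * indicator D w))) =
      ?R (\<lambda>(x, y, z, w). indicator A x * (indicator B y * (indicator C z * indicator D w)))"
    unfolding f by (rule R[symmetric])
qed

end

end

section \<open>Variance bounds\<close>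

context B4_process
begin

context
  fixes W :: "'a set"
  assumes W: "bounded W" "W \<in> sets borel"
begin

private abbreviation vol :: real where "vol \<equiv> measure lborel W"

lemma integral_window_const: "(\<integral>x. indicator W x * c \<partial>lborel) = c * vol" "integrable lborel (\<lambda>x. indicator W x * (c :: real))"
  using W emeasure_bounded_finite[OF W(1)] by simp_all

lemma g1_mono_bound:
  assumes "bounded_borel F" "\<And>x. x \<in> W \<Longrightarrow> \<bar>F x\<bar> \<le> c"
  shows "\<bar>g1 W F\<bar> \<le> lam * (c * vol)"
proof -
  have "\<bar>\<integral>x. indicator W x * F x \<partial>lborel\<bar> \<le> (\<integral>x. indicator W x * c \<partial>lborel)"
    by (rule abs_integral_le[OF integral_window_const(2)]) (use assms(2) in \<open>auto simp: indicator_def\<close>)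
  then show ?thesis using pos by (simp add: g1_def abs_mult integral_window_const mult.commute)
qed

lemma g_bound_const:
  "(\<And>p. \<bar>F2 p\<bar> \<le> c) \<Longrightarrow> \<bar>g2 W F2\<bar> \<le> lam * variation 2 * (c * vol)"
  "(\<And>p. \<bar>F3 p\<bar> \<le> c) \<Longrightarrow> \<bar>g3 W F3\<bar> \<le> lam * variation 3 * (c * vol)"
  "(\<And>p. \<bar>F4 p\<bar> \<le> c) \<Longrightarrow> \<bar>g4 W F4\<bar> \<le> lam * variation 4 * (c * vol)"
  unfolding g2_def g3_def g4_def
  by (subst integral_window_const(1)[symmetric],
      rule cumulant_functional_bound[OF _ integral_window_const(2)]; simp)+

lemma g2_bound:
  assumes "integrable lborel (\<lambda>x. indicator W x * h x)" "\<And>x y. y \<in> W \<Longrightarrow> \<bar>F (x, y)\<bar> \<le> h y"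
  shows "\<bar>g2 W F\<bar> \<le> lam * variation 2 * (\<integral>x. indicator W x * h x \<partial>lborel)"
  unfolding g2_def by (rule cumulant_functional_bound) (use assms in auto)

text \<open>The variance equals \<open>g2 W\<close> of the tensor square of \<open>q\<close> plus
  \<open>g1 W\<close> of its pointwise square. One factor is bounded uniformly and the other kept in
  mean, because the weight to which this is applied is small in mean but not uniformly near the
  boundary.\<close>

lemma variance_linear_statistic:
  assumes q: "bounded_borel q" and Q: "\<And>x. \<bar>q x\<bar> \<le> Q"
  defines "S \<equiv> \<lambda>\<omega>. \<Sum>t\<in>pts W \<omega>. q (X t \<omega>)"
  shows "integrable M S" "integrable M (\<lambda>\<omega>. (S \<omega>)\<^sup>2)"
    and "expectation S = g1 W q"
    and "expectation (\<lambda>\<omega>. (S \<omega>)\<^sup>2) - (expectation S)\<^sup>2 \<le> lam * (variation 2 + 1) * Q * (\<integral>x. indicator W x * \<bar>q x\<bar> \<partial>lborel)"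
proof -
  have q2: "bounded_borel (\<lambda>x. (q x)\<^sup>2)" using bounded_borel_mult[OF q q] by (simp add: power2_eq_square)
  have qq: "bounded_borel (\<lambda>p. q (fst p) * q (snd p))"
    using bounded_borel_times[OF q q] by (simp add: case_prod_beta')
  show int: "integrable M S" unfolding S_def by (rule integrable_random_sums(1)[OF W q])
  show ES: "expectation S = g1 W q"
    unfolding S_def avg1_decomposition[OF W q, symmetric] avg1_def ..
  have ae: "AE \<omega> in M. (\<Sum>t\<in>distinct2 (pts W \<omega>). q (fst (X2 t \<omega>)) * q (snd (X2 t \<omega>))) + (\<Sum>t\<in>pts W \<omega>. (q (X t \<omega>))\<^sup>2) = (S \<omega>)\<^sup>2"
    using AE_finite_pts[OF W(1)]
    by eventually_elim (simp add: S_def sum_square_distinct2 X2_def case_prod_beta')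
  note i = integrable_random_sums(2)[OF W qq] integrable_random_sums(1)[OF W q2]
  have mS: "S \<in> borel_measurable M" using int by auto
  show "integrable M (\<lambda>\<omega>. (S \<omega>)\<^sup>2)"
    by (rule integrable_cong_AE_imp[OF Bochner_Integration.integrable_add[OF i]]) (use mS ae in auto)
  have "expectation (\<lambda>\<omega>. (S \<omega>)\<^sup>2) = expectation (\<lambda>\<omega>. (\<Sum>t\<in>distinct2 (pts W \<omega>). q (fst (X2 t \<omega>)) * q (snd (X2 t \<omega>)))
      + (\<Sum>t\<in>pts W \<omega>. (q (X t \<omega>))\<^sup>2))"
    using ae i mS by (intro integral_cong_AE) (auto elim: eventually_mono)
  also have "\<dots> = avg2 W (\<lambda>p. q (fst p) * q (snd p)) + avg1 W (\<lambda>x. (q x)\<^sup>2)"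
    unfolding avg1_def avg2_def using i by simp
  also have "\<dots> = g2 W (\<lambda>p. q (fst p) * q (snd p)) + (g1 W q)\<^sup>2 + g1 W (\<lambda>x. (q x)\<^sup>2)"
    by (simp add: avg1_decomposition[OF W q2] avg2_decomposition[OF W qq] g_mult[OF W] g_mult'[OF W])
       (simp add: power2_eq_square)
  finally have eq: "expectation (\<lambda>\<omega>. (S \<omega>)\<^sup>2) - (expectation S)\<^sup>2 = g2 W (\<lambda>p. q (fst p) * q (snd p)) + g1 W (\<lambda>x. (q x)\<^sup>2)"
    by (simp add: ES)
  obtain x0 :: 'a where True by simp
  have Q0: "0 \<le> Q" using Q[of x0] by linarith
  have iq: "integrable lborel (\<lambda>x. indicator W x * \<bar>q x\<bar>)"
    by (rule Bochner_Integration.integrable_bound[OF integral_window_const(2)[of Q]])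
       (use q order_trans[OF Q abs_ge_self] W in \<open>auto simp: indicator_def\<close>)
  then have iQ: "integrable lborel (\<lambda>x. indicator W x * (Q * \<bar>q x\<bar>))"
    using integrable_mult_right[of Q lborel "\<lambda>x. indicator W x * \<bar>q x\<bar>"] by (simp add: mult.left_commute)
  have Qi: "(\<integral>x. indicator W x * (Q * \<bar>q x\<bar>) \<partial>lborel) = Q * (\<integral>x. indicator W x * \<bar>q x\<bar> \<partial>lborel)"
    by (simp add: mult.left_commute[of _ Q])
  have "\<bar>g2 W (\<lambda>p. q (fst p) * q (snd p))\<bar> \<le> lam * variation 2 * (\<integral>x. indicator W x * (Q * \<bar>q x\<bar>) \<partial>lborel)"
    using Q by (intro g2_bound iQ) (auto simp: abs_mult intro!: mult_right_mono)
  moreover have "g1 W (\<lambda>x. (q x)\<^sup>2) \<le> lam * (\<integral>x. indicator W x * (Q * \<bar>q x\<bar>) \<partial>lborel)"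
    unfolding g1_def
  proof (intro mult_left_mono)
    have "\<bar>\<integral>x. indicator W x * (q x)\<^sup>2 \<partial>lborel\<bar> \<le> (\<integral>x. indicator W x * (Q * \<bar>q x\<bar>) \<partial>lborel)"
    proof (rule abs_integral_le[OF iQ])
      fix x :: 'a
      have "(q x)\<^sup>2 \<le> Q * \<bar>q x\<bar>"
        using mult_right_mono[OF Q[of x] abs_ge_zero[of "q x"]] by (simp add: power2_eq_square)
      then show "\<bar>indicator W x * (q x)\<^sup>2\<bar> \<le> indicator W x * (Q * \<bar>q x\<bar>)" by (auto simp: indicator_def)
    qed
    then show "(\<integral>x. indicator W x * (q x)\<^sup>2 \<partial>lborel) \<le> (\<integral>x. indicator W x * (Q * \<bar>q x\<bar>) \<partial>lborel)" by linarith
  qed (use pos in simp)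
  ultimately show "expectation (\<lambda>\<omega>. (S \<omega>)\<^sup>2) - (expectation S)\<^sup>2 \<le> lam * (variation 2 + 1) * Q * (\<integral>x. indicator W x * \<bar>q x\<bar> \<partial>lborel)"
    unfolding eq Qi by (simp add: algebra_simps)
qed

text \<open>
  The linear statistic with weight \<open>2 * g1 W (\<lambda>y. f (x, y))\<close> is the Hajek-type projection of the
  double sum; after subtracting it all terms of leading order in the variance cancel.
\<close>

lemma variance_projected_double_sum:
  assumes f: "bounded_borel f" and sym: "\<And>x y. f (x, y) = f (y, x)"
    and f0: "\<And>p. 0 \<le> f p" and fc: "\<And>p. f p \<le> c"
    and m: "\<And>x. (\<integral>y. indicator W y * f (x, y) \<partial>lborel) \<le> m"
  defines "p \<equiv> \<lambda>x. 2 * g1 W (\<lambda>y. f (x, y))"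
  defines "U \<equiv> \<lambda>\<omega>. (\<Sum>t\<in>distinct2 (pts W \<omega>). f (X2 t \<omega>)) - (\<Sum>t\<in>pts W \<omega>. p (X t \<omega>))"
  shows "bounded_borel p" "integrable M U" "integrable M (\<lambda>\<omega>. (U \<omega>)\<^sup>2)"
    and "expectation (\<lambda>\<omega>. (U \<omega>)\<^sup>2) - (expectation U)\<^sup>2 \<le>
      c * c * vol * (lam * (variation 4 + 4 * variation 3 + 2 * variation 2)) +
      c * m * vol * (lam * lam * (8 * variation 3 + 2 * variation 2 * variation 2 + 20 * variation 2 + 2))"
proof -
  define r where "r x = g1 W (\<lambda>y. f (x, y))" for x
  have r: "bounded_borel r" unfolding r_def[abs_def]
    by (rule bounded_borel_measure_functional[OF measure_functional_g(1)[OF W] f])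
  have p_r: "p = (\<lambda>x. 2 * r x)" by (simp add: p_def r_def)
  show bp: "bounded_borel p" unfolding p_r by (rule bounded_borel_cmult[OF r])
  have r1: "g1 W (\<lambda>y. f (x, y)) = r x" for x by (simp add: r_def)
  have r2: "g1 W (\<lambda>x. f (x, y)) = r y" for y unfolding r_def by (subst sym) (rule refl)
  have r0: "0 \<le> r x" for x
    unfolding r_def g1_def using pos f0 by (intro mult_nonneg_nonneg Bochner_Integration.integral_nonneg) (auto simp: less_imp_le)
  have rm: "r x \<le> lam * m" for x
    unfolding r_def g1_def using pos m by (intro mult_left_mono) auto
  have c0: "0 \<le> c" using order_trans[OF f0 fc] by blast
  have m0: "0 \<le> m" by (rule order_trans[OF Bochner_Integration.integral_nonneg m]) (use f0 in auto)

  \<comment> \<open>The kernels of the seven sums over distinct tuples that arise from multiplying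
    out the square of \<open>U\<close>.\<close>
  define F4 where "F4 = (\<lambda>u. f (fst u, fst (snd u)) * f (fst (snd (snd u)), snd (snd (snd u))))"
  define F3 where "F3 = (\<lambda>u. f (fst u, fst (snd u)) * f (fst u, snd (snd u)))"
  define F2 where "F2 = (\<lambda>u. (f u)\<^sup>2)"
  define G3 where "G3 = (\<lambda>u. f (fst u, fst (snd u)) * p (snd (snd u)))"
  define G2 where "G2 = (\<lambda>u. f u * p (fst u))"
  define P2 where "P2 = (\<lambda>u::'a\<times>'a. p (fst u) * p (snd u))"
  define P1 where "P1 = (\<lambda>x. (p x)\<^sup>2)"
  have b: "bounded_borel F4" "bounded_borel F3" "bounded_borel F2" "bounded_borel G3" "bounded_borel G2" "bounded_borel P2" "bounded_borel P1"
    unfolding F4_def F3_def F2_def G3_def G2_def P2_def P1_def power2_eq_square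
    by (intro bounded_borel_mult f bp bounded_borel_compose[OF f] bounded_borel_compose[OF bp]; simp flip: borel_prod)+
  note i = integrable_random_sums(4)[OF W b(1)] integrable_random_sums(3)[OF W b(2)] integrable_random_sums(2)[OF W b(3)]
    integrable_random_sums(3)[OF W b(4)] integrable_random_sums(2)[OF W b(5)] integrable_random_sums(2)[OF W b(6)]
    integrable_random_sums(1)[OF W b(7)]
  have iU: "integrable M (\<lambda>\<omega>. \<Sum>t\<in>distinct2 (pts W \<omega>). f (X2 t \<omega>))" "integrable M (\<lambda>\<omega>. \<Sum>t\<in>pts W \<omega>. p (X t \<omega>))"
    by (rule integrable_random_sums(2)[OF W f] integrable_random_sums(1)[OF W bp])+
  then show intU: "integrable M U" unfolding U_def by auto
  have EU: "expectation U = avg2 W f - avg1 W p" unfolding U_def avg2_def avg1_def using iU by simp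
  let ?H = "\<lambda>\<omega>. (\<Sum>t\<in>distinct4 (pts W \<omega>). F4 (X4 t \<omega>)) + 4 * (\<Sum>t\<in>distinct3 (pts W \<omega>). F3 (X3 t \<omega>))
     + 2 * (\<Sum>t\<in>distinct2 (pts W \<omega>). F2 (X2 t \<omega>)) - 2 * (\<Sum>t\<in>distinct3 (pts W \<omega>). G3 (X3 t \<omega>))
     - 4 * (\<Sum>t\<in>distinct2 (pts W \<omega>). G2 (X2 t \<omega>))
     + (\<Sum>t\<in>distinct2 (pts W \<omega>). P2 (X2 t \<omega>)) + (\<Sum>t\<in>pts W \<omega>. P1 (X t \<omega>))"
  have ae: "AE \<omega> in M. ?H \<omega> = (U \<omega>)\<^sup>2"
    using AE_finite_pts[OF W(1)]
  proof eventually_elim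
    case (elim \<omega>)
    let ?a = "\<lambda>i j. f (X i \<omega>, X j \<omega>)" and ?b = "\<lambda>i. p (X i \<omega>)" and ?I = "pts W \<omega>"
    have e: "(\<Sum>t\<in>distinct2 ?I. f (X2 t \<omega>)) = (\<Sum>(i, j)\<in>distinct2 ?I. ?a i j)"
      by (simp add: X2_def case_prod_beta')
    have "(U \<omega>)\<^sup>2 = (\<Sum>(i, j)\<in>distinct2 ?I. ?a i j)\<^sup>2 - 2 * ((\<Sum>(i, j)\<in>distinct2 ?I. ?a i j) * (\<Sum>i\<in>?I. ?b i)) + (\<Sum>i\<in>?I. ?b i)\<^sup>2"
      unfolding U_def e by (simp add: power2_diff)
    also have "\<dots> = (\<Sum>(i, j, k, l)\<in>distinct4 ?I. ?a i j * ?a k l)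
      + 4 * (\<Sum>(i, j, k)\<in>distinct3 ?I. ?a i j * ?a i k) + 2 * (\<Sum>(i, j)\<in>distinct2 ?I. (?a i j)\<^sup>2)
      - 2 * ((\<Sum>(i, j, k)\<in>distinct3 ?I. ?a i j * ?b k) + 2 * (\<Sum>(i, j)\<in>distinct2 ?I. ?a i j * ?b i))
      + ((\<Sum>(i, j)\<in>distinct2 ?I. ?b i * ?b j) + (\<Sum>i\<in>?I. (?b i)\<^sup>2))"
      by (simp only: sum_distinct2_square[where a="?a", OF elim sym] sum_distinct2_times_sum[where a="?a", OF elim sym]
          sum_square_distinct2[OF elim])
    finally show ?case
      by (simp add: F4_def F3_def F2_def G3_def G2_def P2_def P1_def X2_def X3_def X4_def case_prod_beta')
  qed
  have intH: "integrable M ?H" using i by auto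
  show "integrable M (\<lambda>\<omega>. (U \<omega>)\<^sup>2)"
    by (rule integrable_cong_AE_imp[OF intH]) (use intU ae in auto)
  have "expectation (\<lambda>\<omega>. (U \<omega>)\<^sup>2) = expectation ?H"
    using intU intH ae by (intro integral_cong_AE) (auto elim: eventually_mono)
  also have "\<dots> = avg4 W F4 + 4 * avg3 W F3 + 2 * avg2 W F2 - 2 * avg3 W G3 - 4 * avg2 W G2 + avg2 W P2 + avg1 W P1"
    unfolding avg1_def avg2_def avg3_def avg4_def using i by simp
  finally have EU2: "expectation (\<lambda>\<omega>. (U \<omega>)\<^sup>2) =
      avg4 W F4 + 4 * avg3 W F3 + 2 * avg2 W F2 - 2 * avg3 W G3 - 4 * avg2 W G2 + avg2 W P2 + avg1 W P1" .

  \<comment> \<open>Names for the values of the partition terms; symmetry of \<open>f\<close> makes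
    many of the 15 terms coincide, and with these names the cancellation is linear
    arithmetic.\<close>
  define T2 where "T2 = g3 W (\<lambda>u. f (fst u, fst (snd u)) * r (snd (snd u)))"
  define T2' where "T2' = g3 W (\<lambda>u. f (snd u) * r (fst u))"
  define ga where "ga = g2 W (\<lambda>u. g2 W (\<lambda>v. f (fst u, fst v) * f (snd u, snd v)))"
  define gb where "gb = g2 W (\<lambda>u. g2 W (\<lambda>v. f (fst u, fst v) * f (snd v, snd u)))"
  define a where "a = g2 W f"
  define mm where "mm = g1 W r"
  define rr where "rr = g2 W (\<lambda>u. r (fst u) * r (snd u))"
  have rr': "g2 W (\<lambda>u. r (snd u) * r (fst u)) = rr" by (simp add: rr_def mult.commute)
  define e1 where "e1 = g2 W (\<lambda>u. f u * r (fst u))"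
  define e2 where "e2 = g2 W (\<lambda>u. g1 W (\<lambda>x. f (x, fst u) * f (x, snd u)))"
  define s where "s = g1 W (\<lambda>x. r x * r x)"
  define t where "t = g1 W (\<lambda>x. g1 W (\<lambda>y. f (x, y) * f (x, y)))"
  note gm = g_mult[OF W] g_mult'[OF W]
  have d4: "avg4 W F4 = g4 W F4 + (2 * T2 + 2 * T2') + (a * a + ga + gb) + (2 * a * mm + 4 * rr) + mm * mm"
    unfolding avg4_decomposition[OF W b(1)]
    by (simp add: F4_def gm r1 r2 rr' flip: T2_def T2'_def ga_def gb_def a_def mm_def rr_def)
  have d3: "avg3 W F3 = g3 W F3 + (2 * e1 + e2) + s"
    unfolding avg3_decomposition[OF W b(2)]
    by (simp add: F3_def gm r1 r2 flip: e1_def e2_def s_def)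
  have d2: "avg2 W F2 = g2 W F2 + t"
    unfolding avg2_decomposition[OF W b(3)] by (simp add: F2_def t_def power2_eq_square)
  have h3: "avg3 W G3 = g3 W G3 + (2 * mm * a + 4 * rr) + 2 * mm * mm"
    unfolding avg3_decomposition[OF W b(4)]
    by (simp add: G3_def p_r gm r1 r2 flip: a_def mm_def rr_def)
       (simp add: mult.assoc gm rr')
  have h2: "avg2 W G2 = g2 W G2 + 2 * s"
    unfolding avg2_decomposition[OF W b(5)]
    by (simp add: G2_def p_r gm r1 r2 mult.assoc flip: s_def)
  have k2: "avg2 W P2 = 4 * rr + 4 * mm * mm"
    unfolding avg2_decomposition[OF W b(6)]
    by (simp add: P2_def p_r gm mult.assoc flip: rr_def mm_def)
  have k1: "avg1 W P1 = 4 * s"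
    unfolding avg1_decomposition[OF W b(7)]
    by (simp add: P1_def p_r gm power2_eq_square mult.assoc flip: s_def)
  have l2: "avg2 W f = a + mm"
    unfolding avg2_decomposition[OF W f] by (simp add: r1 flip: a_def mm_def)
  have l1: "avg1 W p = 2 * mm"
    unfolding avg1_decomposition[OF W bp] by (simp add: p_r gm flip: mm_def)
  \<comment> \<open>The products of \<open>a\<close> and \<open>mm\<close> cancel against the
    squared mean \<open>(a - mm)^2\<close>. The coefficients of \<open>rr\<close> add up to 4 - 8 +
    4 and those of \<open>s\<close> to 4 - 8 + 4, which is what the factor 2 in \<open>p\<close>
    achieves.\<close>
  have var: "expectation (\<lambda>\<omega>. (U \<omega>)\<^sup>2) - (expectation U)\<^sup>2 =
      g4 W F4 + 2 * T2 + 2 * T2' + ga + gb + 4 * (g3 W F3 + 2 * e1 + e2) + 2 * (g2 W F2 + t)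
      + 2 * (- g3 W G3) + 4 * (- g2 W G2)"
    unfolding EU2 EU d4 d3 d2 h3 h2 k2 k1 l2 l1 by (simp add: power2_eq_square algebra_simps)

  \<comment> \<open>Every surviving term is at most a constant times \<open>c * c * vol\<close> or
    \<open>c * m * vol\<close>. With \<open>c\<close> of order \<open>1 / V\<close> and
    \<open>m\<close> of order \<open>|D| / V\<close> these are \<open>1 / V\<close> and
    \<open>|D| / V\<close>.\<close>
  have ff: "\<bar>f u * f v\<bar> \<le> c * c" for u v
    using f0[of u] f0[of v] fc[of u] fc[of v] by (simp add: abs_mult mult_mono)
  have fr: "\<bar>f u * r x\<bar> \<le> c * (lam * m)" for u x
    using f0[of u] fc[of u] r0[of x] rm[of x] c0 by (simp add: abs_mult mult_mono)
  have V0: "0 \<le> vol" by simp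
  have iW: "integrable lborel (\<lambda>y. indicator W y * f (x, y))" for x
    by (rule Bochner_Integration.integrable_bound[OF integral_window_const(2)[of c]])
       (use bounded_borel_Pair[OF f] f0 fc c0 W in \<open>auto simp: indicator_def\<close>)
  have iW': "integrable lborel (\<lambda>y. indicator W y * (c * f (x, y)))"
    "(\<integral>y. indicator W y * (c * f (x, y)) \<partial>lborel) \<le> c * m" for x
    using integrable_mult_right[OF iW, of c x] mult_left_mono[OF m c0, of x] by (simp_all add: mult.left_commute[of _ c])
  have prod_le: "\<bar>f u * f v\<bar> \<le> c * f v" for u v
    using f0[of u] f0[of v] fc[of u] by (simp add: abs_mult mult_right_mono)
  \<comment> \<open>The inner functional is bounded through its base point \<open>y\<close> alone,
    with \<open>z\<close> a coordinate frozen by the outer functional; integrating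
    \<open>f (z, y)\<close> over \<open>y\<close> then gives the marginal bound
    \<open>m\<close>.\<close>
  have in2: "\<bar>g2 W F\<bar> \<le> lam * variation 2 * (c * m)" if "\<And>x y. \<bar>F (x, y)\<bar> \<le> c * f (z, y)" for F z
  proof -
    have "\<bar>g2 W F\<bar> \<le> lam * variation 2 * (\<integral>y. indicator W y * (c * f (z, y)) \<partial>lborel)"
      using that by (intro g2_bound iW') auto
    also have "\<dots> \<le> lam * variation 2 * (c * m)"
      using iW' pos variation_nonneg by (intro mult_left_mono) auto
    finally show ?thesis .
  qed
  have in1: "\<bar>g1 W F\<bar> \<le> lam * (c * m)" if "\<And>y. \<bar>F y\<bar> \<le> c * f (z, y)" for F z
  proof -
    have "\<bar>\<integral>y. indicator W y * F y \<partial>lborel\<bar> \<le> (\<integral>y. indicator W y * (c * f (z, y)) \<partial>lborel)"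
      using that by (intro abs_integral_le iW') (auto simp: indicator_def)
    also have "\<dots> \<le> c * m" by (rule iW')
    finally show ?thesis using pos by (simp add: g1_def abs_mult)
  qed
  have B1: "\<bar>g4 W F4\<bar> \<le> lam * variation 4 * (c * c * vol)" unfolding F4_def by (intro g_bound_const ff)
  have B2: "\<bar>T2\<bar> \<le> lam * variation 3 * (c * (lam * m) * vol)" unfolding T2_def by (intro g_bound_const fr)
  have B3: "\<bar>T2'\<bar> \<le> lam * variation 3 * (c * (lam * m) * vol)" unfolding T2'_def by (intro g_bound_const fr)
  have B4: "\<bar>ga\<bar> \<le> lam * variation 2 * (lam * variation 2 * (c * m) * vol)"
    unfolding ga_def by (intro g_bound_const in2) (auto intro: prod_le)
  \<comment> \<open>Symmetry turns \<open>f (snd v, snd u)\<close> around, so that the base point of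
    the inner functional stands second as \<open>in2\<close> requires.\<close>
  have B5: "\<bar>gb\<bar> \<le> lam * variation 2 * (lam * variation 2 * (c * m) * vol)"
    unfolding gb_def by (intro g_bound_const in2) (subst (2) sym, auto intro: prod_le)
  have B6: "\<bar>g3 W F3\<bar> \<le> lam * variation 3 * (c * c * vol)" unfolding F3_def by (intro g_bound_const ff)
  have B7: "\<bar>e1\<bar> \<le> lam * variation 2 * (c * (lam * m) * vol)" unfolding e1_def by (intro g_bound_const fr)
  have B8: "\<bar>e2\<bar> \<le> lam * variation 2 * (lam * (c * m) * vol)"
    unfolding e2_def by (intro g_bound_const in1) (subst (2) sym, auto intro: prod_le)
  have B9: "\<bar>g2 W F2\<bar> \<le> lam * variation 2 * (c * c * vol)" unfolding F2_def power2_eq_square by (intro g_bound_const ff)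
  have B10: "\<bar>t\<bar> \<le> lam * (lam * (c * m) * vol)" unfolding t_def
  proof (rule g1_mono_bound)
    have "bounded_borel (\<lambda>u. f u * f u)" by (intro bounded_borel_mult f)
    from bounded_borel_measure_functional[OF measure_functional_g(1)[OF W] this]
    show "bounded_borel (\<lambda>x. g1 W (\<lambda>y. f (x, y) * f (x, y)))" .
    show "\<bar>g1 W (\<lambda>y. f (x, y) * f (x, y))\<bar> \<le> lam * (c * m)" for x
      by (rule in1) (rule prod_le)
  qed
  have B11: "\<bar>g3 W G3\<bar> \<le> lam * variation 3 * (2 * (c * (lam * m)) * vol)"
    unfolding G3_def p_r using fr by (intro g_bound_const) (simp add: abs_mult)
  have B12: "\<bar>g2 W G2\<bar> \<le> lam * variation 2 * (2 * (c * (lam * m)) * vol)"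
    unfolding G2_def p_r using fr by (intro g_bound_const) (simp add: abs_mult)
  have "expectation (\<lambda>\<omega>. (U \<omega>)\<^sup>2) - (expectation U)\<^sup>2 \<le>
     \<bar>g4 W F4\<bar> + 2 * \<bar>T2\<bar> + 2 * \<bar>T2'\<bar> + \<bar>ga\<bar> + \<bar>gb\<bar> + 4 * (\<bar>g3 W F3\<bar> + 2 * \<bar>e1\<bar> + \<bar>e2\<bar>) + 2 * (\<bar>g2 W F2\<bar> + \<bar>t\<bar>)
      + 2 * \<bar>g3 W G3\<bar> + 4 * \<bar>g2 W G2\<bar>"
    unfolding var
    by (intro add_mono mult_left_mono abs_ge_self abs_ge_minus_self) simp_all
  also have "\<dots> \<le> lam * variation 4 * (c * c * vol) + 2 * (lam * variation 3 * (c * (lam * m) * vol)) + 2 * (lam * variation 3 * (c * (lam * m) * vol))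
     + lam * variation 2 * (lam * variation 2 * (c * m) * vol) + lam * variation 2 * (lam * variation 2 * (c * m) * vol)
     + 4 * (lam * variation 3 * (c * c * vol) + 2 * (lam * variation 2 * (c * (lam * m) * vol)) + lam * variation 2 * (lam * (c * m) * vol))
     + 2 * (lam * variation 2 * (c * c * vol) + lam * (lam * (c * m) * vol))
     + 2 * (lam * variation 3 * (2 * (c * (lam * m)) * vol)) + 4 * (lam * variation 2 * (2 * (c * (lam * m)) * vol))"
    by (intro add_mono mult_left_mono B1 B2 B3 B4 B5 B6 B7 B8 B9 B10 B11 B12) simp_all
  also have "\<dots> = c * c * vol * (lam * (variation 4 + 4 * variation 3 + 2 * variation 2)) +
      c * m * vol * (lam * lam * (8 * variation 3 + 2 * variation 2 * variation 2 + 20 * variation 2 + 2))"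
    by (simp add: algebra_simps)
  finally show "expectation (\<lambda>\<omega>. (U \<omega>)\<^sup>2) - (expectation U)\<^sup>2 \<le>
      c * c * vol * (lam * (variation 4 + 4 * variation 3 + 2 * variation 2)) +
      c * m * vol * (lam * lam * (8 * variation 3 + 2 * variation 2 * variation 2 + 20 * variation 2 + 2))" .
qed

end

end

section \<open>Geometry of the window and the edge correction\<close>

lemma measure_lborel_affine:
  fixes S :: "'a::euclidean_space set"
  assumes "compact S"
  shows "measure lborel ((\<lambda>x. a + m *\<^sub>R x) ` S) = \<bar>m\<bar> ^ DIM('a) * measure lborel S"
proof -
  have "compact ((\<lambda>x. a + m *\<^sub>R x) ` S)" by (intro compact_continuous_image continuous_intros assms)
  then have "(\<lambda>x. a + m *\<^sub>R x) ` S \<in> sets borel" "S \<in> sets borel" using assms by (auto intro: borel_compact)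
  moreover have "(\<lambda>x. a + m *\<^sub>R x) ` S = (\<lambda>x. m *\<^sub>R x + a) ` S" by (simp add: add.commute)
  ultimately show ?thesis
    using measure_lebesgue_affine[of m a S] by (simp add: measure_completion)
qed

text \<open>The set covariogram, the volume of the intersection of \<open>W\<close> with its
  translate by \<open>-z\<close>. The integral form makes it measurable in \<open>z\<close>.\<close>

definition covariogram :: "'a::euclidean_space set \<Rightarrow> 'a \<Rightarrow> real" where
  "covariogram W z = (\<integral>x. indicator W x * indicator W (x + z) \<partial>lborel)"

text \<open>Not the full erosion by a ball of radius \<open>s\<close> but a homothetic copy of
  \<open>W\<close> inside it, whose volume is explicit.\<close>

definition eroded :: "'a::euclidean_space set \<Rightarrow> 'a \<Rightarrow> real \<Rightarrow> real \<Rightarrow> 'a set" where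
  "eroded W x0 \<rho> s = (\<lambda>w. x0 + (1 - s / \<rho>) *\<^sub>R (w - x0)) ` W"

definition edge_weight :: "'a::euclidean_space set \<Rightarrow> 'a set \<Rightarrow> 'a \<times> 'a \<Rightarrow> real" where
  "edge_weight W D p = indicator W (fst p) * indicator W (snd p) * indicator D (snd p - fst p) / covariogram W (snd p - fst p)"

definition edge_marginal :: "'a::euclidean_space set \<Rightarrow> 'a set \<Rightarrow> 'a \<Rightarrow> real" where
  "edge_marginal W D x = (\<integral>y. indicator W y * edge_weight W D (x, y) \<partial>lborel)"

context
  fixes W :: "'a::euclidean_space set"
  assumes W: "compact W"
begin

lemma window_measure_facts: "W \<in> sets borel" "emeasure lborel W < \<infinity>" "bounded W"
  using W borel_compact emeasure_bounded_finite compact_imp_bounded by blast+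

lemma shift_preimage_borel: "(\<lambda>x. x + z) -` W \<in> sets borel"
  using measurable_sets[of "\<lambda>x. x + z" borel borel W] window_measure_facts(1) by simp

lemma covariogram_eq: "covariogram W z = measure lborel {x \<in> W. x + z \<in> W}"
proof -
  have e: "{x \<in> W. x + z \<in> W} = W \<inter> (\<lambda>x. x + z) -` W" by auto
  have "covariogram W z = (\<integral>x. indicator {x \<in> W. x + z \<in> W} x \<partial>lborel)"
    unfolding covariogram_def by (intro Bochner_Integration.integral_cong) (auto simp: indicator_def)
  then show ?thesis unfolding e using window_measure_facts shift_preimage_borel by simp
qed

lemma covariogram_set: "{x \<in> W. x + z \<in> W} \<in> sets borel" "emeasure lborel {x \<in> W. x + z \<in> W} < \<infinity>"
proof -
  have e: "{x \<in> W. x + z \<in> W} = W \<inter> (\<lambda>x. x + z) -` W" by auto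
  show "{x \<in> W. x + z \<in> W} \<in> sets borel" unfolding e using window_measure_facts shift_preimage_borel by simp
  show "emeasure lborel {x \<in> W. x + z \<in> W} < \<infinity>"
    using window_measure_facts by (intro le_less_trans[OF emeasure_mono window_measure_facts(2)]) auto
qed

lemma covariogram_nonneg: "0 \<le> covariogram W z"
  unfolding covariogram_eq by simp

lemma covariogram_le: "covariogram W z \<le> measure lborel W"
  unfolding covariogram_eq using window_measure_facts by (intro measure_mono_fmeasurable) (auto simp: fmeasurable_def covariogram_set)

text \<open>The intersection of the two shifted windows is the translate by \<open>-x\<close> of the
  set whose volume is the covariogram at \<open>y - x\<close>.\<close>

lemma measure_shift_Int: "measure lborel ((\<lambda>u. u - x) ` W \<inter> (\<lambda>u. u - y) ` W) = covariogram W (y - x)"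
proof -
  have e: "(\<lambda>u. u - x) ` W \<inter> (\<lambda>u. u - y) ` W = (\<lambda>u. (-x) + 1 *\<^sub>R u) ` {v \<in> W. v + (y - x) \<in> W}"
    by (auto simp: image_iff algebra_simps) (metis add.commute add_diff_cancel_left' diff_add_cancel)+
  have "compact {v \<in> W. v + (y - x) \<in> W}"
  proof -
    have "{v \<in> W. v + (y - x) \<in> W} = W \<inter> (\<lambda>v. v + (y - x)) -` W" by auto
    moreover have "closed ((\<lambda>v. v + (y - x)) -` W)"
      by (intro continuous_closed_vimage compact_imp_closed W) (auto intro!: continuous_intros)
    ultimately show ?thesis using compact_Int_closed[OF W] by simp
  qed
  from measure_lborel_affine[OF this, of "-x" 1] show ?thesis unfolding e covariogram_eq by simp
qed

lemma covariogram_sym: "covariogram W (- z) = covariogram W z"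
  using measure_shift_Int[of 0 z] measure_shift_Int[of z 0] by (simp add: Int_commute)

lemma covariogram_measurable [measurable]: "covariogram W \<in> borel_measurable borel"
proof -
  note [measurable] = window_measure_facts(1)
  have "(\<lambda>z. \<integral>x. indicator W x * indicator W (x + z) \<partial>lborel :: real) \<in> borel_measurable borel"
    by (rule lborel.borel_measurable_lebesgue_integral) measurable
  then show ?thesis by (simp add: covariogram_def[abs_def])
qed

text \<open>With \<open>e = s / \<rho>\<close> the shifted point is the convex combination of
  \<open>w\<close> with weight \<open>1 - e\<close> and of \<open>x0 + (1 / e) *\<^sub>R z\<close>
  with weight \<open>e\<close>; the latter lies in the inscribed ball since
  \<open>norm z \<le> s\<close>. For \<open>e = 0\<close> the shift itself is zero.\<close>

lemma erosion:
  assumes cv: "convex W" and x0: "cball x0 \<rho> \<subseteq> W" "x0 \<in> W" and s: "0 \<le> s" "s < \<rho>"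
    and z: "norm z \<le> s" and w: "w \<in> W"
  shows "(x0 + (1 - s / \<rho>) *\<^sub>R (w - x0)) + z \<in> W" "x0 + (1 - s / \<rho>) *\<^sub>R (w - x0) \<in> W"
proof -
  define e where "e = s / \<rho>"
  have e: "0 \<le> e" "e < 1" using s by (auto simp: e_def)
  have in1: "(1 - e) *\<^sub>R w + e *\<^sub>R (x0 + (1 / e) *\<^sub>R v) \<in> W" if "norm v \<le> s" "e \<noteq> 0" for v
  proof (rule convexD[OF cv w])
    have "norm ((1 / e) *\<^sub>R v) = norm v / e" using e by simp
    also have "\<dots> \<le> s / e" using that e by (intro divide_right_mono) auto
    also have "s / e = \<rho>" using that s by (auto simp: e_def)
    finally show "x0 + (1 / e) *\<^sub>R v \<in> W" using x0 by (auto simp: dist_norm)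
  qed (use e in auto)
  have main: "(x0 + (1 - e) *\<^sub>R (w - x0)) + v \<in> W" if "norm v \<le> s" for v
  proof (cases "e = 0")
    case True
    then have "s = 0" using s by (auto simp: e_def)
    then show ?thesis using that w True by simp
  next
    case False
    have "(x0 + (1 - e) *\<^sub>R (w - x0)) + v = (1 - e) *\<^sub>R w + e *\<^sub>R (x0 + (1 / e) *\<^sub>R v)"
      using False by (simp add: algebra_simps)
    then show ?thesis using in1[OF that False] by simp
  qed
  show "(x0 + (1 - s / \<rho>) *\<^sub>R (w - x0)) + z \<in> W" using main[OF z] by (simp add: e_def)
  show "x0 + (1 - s / \<rho>) *\<^sub>R (w - x0) \<in> W" using main[of 0] s by (simp add: e_def)
qed

section \<open>A contracted copy of the window and the volume ratio \<open>\<kappa>\<close>\<close>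

context
  fixes x0 :: 'a and \<rho> s \<kappa> :: real
  assumes cv: "convex W" and x0: "cball x0 \<rho> \<subseteq> W" "x0 \<in> W" and s: "0 \<le> s" "s < \<rho>"
    and \<kappa>_def: "\<kappa> = (1 - s / \<rho>) ^ DIM('a)"
begin

lemma erosion_factor_bounds: "0 < \<kappa>" "\<kappa> \<le> 1"
  using s unfolding \<kappa>_def by (auto intro!: power_le_one)

lemma eroded_facts:
  shows "eroded W x0 \<rho> s \<subseteq> W" "eroded W x0 \<rho> s \<in> sets borel" "measure lborel (eroded W x0 \<rho> s) = \<kappa> * measure lborel W"
    and "\<And>x z. x \<in> eroded W x0 \<rho> s \<Longrightarrow> norm z \<le> s \<Longrightarrow> x + z \<in> W"
proof -
  show "eroded W x0 \<rho> s \<subseteq> W" using erosion(2)[OF cv x0 s, of 0] s by (auto simp: eroded_def)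
  show "x + z \<in> W" if "x \<in> eroded W x0 \<rho> s" "norm z \<le> s" for x z
    using erosion(1)[OF cv x0 s that(2)] that(1) by (auto simp: eroded_def)
  have e: "eroded W x0 \<rho> s = (\<lambda>w. (x0 - (1 - s / \<rho>) *\<^sub>R x0) + (1 - s / \<rho>) *\<^sub>R w) ` W"
    unfolding eroded_def by (intro image_cong refl) (simp add: algebra_simps)
  have "compact (eroded W x0 \<rho> s)" unfolding e by (intro compact_continuous_image continuous_intros W)
  then show "eroded W x0 \<rho> s \<in> sets borel" by (rule borel_compact)
  show "measure lborel (eroded W x0 \<rho> s) = \<kappa> * measure lborel W"
    unfolding e measure_lborel_affine[OF W] \<kappa>_def using s by (simp add: abs_of_nonneg)
qed

lemma volume_pos: "0 < measure lborel W"
proof -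
  have "interior W \<noteq> {}" using x0 s by (metis ball_subset_cball centre_in_ball empty_iff interior_maximal open_ball order.strict_trans1 order_trans subsetD)
  then have "0 < emeasure lborel (interior W)"
    using open_not_negligible[of "interior W"]
    by (simp add: negligible_iff_null_sets null_sets_completion_iff null_sets_def zero_less_iff_neq_zero)
  also have "\<dots> \<le> emeasure lborel W" using window_measure_facts by (intro emeasure_mono interior_subset) auto
  finally show ?thesis using window_measure_facts(2) by (simp add: measure_def enn2real_positive_iff)
qed

text \<open>The contracted copy, of volume \<open>\<kappa> * measure lborel W\<close>, remains in
  the window under every shift of norm at most \<open>s\<close>. Hence denominators of the estimator
  are bounded away from zero.\<close>

lemma covariogram_ge:
  assumes "norm z \<le> s" shows "\<kappa> * measure lborel W \<le> covariogram W z"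
proof -
  have "measure lborel (eroded W x0 \<rho> s) \<le> measure lborel {x \<in> W. x + z \<in> W}"
    using eroded_facts assms covariogram_set by (intro measure_mono_fmeasurable) (auto simp: fmeasurable_def)
  then show ?thesis by (simp add: eroded_facts covariogram_eq)
qed

section \<open>The edge-corrected weight and its marginal\<close>

context
  fixes D :: "'a set"
  assumes D: "compact D" "uminus ` D = D" "D \<subseteq> cball 0 s"
begin

private abbreviation V :: real where "V \<equiv> measure lborel W"

lemma kernel_measure_facts: "D \<in> sets borel" "emeasure lborel D < \<infinity>"
  using D(1) borel_compact emeasure_bounded_finite compact_imp_bounded by blast+

lemma kernel_minus: "- z \<in> D \<longleftrightarrow> z \<in> D"
  using D(2) by (metis (no_types, lifting) image_iff minus_minus)

lemma kernel_norm: "z \<in> D \<Longrightarrow> norm z \<le> s"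
  using D(3) by auto

lemma edge_weight_bounds: "0 \<le> edge_weight W D p" "edge_weight W D p \<le> 1 / (\<kappa> * V)"
  "edge_weight W D p \<le> indicator D (snd p - fst p) / (\<kappa> * V)"
proof -
  have kV: "0 < \<kappa> * V" using erosion_factor_bounds volume_pos by simp
  show "0 \<le> edge_weight W D p" by (simp add: edge_weight_def covariogram_nonneg)
  show *: "edge_weight W D p \<le> indicator D (snd p - fst p) / (\<kappa> * V)"
  proof (cases "snd p - fst p \<in> D")
    case True
    then have "1 / covariogram W (snd p - fst p) \<le> 1 / (\<kappa> * V)"
      using covariogram_ge[OF kernel_norm[OF True]] kV by (intro divide_left_mono) auto
    moreover have "edge_weight W D p \<le> 1 / covariogram W (snd p - fst p)"
      unfolding edge_weight_def by (intro divide_right_mono covariogram_nonneg) (auto simp: indicator_def)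
    ultimately show ?thesis using True by simp
  qed (simp add: edge_weight_def)
  also have "\<dots> \<le> 1 / (\<kappa> * V)" using kV by (intro divide_right_mono) (auto simp: indicator_def)
  finally show "edge_weight W D p \<le> 1 / (\<kappa> * V)" .
qed

lemma edge_weight_sym: "edge_weight W D (x, y) = edge_weight W D (y, x)"
  using covariogram_sym[of "y - x"] kernel_minus[of "y - x"] by (auto simp: edge_weight_def indicator_def)

lemma edge_weight_borel: "bounded_borel (edge_weight W D)"
proof (rule bounded_borelI)
  note [measurable] = window_measure_facts(1) kernel_measure_facts(1)
  show "edge_weight W D \<in> borel_measurable borel"
    unfolding edge_weight_def[abs_def] borel_prod[symmetric] by measurable
  show "\<bar>edge_weight W D p\<bar> \<le> 1 / (\<kappa> * V)" for p using edge_weight_bounds[of p] by simp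
qed

lemma integral_D_shift: "(\<integral>y. indicator D (y - x) \<partial>lborel) = measure lborel D" "integrable lborel (\<lambda>y. indicator D (y - x) :: real)"
proof -
  have e: "(\<lambda>y. indicator D (y - x) :: real) = indicator ((\<lambda>d. x + 1 *\<^sub>R d) ` D)"
    by (auto simp: indicator_def fun_eq_iff intro: image_eqI[of _ _ "_ - x"])
  have c: "compact ((\<lambda>d. x + 1 *\<^sub>R d) ` D)" by (intro compact_continuous_image continuous_intros D)
  then have "(\<lambda>d. x + 1 *\<^sub>R d) ` D \<in> sets borel" "emeasure lborel ((\<lambda>d. x + 1 *\<^sub>R d) ` D) < \<infinity>"
    using borel_compact emeasure_bounded_finite compact_imp_bounded by blast+
  then show "(\<integral>y. indicator D (y - x) \<partial>lborel) = measure lborel D" "integrable lborel (\<lambda>y. indicator D (y - x) :: real)"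
    unfolding e using measure_lborel_affine[OF D(1), of x 1] by simp_all
qed

lemma integrable_edge_weight: "integrable lborel (\<lambda>y. indicator W y * edge_weight W D (x, y))"
proof (rule Bochner_Integration.integrable_bound)
  show "integrable lborel (\<lambda>y. indicator W y * (1 / (\<kappa> * V)))" using window_measure_facts by simp
  show "(\<lambda>y. indicator W y * edge_weight W D (x, y)) \<in> borel_measurable lborel"
    using window_measure_facts(1) bounded_borel_Pair[OF edge_weight_borel, of x] by auto
  show "AE y in lborel. norm (indicator W y * edge_weight W D (x, y)) \<le> norm (indicator W y * (1 / (\<kappa> * V)))"
  proof (rule AE_I2)
    fix y
    have "\<bar>edge_weight W D (x, y)\<bar> \<le> \<bar>1 / (\<kappa> * V)\<bar>" using edge_weight_bounds(1,2)[of "(x, y)"] by linarith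
    then show "norm (indicator W y * edge_weight W D (x, y)) \<le> norm (indicator W y * (1 / (\<kappa> * V)))"
      unfolding real_norm_def abs_mult by (rule mult_left_mono) simp
  qed
qed

lemma edge_marginal_le: "edge_marginal W D x \<le> measure lborel D / (\<kappa> * V)"
proof -
  have "edge_marginal W D x \<le> (\<integral>y. indicator D (y - x) / (\<kappa> * V) \<partial>lborel)"
    unfolding edge_marginal_def
  proof (rule integral_mono[OF integrable_edge_weight])
    show "integrable lborel (\<lambda>y. indicator D (y - x) / (\<kappa> * V))" using integral_D_shift(2) by simp
    fix y
    show "indicator W y * edge_weight W D (x, y) \<le> indicator D (y - x) / (\<kappa> * V)"
      using edge_weight_bounds[of "(x, y)"] erosion_factor_bounds volume_pos by (auto simp: indicator_def split: if_splits)
  qed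
  then show ?thesis using integral_D_shift(1)[of x] by simp
qed

lemma edge_marginal_nonneg: "0 \<le> edge_marginal W D x"
  unfolding edge_marginal_def using edge_weight_bounds by (intro Bochner_Integration.integral_nonneg) auto

text \<open>From a point of the contracted copy no displacement in \<open>D\<close> leaves the
  window, and each weight is at least the reciprocal volume because the covariogram never exceeds
  the volume.\<close>

lemma edge_marginal_ge:
  assumes "x \<in> eroded W x0 \<rho> s" shows "measure lborel D / V \<le> edge_marginal W D x"
proof -
  have "(\<integral>y. indicator D (y - x) / V \<partial>lborel) \<le> edge_marginal W D x"
    unfolding edge_marginal_def
  proof (rule integral_mono[OF _ integrable_edge_weight])
    show "integrable lborel (\<lambda>y. indicator D (y - x) / V)" using integral_D_shift(2) by simp
    fix y
    show "indicator D (y - x) / V \<le> indicator W y * edge_weight W D (x, y)"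
    proof (cases "y - x \<in> D")
      case True
      then have "x \<in> W" "y \<in> W" using eroded_facts(1) eroded_facts(4)[OF assms kernel_norm[OF True]] assms by auto
      moreover have "0 < covariogram W (y - x)"
        using covariogram_ge[OF kernel_norm[OF True]] erosion_factor_bounds volume_pos by (meson less_le_trans mult_pos_pos)
      ultimately show ?thesis
        using True covariogram_le[of "y - x"] volume_pos by (simp add: edge_weight_def frac_le)
    qed (use edge_weight_bounds in simp)
  qed
  then show ?thesis using integral_D_shift(1)[of x] by simp
qed

text \<open>On the contracted copy the marginal lies between \<open>|D| / V\<close> and
  \<open>|D| / (\<kappa> V)\<close>. Elsewhere the deviation is at most
  \<open>|D| / (\<kappa> V)\<close>, but on a set of volume \<open>(1 - \<kappa>) V\<close> only.
  The bound vanishes relative to \<open>|D|\<close> as \<open>\<kappa>\<close> tends to 1.\<close>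

lemma edge_marginal_L1:
  "(\<integral>x. indicator W x * \<bar>edge_marginal W D x - measure lborel D / V\<bar> \<partial>lborel) \<le> 2 * measure lborel D * (1 / \<kappa> - 1)"
proof -
  let ?d = "measure lborel D" and ?k = "\<kappa>"
  have V0: "0 < V" and k: "0 < ?k" "?k \<le> 1" using volume_pos erosion_factor_bounds by auto
  have le: "?d / V \<le> ?d / (?k * V)" using V0 k by (intro divide_left_mono) (auto simp: mult_left_le_one_le)
  let ?h = "\<lambda>x. indicator W x * (?d / (?k * V) - ?d / V) + (indicator W x - indicator (eroded W x0 \<rho> s) x) * (?d / V)"
  have int: "integrable lborel (\<lambda>x. indicator W x :: real)" "integrable lborel (\<lambda>x. indicator (eroded W x0 \<rho> s) x :: real)"
    using window_measure_facts eroded_facts le_less_trans[OF emeasure_mono[OF eroded_facts(1)] window_measure_facts(2)] by auto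
  have "(\<integral>x. indicator W x * \<bar>edge_marginal W D x - ?d / V\<bar> \<partial>lborel) \<le> (\<integral>x. ?h x \<partial>lborel)"
  proof (rule integral_mono')
    show "integrable lborel ?h" using int by (intro Bochner_Integration.integrable_add integrable_mult_left Bochner_Integration.integrable_diff)
    fix x
    have d0: "0 \<le> ?d / V" using V0 by simp
    show "indicator W x * \<bar>edge_marginal W D x - ?d / V\<bar> \<le> ?h x"
    proof (cases "x \<in> eroded W x0 \<rho> s")
      case True
      then have "x \<in> W" using eroded_facts(1) by auto
      then show ?thesis using True edge_marginal_ge[OF True] edge_marginal_le[of x] by simp
    next
      case False
      have "\<bar>edge_marginal W D x - ?d / V\<bar> \<le> ?d / (?k * V)"
        using edge_marginal_le[of x] edge_marginal_nonneg[of x] le d0 by linarith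
      then show ?thesis using False by (cases "x \<in> W") simp_all
    qed
    show "0 \<le> ?h x" using le d0 eroded_facts(1) by (auto simp: indicator_def)
  qed
  also have "\<dots> = V * (?d / (?k * V) - ?d / V) + (V - ?k * V) * (?d / V)"
    using int window_measure_facts eroded_facts by (subst Bochner_Integration.integral_add) (auto simp: algebra_simps)
  also have "\<dots> = ?d * (1 / ?k - 1) + ?d * (1 - ?k)" using V0 k by (simp add: field_simps)
  also have "\<dots> \<le> ?d * (1 / ?k - 1) + ?d * (1 / ?k - 1)"
  proof (intro add_left_mono mult_left_mono)
    have "0 \<le> (1 - ?k)\<^sup>2 / ?k" using k by simp
    also have "(1 - ?k)\<^sup>2 / ?k = (1 / ?k - 1) - (1 - ?k)" using k by (simp add: field_simps power2_eq_square)
    finally show "1 - ?k \<le> 1 / ?k - 1" by simp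
  qed simp
  finally show ?thesis by simp
qed

end

end

end

section \<open>The estimator on a single window\<close>

lemma (in point_process) measure_atom_measure:
  assumes "W \<in> sets borel"
  shows "measure (atom_measure X J \<omega>) W = real (card (pts W \<omega>))"
  unfolding measure_def emeasure_atom_measure[OF assms]
  by (cases "finite (pts W \<omega>)") (simp_all add: ennreal_of_nat_eq_real_of_nat)

context point_process
begin

context
  fixes W B :: "'a set" and R :: real
  assumes W: "compact W" and D: "compact ((*\<^sub>R) R ` B)"
begin

private abbreviation (input) "pair_weight \<equiv> edge_weight W ((*\<^sub>R) R ` B)"

lemma K_estimator_eq_infsum:
  "K_estimator X J B W R \<omega> = (\<Sum>\<^sub>\<infinity>t\<in>distinct2 (J \<omega>). pair_weight (X2 t \<omega>))"
proof -
  have "{(i, j). i \<in> J \<omega> \<and> j \<in> J \<omega> \<and> i \<noteq> j} = distinct2 (J \<omega>)" by (auto simp: distinct2_def)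
  then show ?thesis
    unfolding K_estimator_def
    by (auto simp: edge_weight_def X2_def measure_shift_Int[OF W] case_prod_beta' intro!: infsum_cong)
qed

lemma pair_weight_nonneg: "0 \<le> pair_weight p"
  by (simp add: edge_weight_def covariogram_nonneg[OF W])

lemma pair_weight_measurable: "pair_weight \<in> borel_measurable borel"
proof -
  note [measurable] = window_measure_facts(1)[OF W] borel_compact[OF D] covariogram_measurable[OF W]
  show ?thesis unfolding edge_weight_def[abs_def] borel_prod[symmetric] by measurable
qed

lemma K_estimator_AE:
  "AE \<omega> in M. K_estimator X J B W R \<omega> = (\<Sum>t\<in>distinct2 (pts W \<omega>). pair_weight (X2 t \<omega>))"
  using AE_finite_pts[OF window_measure_facts(3)[OF W]]
proof eventually_elim
  case (elim \<omega>)
  have "K_estimator X J B W R \<omega> = (\<Sum>\<^sub>\<infinity>t\<in>distinct2 (pts W \<omega>). pair_weight (X2 t \<omega>))"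
    unfolding K_estimator_eq_infsum
    by (rule infsum_cong_neutral) (auto simp: distinct2_def pts_def edge_weight_def X2_def indicator_def)
  then show ?case using finite_distinct(1)[OF elim] by simp
qed

text \<open>Both sides are 0 in the absence of summability, so the estimator is measurable even on the null set
  where the point pattern is not locally finite.\<close>

lemma infsum_eq_integral_count_space:
  fixes f :: "'t \<Rightarrow> real"
  shows "infsum f A = (\<integral>t. f t \<partial>count_space A)"
proof (cases "integrable (count_space A) f")
  case True
  then have "Infinite_Set_Sum.abs_summable_on f A" by (simp add: abs_summable_on_def)
  from infsetsum_infsum[OF this] show ?thesis by (simp add: infsetsum_def)
next
  case False
  then have "\<not> Infinite_Set_Sum.abs_summable_on f A" by (simp add: abs_summable_on_def)
  then have "\<not> f summable_on A"
    using summable_on_iff_abs_summable_on_real[of f A] abs_summable_equivalent[of f A] by blast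
  then show ?thesis using False by (simp add: infsum_not_exists not_integrable_integral_eq)
qed

lemma K_estimator_measurable: "K_estimator X J B W R \<in> borel_measurable M"
proof -
  interpret C: sigma_finite_measure "count_space (UNIV :: (nat \<times> nat) set)"
    by (rule sigma_finite_measure_count_space_countable) simp
  have eq: "K_estimator X J B W R \<omega> = (\<integral>t. indicator (distinct2 (J \<omega>)) t * pair_weight (X2 t \<omega>) \<partial>count_space UNIV)" for \<omega>
    unfolding K_estimator_eq_infsum infsum_eq_integral_count_space[symmetric]
    by (rule infsum_cong_neutral) (auto simp: indicator_def)
  note [measurable] = pair_weight_measurable
  have [measurable]: "Measurable.pred M (\<lambda>\<omega>. t \<in> distinct2 (J \<omega>))" for t
    by (cases t) (simp add: distinct2_def)
  have m: "(\<lambda>\<omega>. indicator (distinct2 (J \<omega>)) t * pair_weight (X2 t \<omega>)) \<in> borel_measurable M" for t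
    unfolding indicator_def by measurable
  have "(\<lambda>(\<omega>, t). indicator (distinct2 (J \<omega>)) t * pair_weight (X2 t \<omega>)) \<in> borel_measurable (M \<Otimes>\<^sub>M count_space UNIV)"
  proof -
    have "(\<lambda>(t, \<omega>). indicator (distinct2 (J \<omega>)) t * pair_weight (X2 t \<omega>)) \<in> borel_measurable (count_space UNIV \<Otimes>\<^sub>M M)"
      using m by (intro measurable_pair_measure_countable1) auto
    from measurable_pair_swap[OF this] show ?thesis by (simp add: case_prod_beta')
  qed
  then have "(\<lambda>\<omega>. \<integral>t. indicator (distinct2 (J \<omega>)) t * pair_weight (X2 t \<omega>) \<partial>count_space UNIV) \<in> borel_measurable M"
    by (rule C.borel_measurable_lebesgue_integral)
  then show ?thesis by (simp add: eq[abs_def] cong: measurable_cong)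
qed

end

end

section \<open>Mean and mean square error of the estimator\<close>

context B4_process
begin

lemma K_function_reduced2:
  assumes D: "compact ((*\<^sub>R) R ` B)"
  shows "lam\<^sup>2 * K_function M X J B R = lam * measure reduced2 ((*\<^sub>R) R ` B)"
proof -
  have "measure reduced2 ((*\<^sub>R) R ` B) = measure (reduced_moment M X J 2) (\<Pi>\<^sub>E l\<in>{1..<2}. (*\<^sub>R) R ` B)"
    unfolding measure_def using emeasure_reduced2[OF pos borel_compact[OF D]] by simp
  then show ?thesis using pos by (simp add: K_function_def power2_eq_square)
qed

text \<open>\<open>double_sum_const\<close> and \<open>mixed_const\<close> are the coefficients of
  \<open>c * c * vol\<close> and \<open>c * m * vol\<close> in
  \<open>variance_projected_double_sum\<close>.\<close>

definition double_sum_const :: real where "double_sum_const = lam * (variation 4 + 4 * variation 3 + 2 * variation 2)"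
definition mixed_const :: real where "mixed_const = lam * lam * (8 * variation 3 + 2 * variation 2 * variation 2 + 20 * variation 2 + 2)"
text \<open>The factor 8 collects a 2 from the uniform bound on \<open>q\<close>, a 2 from its mean
  bound and a 2 from \<open>edge_marginal_L1\<close>; the first two each come with a factor
  \<open>lam\<close>.\<close>

definition linear_const :: real where "linear_const = 8 * lam\<^sup>2 * (lam * (variation 2 + 1))"

context
  fixes W B :: "'a set" and R :: real and x0 :: 'a and \<rho> s \<kappa> :: real
  assumes W: "compact W" and cv: "convex W" and x0: "cball x0 \<rho> \<subseteq> W" "x0 \<in> W" and s: "0 \<le> s" "s < \<rho>"
    and \<kappa>_def: "\<kappa> = (1 - s / \<rho>) ^ DIM('a)"
    and D: "compact ((*\<^sub>R) R ` B)" "uminus ` (*\<^sub>R) R ` B = (*\<^sub>R) R ` B" "(*\<^sub>R) R ` B \<subseteq> cball 0 s"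
begin

private abbreviation (input) "D \<equiv> (*\<^sub>R) R ` B"
private abbreviation (input) "w \<equiv> edge_weight W D"
private abbreviation (input) "v \<equiv> measure lborel W"

lemmas window_assms = W cv x0 s \<kappa>_def
lemmas window_bounded_borel = window_measure_facts(3,1)[OF W]

text \<open>For a fixed difference \<open>z\<close> the base points with both points in the window
  have volume \<open>covariogram W z\<close>, which the edge correction cancels exactly. This needs
  a positive covariogram on \<open>D\<close>, which follows from \<open>s < \<rho>\<close>.\<close>

lemma mean_K_estimator: "avg2 W w = lam * measure reduced2 D"
proof -
  note wm = pair_weight_measurable[OF W D(1)] and wn = pair_weight_nonneg[OF W D(1)]
  have wb: "bounded_borel w" by (rule edge_weight_borel[OF window_assms D])
  have inner: "(\<integral>\<^sup>+x. ennreal (w (z + x, x)) \<partial>lborel) = indicator D z" for z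
  proof -
    have wz: "w (z + x, x) = indicator {x \<in> W. x + z \<in> W} x * (indicator D z / covariogram W z)" for x
      using covariogram_sym[OF W, of z] kernel_minus[OF window_assms D, of z]
      by (auto simp: edge_weight_def indicator_def add.commute)
    have c0: "0 < covariogram W z" if "z \<in> D"
      using covariogram_ge[OF window_assms kernel_norm[OF window_assms D that]] erosion_factor_bounds[OF window_assms] volume_pos[OF window_assms]
      by (meson less_le_trans mult_pos_pos)
    have "(\<integral>\<^sup>+x. ennreal (w (z + x, x)) \<partial>lborel) =
        (\<integral>\<^sup>+x. ennreal (indicator D z / covariogram W z) * indicator {x \<in> W. x + z \<in> W} x \<partial>lborel)"
      unfolding wz by (intro nn_integral_cong) (auto simp: indicator_def)
    also have "\<dots> = ennreal (indicator D z / covariogram W z) * emeasure lborel {x \<in> W. x + z \<in> W}"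
      using covariogram_set[OF W] by (subst nn_integral_cmult_indicator) auto
    also have "emeasure lborel {x \<in> W. x + z \<in> W} = ennreal (covariogram W z)"
      unfolding covariogram_eq[OF W] using covariogram_set[OF W, of z] by (simp add: emeasure_eq_ennreal_measure less_top)
    also have "ennreal (indicator D z / covariogram W z) * ennreal (covariogram W z) = indicator D z"
      using c0 by (cases "z \<in> D") (auto simp: ennreal_mult''[symmetric] less_imp_le)
    finally show ?thesis .
  qed
  have int: "integrable M (\<lambda>\<omega>. \<Sum>t\<in>distinct2 (pts W \<omega>). w (X2 t \<omega>))" by (rule integrable_random_sums(2)[OF window_bounded_borel wb])
  have "ennreal (avg2 W w) = (\<integral>\<^sup>+\<omega>. ennreal (\<Sum>t\<in>distinct2 (pts W \<omega>). w (X2 t \<omega>)) \<partial>M)"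
    unfolding avg2_def by (rule nn_integral_eq_integral[OF int, symmetric]) (simp add: sum_nonneg wn)
  also have "\<dots> = (\<integral>\<^sup>+\<omega>. (\<integral>\<^sup>+t. ennreal (w (X2 t \<omega>)) \<partial>count_space (distinct2 (J \<omega>))) \<partial>M)"
  proof (rule nn_integral_cong_AE)
    show "AE \<omega> in M. ennreal (\<Sum>t\<in>distinct2 (pts W \<omega>). w (X2 t \<omega>)) = (\<integral>\<^sup>+t. ennreal (w (X2 t \<omega>)) \<partial>count_space (distinct2 (J \<omega>)))"
      using AE_finite_pts[OF window_bounded_borel(1)]
    proof eventually_elim
      case (elim \<omega>)
      have "(\<integral>\<^sup>+t. ennreal (w (X2 t \<omega>)) \<partial>count_space (distinct2 (J \<omega>))) = (\<Sum>t\<in>distinct2 (pts W \<omega>). ennreal (w (X2 t \<omega>)))"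
        by (rule nn_integral_count_space'[OF finite_distinct(1)[OF elim]])
           (auto simp: distinct2_def pts_def edge_weight_def X2_def indicator_def)
      then show ?case by (simp add: sum_ennreal wn)
    qed
  qed
  also have "\<dots> = (\<integral>\<^sup>+p. ennreal (w p) \<partial>moment2)"
    using wm by (intro nn_integral_moment2[symmetric]) measurable
  also have "\<dots> = ennreal lam * (\<integral>\<^sup>+z. (\<integral>\<^sup>+x. ennreal (w (z + x, x)) \<partial>lborel) \<partial>reduced2)"
    using wm by (intro nn_integral_moment2_reduced2[OF pos]) measurable
  also have "(\<integral>\<^sup>+z. (\<integral>\<^sup>+x. ennreal (w (z + x, x)) \<partial>lborel) \<partial>reduced2) = (\<integral>\<^sup>+z. indicator D z \<partial>reduced2)"
    by (intro nn_integral_cong inner)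
  also have "ennreal lam * (\<integral>\<^sup>+z. indicator D z \<partial>reduced2) = ennreal lam * emeasure reduced2 D"
    using borel_compact[OF D(1)] by simp
  finally have eq: "ennreal (avg2 W w) = ennreal lam * emeasure reduced2 D" .
  have "0 \<le> avg2 W w" unfolding avg2_def by (intro Bochner_Integration.integral_nonneg sum_nonneg wn)
  then have "avg2 W w = enn2real (ennreal lam * emeasure reduced2 D)" by (simp flip: eq)
  then show ?thesis using pos by (simp add: enn2real_mult measure_def)
qed

text \<open>The error splits into two centred parts: the projected double sum \<open>U\<close>, and
  the linear statistic \<open>S\<close> whose weight \<open>q\<close> is the projection weight minus
  its interior value \<open>h\<close>. The inequality \<open>(a + b)^2 \<le> 2 a^2 + 2 b^2\<close>
  separates their variances and gives the leading factor 2.\<close>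

lemma K_estimator_L2:
  defines "d \<equiv> measure lborel D"
  defines "Z \<equiv> \<lambda>\<omega>. K_estimator X J B W R \<omega> - lam\<^sup>2 * K_function M X J B R
      - (2 * lam * d / v) * (measure (atom_measure X J \<omega>) W - lam * v)"
  shows "integrable M (\<lambda>\<omega>. (Z \<omega>)\<^sup>2)"
    and "expectation (\<lambda>\<omega>. (Z \<omega>)\<^sup>2) \<le> 2 * (double_sum_const / (\<kappa>\<^sup>2 * v) + mixed_const * d / (\<kappa>\<^sup>2 * v) + linear_const * d\<^sup>2 / (\<kappa> * v) * (1 / \<kappa> - 1))"
proof -
  define c where "c = 1 / (\<kappa> * v)"
  define m where "m = d / (\<kappa> * v)"
  define h where "h = 2 * lam * d / v"
  have k: "0 < \<kappa>" "\<kappa> \<le> 1" and v0: "0 < v" and d0: "0 \<le> d" using erosion_factor_bounds[OF window_assms] volume_pos[OF window_assms] by (auto simp: d_def)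
  have wb: "bounded_borel w" by (rule edge_weight_borel[OF window_assms D])
  have wm: "(\<integral>y. indicator W y * w (x, y) \<partial>lborel) \<le> m" for x
    using edge_marginal_le[OF window_assms D, of x] by (simp add: edge_marginal_def m_def d_def)
  have wc: "w q \<le> c" "0 \<le> w q" for q using edge_weight_bounds[OF window_assms D, of q] by (auto simp: c_def)
  define p where "p x = 2 * g1 W (\<lambda>y. w (x, y))" for x
  define U where "U \<omega> = (\<Sum>t\<in>distinct2 (pts W \<omega>). w (X2 t \<omega>)) - (\<Sum>t\<in>pts W \<omega>. p (X t \<omega>))" for \<omega>
  note vp = variance_projected_double_sum[OF window_bounded_borel wb edge_weight_sym[OF window_assms D] wc(2) wc(1) wm, folded p_def, folded U_def]
  define q where "q x = p x - h" for x
  have p_eq: "p x = 2 * lam * edge_marginal W D x" for x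
    by (simp add: p_def g1_def edge_marginal_def)
  have bq: "bounded_borel q" unfolding q_def[abs_def] by (intro bounded_borel_diff vp(1) bounded_borel_const)
  have dm: "d / v \<le> m" unfolding m_def using k v0 d0 by (intro divide_left_mono) (auto simp: mult_left_le_one_le)
  have q_eq: "q x = 2 * lam * (edge_marginal W D x - d / v)" for x by (simp add: q_def p_eq h_def algebra_simps)
  have qQ: "\<bar>q x\<bar> \<le> 2 * lam * m" for x
  proof -
    have "0 \<le> d / v" using d0 v0 by simp
    moreover have "0 \<le> edge_marginal W D x" "edge_marginal W D x \<le> m"
      using edge_marginal_nonneg[OF window_assms D] edge_marginal_le[OF window_assms D] by (auto simp: m_def d_def)
    ultimately have "\<bar>edge_marginal W D x - d / v\<bar> \<le> m" using dm by linarith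
    then show ?thesis unfolding q_eq abs_mult using pos by simp
  qed
  define S where "S \<omega> = (\<Sum>t\<in>pts W \<omega>. q (X t \<omega>))" for \<omega>
  note vq = variance_linear_statistic[OF window_bounded_borel bq qQ, folded S_def]
  have L1: "(\<integral>x. indicator W x * \<bar>q x\<bar> \<partial>lborel) \<le> 2 * lam * (2 * d * (1 / \<kappa> - 1))"
  proof -
    have "(\<integral>x. indicator W x * \<bar>q x\<bar> \<partial>lborel) = 2 * lam * (\<integral>x. indicator W x * \<bar>edge_marginal W D x - d / v\<bar> \<partial>lborel)"
    proof -
      have "indicator W x * \<bar>q x\<bar> = 2 * lam * (indicator W x * \<bar>edge_marginal W D x - d / v\<bar>)" for x
        using pos by (simp add: q_eq abs_mult)
      then show ?thesis by (simp only: integral_mult_right_zero)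
    qed
    also have "\<dots> \<le> 2 * lam * (2 * d * (1 / \<kappa> - 1))"
      using edge_marginal_L1[OF window_assms D] pos by (intro mult_left_mono) (auto simp: d_def)
    finally show ?thesis .
  qed
  have Eq: "expectation S = g1 W p - h * lam * v"
  proof -
    have "expectation S = g1 W q" by (rule vq)
    also have "\<dots> = g1 W p + g1 W (\<lambda>_. - h)"
      using bounded_functionalD(1)[OF measure_functional_imp_bounded[OF measure_functional_g(1)[OF window_bounded_borel]] vp(1) bounded_borel_const[of "-h"]]
      by (simp add: q_def[abs_def])
    also have "g1 W (\<lambda>_. - h) = - (h * lam * v)"
      using window_measure_facts[OF W] by (simp add: g1_def)
    finally show ?thesis by simp
  qed
  have EU: "expectation U = lam\<^sup>2 * K_function M X J B R - g1 W p"
  proof -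
    have "expectation U = avg2 W w - avg1 W p"
      unfolding U_def avg2_def avg1_def
      using integrable_random_sums(2)[OF window_bounded_borel wb] integrable_random_sums(1)[OF window_bounded_borel vp(1)] by simp
    then show ?thesis by (simp add: mean_K_estimator avg1_decomposition[OF window_bounded_borel vp(1)] K_function_reduced2[OF D(1)])
  qed
  \<comment> \<open>The projection weight \<open>p\<close> drops out of both the sum and the means:
    what remains is the estimator minus \<open>h\<close> times the count, centred.\<close>
  let ?Y = "\<lambda>\<omega>. (U \<omega> - expectation U) + (S \<omega> - expectation S)"
  have ae: "AE \<omega> in M. ?Y \<omega> = Z \<omega>"
    using K_estimator_AE[OF W D(1)]
  proof eventually_elim
    case (elim \<omega>)
    have "S \<omega> = (\<Sum>t\<in>pts W \<omega>. p (X t \<omega>)) - real (card (pts W \<omega>)) * h"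
      by (simp add: S_def q_def sum_subtractf)
    moreover have "U \<omega> = K_estimator X J B W R \<omega> - (\<Sum>t\<in>pts W \<omega>. p (X t \<omega>))"
      using elim by (simp add: U_def)
    ultimately show ?case
      by (simp add: Z_def EU Eq measure_atom_measure[OF window_bounded_borel(2)] h_def algebra_simps)
  qed
  have sqU: "integrable M (\<lambda>\<omega>. (U \<omega> - expectation U)\<^sup>2)"
    using vp(2,3) by (simp add: power2_diff)
  have sqS: "integrable M (\<lambda>\<omega>. (S \<omega> - expectation S)\<^sup>2)"
    using vq(1,2) by (simp add: power2_diff)
  have mZ: "Z \<in> borel_measurable M"
    unfolding Z_def measure_atom_measure[OF window_bounded_borel(2)] using card_pts_measurable[OF window_bounded_borel(2)] K_estimator_measurable[OF W D(1)] by measurable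
  have mY: "?Y \<in> borel_measurable M" using vp(2) vq(1) by auto
  have bnd: "(a + b)\<^sup>2 \<le> 2 * a\<^sup>2 + 2 * b\<^sup>2" for a b :: real
    using sum_squares_bound[of a b] by (simp add: power2_sum)
  have intb: "integrable M (\<lambda>\<omega>. 2 * (U \<omega> - expectation U)\<^sup>2 + 2 * (S \<omega> - expectation S)\<^sup>2)"
    using sqU sqS by simp
  have intY: "integrable M (\<lambda>\<omega>. (?Y \<omega>)\<^sup>2)"
    by (rule Bochner_Integration.integrable_bound[OF intb]) (use mY bnd in \<open>auto intro!: AE_I2\<close>)
  show "integrable M (\<lambda>\<omega>. (Z \<omega>)\<^sup>2)"
    by (rule integrable_cong_AE_imp[OF intY]) (use mZ ae in auto)
  have "expectation (\<lambda>\<omega>. (Z \<omega>)\<^sup>2) = expectation (\<lambda>\<omega>. (?Y \<omega>)\<^sup>2)"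
    using mZ mY ae by (intro integral_cong_AE) (auto elim: eventually_mono)
  also have "\<dots> \<le> expectation (\<lambda>\<omega>. 2 * (U \<omega> - expectation U)\<^sup>2 + 2 * (S \<omega> - expectation S)\<^sup>2)"
    by (intro integral_mono intY intb bnd)
  also have "\<dots> = 2 * variance U + 2 * variance S" using sqU sqS by simp
  also have "variance U = expectation (\<lambda>\<omega>. (U \<omega>)\<^sup>2) - (expectation U)\<^sup>2" by (rule variance_eq[OF vp(2,3)])
  also have "variance S = expectation (\<lambda>\<omega>. (S \<omega>)\<^sup>2) - (expectation S)\<^sup>2" by (rule variance_eq[OF vq(1,2)])
  also have "2 * (expectation (\<lambda>\<omega>. (U \<omega>)\<^sup>2) - (expectation U)\<^sup>2) + 2 * (expectation (\<lambda>\<omega>. (S \<omega>)\<^sup>2) - (expectation S)\<^sup>2) \<le>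
      2 * (c * c * v * double_sum_const + c * m * v * mixed_const) + 2 * (lam * (variation 2 + 1) * (2 * lam * m) * (2 * lam * (2 * d * (1 / \<kappa> - 1))))"
  proof (intro add_mono mult_left_mono)
    show "expectation (\<lambda>\<omega>. (U \<omega>)\<^sup>2) - (expectation U)\<^sup>2 \<le> c * c * v * double_sum_const + c * m * v * mixed_const"
      using vp(4) by (simp only: double_sum_const_def mixed_const_def)
    have "0 \<le> lam * (variation 2 + 1) * (2 * lam * m)"
      using pos variation_nonneg[of 2] k v0 d0 by (simp add: m_def)
    from order_trans[OF vq(4) mult_left_mono[OF L1 this]]
    show "expectation (\<lambda>\<omega>. (S \<omega>)\<^sup>2) - (expectation S)\<^sup>2 \<le> lam * (variation 2 + 1) * (2 * lam * m) * (2 * lam * (2 * d * (1 / \<kappa> - 1)))" .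
  qed simp_all
  also have "\<dots> = 2 * (double_sum_const / (\<kappa>\<^sup>2 * v) + mixed_const * d / (\<kappa>\<^sup>2 * v) + linear_const * d\<^sup>2 / (\<kappa> * v) * (1 / \<kappa> - 1))"
  proof -
    have e1: "c * c * v * double_sum_const = double_sum_const / (\<kappa>\<^sup>2 * v)" "c * m * v * mixed_const = mixed_const * d / (\<kappa>\<^sup>2 * v)"
      using k v0 by (simp_all add: c_def m_def power2_eq_square mult_ac)
    have e2: "lam * (variation 2 + 1) * (2 * lam * m) * (2 * lam * (2 * d * (1 / \<kappa> - 1))) = linear_const * d\<^sup>2 / (\<kappa> * v) * (1 / \<kappa> - 1)"
    proof -
      have "lam * (variation 2 + 1) * (2 * lam * m) * (2 * lam * (2 * d * e)) = linear_const * d * m * e" for e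
        by (simp add: linear_const_def power2_eq_square algebra_simps)
      then have "lam * (variation 2 + 1) * (2 * lam * m) * (2 * lam * (2 * d * (1 / \<kappa> - 1))) = linear_const * d * m * (1 / \<kappa> - 1)" .
      moreover have "linear_const * d * m = linear_const * d\<^sup>2 / (\<kappa> * v)" by (simp add: m_def power2_eq_square)
      ultimately show ?thesis by (simp only:)
    qed
    show ?thesis unfolding e1 e2 by simp
  qed
  finally show "expectation (\<lambda>\<omega>. (Z \<omega>)\<^sup>2) \<le> 2 * (double_sum_const / (\<kappa>\<^sup>2 * v) + mixed_const * d / (\<kappa>\<^sup>2 * v) + linear_const * d\<^sup>2 / (\<kappa> * v) * (1 / \<kappa> - 1))" .
qed

end

end

section \<open>A Slutsky theorem\<close>

lemma centered_normal_sets [simp, measurable_cong]: "sets (centered_normal v) = sets borel"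
  by (simp add: centered_normal_def)

lemma real_distribution_centered_normal: "real_distribution (centered_normal v)"
  unfolding centered_normal_def
proof -
  interpret real_distribution std_normal_distribution by (rule real_dist_normal_dist)
  show "real_distribution (distr std_normal_distribution borel (\<lambda>z. sqrt v * z))"
    by (rule real_distribution_distr) simp
qed

text \<open>A continuous bounded \<open>f\<close> need not be uniformly continuous, so the
  comparison is made on a compact ball. The exceptional events are \<open>?A n\<close>, where the
  difference is large, and large values of \<open>Y n\<close>, controlled by tightness that is
  extracted from the weak convergence.\<close>

lemma slutsky_vector:
  fixes T :: "nat \<Rightarrow> 'w \<Rightarrow> 'b::euclidean_space" and Y :: "nat \<Rightarrow> 'w \<Rightarrow> real" and u :: 'b
  assumes M: "prob_space M" and Y[measurable]: "\<And>n. Y n \<in> borel_measurable M"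
    and T[measurable]: "\<And>n. T n \<in> borel_measurable M"
    and L: "real_distribution L" and wc: "weak_conv_m (\<lambda>n. distr M borel (Y n)) L"
    and small: "\<And>\<delta>. \<delta> > 0 \<Longrightarrow> (\<lambda>n. measure M {\<omega> \<in> space M. norm (T n \<omega> - Y n \<omega> *\<^sub>R u) > \<delta>}) \<longlonglongrightarrow> 0"
    and f: "continuous_on UNIV f" and bd: "\<And>x. \<bar>f x :: real\<bar> \<le> C"
  shows "(\<lambda>n. integral\<^sup>L (distr M borel (T n)) f) \<longlonglongrightarrow> integral\<^sup>L (distr L borel (\<lambda>z. z *\<^sub>R u)) f"
proof -
  interpret prob_space M by fact
  interpret L: real_distribution L by fact
  have d: "real_distribution (distr M borel (Y n))" for n by (rule real_distribution_distr) measurable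
  have [measurable]: "f \<in> borel_measurable borel" using f by (rule borel_measurable_continuous_onI)
  have C0: "0 \<le> C" using bd[of undefined] by linarith
  have conv: "(\<lambda>n. expectation (\<lambda>\<omega>. g (Y n \<omega>))) \<longlonglongrightarrow> integral\<^sup>L L g"
    if g: "continuous_on UNIV g" "\<And>x. \<bar>g x\<bar> \<le> K" for g :: "real \<Rightarrow> real" and K
  proof -
    have [measurable]: "g \<in> borel_measurable borel" using g(1) by (rule borel_measurable_continuous_onI)
    have "(\<lambda>n. integral\<^sup>L (distr M borel (Y n)) g) \<longlonglongrightarrow> integral\<^sup>L L g"
      by (rule weak_conv_imp_integral_bdd_continuous_conv[OF d L wc, where B=K])
         (use g in \<open>auto simp: continuous_on_eq_continuous_at\<close>)
    then show ?thesis by (simp add: integral_distr)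
  qed
  have cu: "continuous_on UNIV (\<lambda>z. f (z *\<^sub>R u))"
    by (rule continuous_on_compose2[OF f]) (auto intro!: continuous_intros)
  have main: "(\<lambda>n. expectation (\<lambda>\<omega>. f (Y n \<omega> *\<^sub>R u))) \<longlonglongrightarrow> integral\<^sup>L L (\<lambda>z. f (z *\<^sub>R u))"
    by (rule conv[OF cu bd])
  have diff: "(\<lambda>n. expectation (\<lambda>\<omega>. f (T n \<omega>)) - expectation (\<lambda>\<omega>. f (Y n \<omega> *\<^sub>R u))) \<longlonglongrightarrow> 0"
  proof (rule LIMSEQ_I)
    fix e :: real assume e: "0 < e"
    \<comment> \<open>Two exceptional terms cost \<open>2 * C * \<eta>\<close> each, together less
      than \<open>e / 2\<close>; the remaining \<open>e / 4\<close> comes from uniform continuity.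
      The \<open>+ 1\<close> guards against \<open>C = 0\<close>.\<close>
    define \<eta> where "\<eta> = e / (8 * (C + 1))"
    have \<eta>: "0 < \<eta>" using e C0 by (simp add: \<eta>_def)
    \<comment> \<open>A continuous cutoff, 1 on \<open>[-k, k]\<close> and 0 outside
      \<open>[-k-1, k+1]\<close>. Being continuous, it transfers the tightness of \<open>L\<close>
      to the laws of \<open>Y n\<close>.\<close>
    define \<phi> where "\<phi> k y = max 0 (min 1 (real k + 1 - \<bar>y\<bar>))" for k :: nat and y :: real
    have \<phi>c: "continuous_on UNIV (\<phi> k)" for k unfolding \<phi>_def by (intro continuous_intros)
    have \<phi>b: "\<bar>\<phi> k y\<bar> \<le> 1" "0 \<le> \<phi> k y" for k y by (auto simp: \<phi>_def)
    have [measurable]: "\<phi> k \<in> borel_measurable borel" for k using \<phi>c by (rule borel_measurable_continuous_onI)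
    have "(\<lambda>k. integral\<^sup>L L (\<phi> k)) \<longlonglongrightarrow> integral\<^sup>L L (\<lambda>_. 1)"
    proof (rule integral_dominated_convergence[where w="\<lambda>_. 1"])
      show "AE y in L. (\<lambda>k. \<phi> k y) \<longlonglongrightarrow> 1"
      proof (rule AE_I2)
        fix y :: real
        obtain k0 :: nat where k0: "\<bar>y\<bar> < real k0" using reals_Archimedean2 by blast
        have "\<phi> k y = 1" if "k \<ge> k0" for k
        proof -
          have "\<bar>y\<bar> < real k" using k0 that by (meson less_le_trans of_nat_le_iff)
          then show ?thesis by (simp add: \<phi>_def)
        qed
        then show "(\<lambda>k. \<phi> k y) \<longlonglongrightarrow> 1" by (intro tendsto_eventually eventually_sequentiallyI)
      qed
    qed (use \<phi>b in auto)
    then have "(\<lambda>k. integral\<^sup>L L (\<phi> k)) \<longlonglongrightarrow> 1" using L.prob_space by simp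
    then have "eventually (\<lambda>k. 1 - \<eta> < integral\<^sup>L L (\<phi> k)) sequentially"
      by (rule order_tendstoD(1)) (use \<eta> in simp)
    then obtain k where k: "1 - \<eta> < integral\<^sup>L L (\<phi> k)" by (auto simp: eventually_sequentially)
    have ev1: "eventually (\<lambda>n. 1 - \<eta> < expectation (\<lambda>\<omega>. \<phi> k (Y n \<omega>))) sequentially"
      by (rule order_tendstoD(1)[OF conv[OF \<phi>c \<phi>b(1)] k])
    \<comment> \<open>The radius allows for \<open>\<bar>Y n \<omega>\<bar> \<le> k + 1\<close>; the
      extra 1 leaves room for \<open>T n \<omega>\<close>, as
      \<open>\<delta> \<le> 1\<close>.\<close>
    let ?K = "cball 0 ((real k + 1) * norm u + 1) :: 'b set"
    have "uniformly_continuous_on ?K f"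
      by (intro compact_uniformly_continuous continuous_on_subset[OF f]) auto
    then obtain \<delta>0 where \<delta>0: "0 < \<delta>0" "\<And>x y. x \<in> ?K \<Longrightarrow> y \<in> ?K \<Longrightarrow> dist y x < \<delta>0 \<Longrightarrow> dist (f y) (f x) < e / 4"
      using e unfolding uniformly_continuous_on_def by (metis zero_less_divide_iff zero_less_numeral)
    define \<delta> where "\<delta> = min 1 (\<delta>0 / 2)"
    have \<delta>: "0 < \<delta>" "\<delta> \<le> 1" "\<delta> < \<delta>0" using \<delta>0 by (auto simp: \<delta>_def)
    let ?A = "\<lambda>n. {\<omega> \<in> space M. norm (T n \<omega> - Y n \<omega> *\<^sub>R u) > \<delta>}"
    have ev2: "eventually (\<lambda>n. measure M (?A n) < \<eta>) sequentially"
      using order_tendstoD(2)[OF small[OF \<delta>(1)] \<eta>] .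
    have A[measurable]: "?A n \<in> sets M" for n by measurable
    have pt: "\<bar>f (T n \<omega>) - f (Y n \<omega> *\<^sub>R u)\<bar> \<le> e / 4 + 2 * C * indicator (?A n) \<omega> + 2 * C * (1 - \<phi> k (Y n \<omega>))"
      if \<omega>: "\<omega> \<in> space M" for n \<omega>
    proof -
      have two: "\<bar>f (T n \<omega>) - f (Y n \<omega> *\<^sub>R u)\<bar> \<le> 2 * C" using bd[of "T n \<omega>"] bd[of "Y n \<omega> *\<^sub>R u"] by linarith
      have nn: "0 \<le> 2 * C * (1 - \<phi> k (Y n \<omega>))" using C0 \<phi>b[of k "Y n \<omega>"] by (intro mult_nonneg_nonneg) auto
      consider "\<omega> \<in> ?A n" | "\<bar>Y n \<omega>\<bar> > real k + 1" | "\<omega> \<notin> ?A n" "\<bar>Y n \<omega>\<bar> \<le> real k + 1" by linarith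
      then show ?thesis
      proof cases
        case 1 then show ?thesis using two nn e by simp
      next
        case 2
        then have "\<phi> k (Y n \<omega>) = 0" by (simp add: \<phi>_def)
        then show ?thesis using two e C0 by (simp add: indicator_def)
      next
        case 3
        then have n1: "norm (T n \<omega> - Y n \<omega> *\<^sub>R u) \<le> \<delta>" using \<omega> by auto
        have n2: "norm (Y n \<omega> *\<^sub>R u) \<le> (real k + 1) * norm u" using 3 by (simp add: mult_right_mono)
        have "norm (T n \<omega>) \<le> norm (T n \<omega> - Y n \<omega> *\<^sub>R u) + norm (Y n \<omega> *\<^sub>R u)"
          using norm_triangle_ineq[of "T n \<omega> - Y n \<omega> *\<^sub>R u" "Y n \<omega> *\<^sub>R u"] by simp
        then have "T n \<omega> \<in> ?K" "Y n \<omega> *\<^sub>R u \<in> ?K" using n1 n2 \<delta> by auto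
        moreover have "dist (T n \<omega>) (Y n \<omega> *\<^sub>R u) < \<delta>0" using n1 \<delta> by (simp add: dist_norm)
        ultimately have "dist (f (T n \<omega>)) (f (Y n \<omega> *\<^sub>R u)) < e / 4" using \<delta>0(2) by blast
        then show ?thesis using nn C0 by (simp add: dist_real_def indicator_def)
      qed
    qed
    have int1: "integrable M (\<lambda>\<omega>. f (T n \<omega>))" "integrable M (\<lambda>\<omega>. f (Y n \<omega> *\<^sub>R u))" for n
      by (rule integrable_const_bound[of _ C]; use bd in simp)+
    have int2: "integrable M (\<lambda>\<omega>. \<phi> k (Y n \<omega>))" for n
      by (rule integrable_const_bound[of _ 1]) (use \<phi>b in auto)
    have int3: "integrable M (\<lambda>\<omega>. indicator (?A n) \<omega> :: real)" for n
      by (rule integrable_const_bound[of _ 1]) (auto simp: indicator_def)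
    from ev1 ev2 have "eventually (\<lambda>n. norm ((expectation (\<lambda>\<omega>. f (T n \<omega>)) - expectation (\<lambda>\<omega>. f (Y n \<omega> *\<^sub>R u))) - 0) < e) sequentially"
    proof eventually_elim
      case (elim n)
      have "\<bar>expectation (\<lambda>\<omega>. f (T n \<omega>)) - expectation (\<lambda>\<omega>. f (Y n \<omega> *\<^sub>R u))\<bar> = \<bar>expectation (\<lambda>\<omega>. f (T n \<omega>) - f (Y n \<omega> *\<^sub>R u))\<bar>"
        using int1 by simp
      also have "\<dots> \<le> expectation (\<lambda>\<omega>. e / 4 + 2 * C * indicator (?A n) \<omega> + 2 * C * (1 - \<phi> k (Y n \<omega>)))"
        using int2[of n] int3[of n] by (intro abs_integral_le pt) auto
      also have "\<dots> = e / 4 + 2 * C * measure M (?A n) + 2 * C * (1 - expectation (\<lambda>\<omega>. \<phi> k (Y n \<omega>)))"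
        using int2[of n] int3[of n] by (simp add: prob_space)
      also have "\<dots> \<le> e / 4 + 2 * C * \<eta> + 2 * C * \<eta>"
        using elim C0 by (intro add_mono mult_left_mono) auto
      also have "\<dots> < e"
      proof -
        have "4 * C * \<eta> < e / 2" using e C0 by (simp add: \<eta>_def field_simps)
        then show ?thesis using e by linarith
      qed
      finally have "\<bar>expectation (\<lambda>\<omega>. f (T n \<omega>)) - expectation (\<lambda>\<omega>. f (Y n \<omega> *\<^sub>R u))\<bar> < e" .
      then show ?case by simp
    qed
    then show "\<exists>no. \<forall>n\<ge>no. norm ((expectation (\<lambda>\<omega>. f (T n \<omega>)) - expectation (\<lambda>\<omega>. f (Y n \<omega> *\<^sub>R u))) - 0) < e"
      by (auto simp: eventually_sequentially)
  qed
  have "(\<lambda>n. expectation (\<lambda>\<omega>. f (T n \<omega>))) \<longlonglongrightarrow> integral\<^sup>L L (\<lambda>z. f (z *\<^sub>R u))"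
    using tendsto_add[OF diff main] by simp
  then show ?thesis by (simp add: integral_distr)
qed

lemma (in prob_space) prob_norm_greater_le:
  fixes D :: "'a \<Rightarrow> 'b::euclidean_space"
  assumes [measurable]: "D \<in> borel_measurable M" and int: "integrable M (\<lambda>\<omega>. (norm (D \<omega>))\<^sup>2)" and \<delta>: "0 < \<delta>"
  shows "measure M {\<omega> \<in> space M. norm (D \<omega>) > \<delta>} \<le> expectation (\<lambda>\<omega>. (norm (D \<omega>))\<^sup>2) / \<delta>\<^sup>2"
proof -
  let ?A = "{\<omega> \<in> space M. norm (D \<omega>) > \<delta>}"
  have A: "?A \<in> sets M" by measurable
  have "\<delta>\<^sup>2 * measure M ?A = expectation (\<lambda>\<omega>. \<delta>\<^sup>2 * indicator ?A \<omega>)" using A by simp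
  also have "\<dots> \<le> expectation (\<lambda>\<omega>. (norm (D \<omega>))\<^sup>2)"
  proof (rule integral_mono[OF _ int])
    show "integrable M (\<lambda>\<omega>. \<delta>\<^sup>2 * indicator ?A \<omega> :: real)" using A by (auto intro!: integrable_mult_right simp: emeasure_eq_measure)
    fix \<omega>
    show "\<delta>\<^sup>2 * indicator ?A \<omega> \<le> (norm (D \<omega>))\<^sup>2"
      using \<delta> by (auto simp: indicator_def intro!: power_mono)
  qed
  finally show ?thesis using \<delta> by (simp add: field_simps)
qed

section \<open>Growing windows\<close>

text \<open>\<open>Sup {}\<close> is an unspecified real; an inradius above it certifies that some ball fits.\<close>

lemma inradius_ball:
  fixes W :: "'a::euclidean_space set"
  assumes "inradius W > Sup {}" "inradius W > 0"
  obtains x0 where "x0 \<in> W" "cball x0 (inradius W / 2) \<subseteq> W"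
proof -
  let ?S = "{r. 0 < r \<and> (\<exists>x\<in>W. cball x r \<subseteq> W)}"
  have "?S \<noteq> {}" using assms(1) unfolding inradius_def by force
  moreover have "inradius W / 2 < Sup ?S" using assms(2) unfolding inradius_def[symmetric] by simp
  ultimately obtain r where "r \<in> ?S" "inradius W / 2 < r" by (rule less_cSupD[THEN bexE]) auto
  then obtain x0 where "x0 \<in> W" "cball x0 r \<subseteq> W" "inradius W / 2 < r" by auto
  moreover from this have "cball x0 (inradius W / 2) \<subseteq> W" by (meson less_imp_le order_trans subset_cball)
  ultimately show ?thesis using that by blast
qed

locale window_sequence =
  fixes W :: "nat \<Rightarrow> 'a::euclidean_space set"
  assumes averaging: "convex_averaging W"
begin

lemma window_compact: "compact (W n)" and window_convex: "convex (W n)"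
  using averaging by (auto simp: convex_averaging_def)

lemma inradius_at_top: "filterlim (\<lambda>n. inradius (W n)) at_top sequentially"
  using averaging by (simp add: convex_averaging_def)

text \<open>Half the inradius is strictly below the supremum, hence exceeded by the radius of some
  inscribed ball.\<close>

lemma eventually_inradius:
  "eventually (\<lambda>n. inradius (W n) > 0 \<and> (\<exists>x0\<in>W n. cball x0 (inradius (W n) / 2) \<subseteq> W n)) sequentially"
proof -
  have "eventually (\<lambda>n. inradius (W n) > max 0 (Sup {})) sequentially"
    using inradius_at_top[unfolded filterlim_at_top_dense, rule_format, of "max 0 (Sup {})"] .
  then show ?thesis
  proof eventually_elim
    case (elim n)
    then show ?case using inradius_ball[of "W n"] by (auto simp: max_def split: if_splits)
  qed
qed

text \<open>The window contains a ball of half the inradius. Once that radius is at least 1, i.e.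
  the inradius at least 2, its power of order \<open>DIM('a)\<close> dominates it, and a bound
  linear in the inradius suffices.\<close>

lemma volume_at_top: "filterlim (\<lambda>n. measure lborel (W n)) at_top sequentially"
proof -
  define b where "b = measure lborel (cball (0::'a) 1)"
  have b: "0 < b" unfolding b_def
    by (rule volume_pos[of "cball 0 1" 0 1 0 1]) auto
  have "filterlim (\<lambda>n. b / 2 * inradius (W n)) at_top sequentially"
    using b by (intro filterlim_tendsto_pos_mult_at_top[OF tendsto_const _ inradius_at_top]) simp
  moreover have "eventually (\<lambda>n. b / 2 * inradius (W n) \<le> measure lborel (W n)) sequentially"
    using eventually_inradius inradius_at_top[unfolded filterlim_at_top, rule_format, of 2]
  proof eventually_elim
    case (elim n)
    let ?\<rho> = "inradius (W n) / 2"
    obtain x0 where x0: "cball x0 ?\<rho> \<subseteq> W n" using elim by auto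
    let ?S = "(\<lambda>x. x0 + ?\<rho> *\<^sub>R x) ` cball (0::'a) 1"
    have S: "compact ?S" by (intro compact_continuous_image continuous_intros compact_cball)
    have "?S \<subseteq> cball x0 ?\<rho>" using elim by (auto simp: dist_norm mult_left_le)
    then have "measure lborel ?S \<le> measure lborel (W n)"
      using x0 window_measure_facts[OF window_compact] borel_compact[OF S] by (intro measure_mono_fmeasurable) (auto simp: fmeasurable_def)
    moreover have "measure lborel ?S = ?\<rho> ^ DIM('a) * b"
      using measure_lborel_affine[of "cball (0::'a) 1" x0 ?\<rho>] elim by (simp add: b_def)
    moreover have "?\<rho> * b \<le> ?\<rho> ^ DIM('a) * b" using elim b by (intro mult_right_mono self_le_power) auto
    ultimately show ?case by (simp add: mult.commute)
  qed
  ultimately show ?thesis by (rule filterlim_at_top_mono)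
qed

end

section \<open>Approximation by the normalised count and the limit theorem\<close>

context B4_process
begin

context
  fixes W :: "nat \<Rightarrow> 'a set" and B :: "'a set" and \<alpha> :: real
  assumes W: "convex_averaging W"
    and B: "compact B" "uminus ` B = B"
    and \<alpha>: "0 < \<alpha>"
    and slow: "(\<lambda>n. window_scale (W n) powr \<alpha> / inradius (W n)) \<longlonglongrightarrow> 0"
begin

interpretation window_sequence W by standard (rule W)

definition count_deviation :: "nat \<Rightarrow> 'w \<Rightarrow> real" where
  "count_deviation n \<omega> = (measure (atom_measure X J \<omega>) (W n) - lam * measure lborel (W n)) / sqrt (measure lborel (W n))"

definition limit_coefficient :: "real \<Rightarrow> real" where
  "limit_coefficient r = 2 * lam * measure lborel B * r ^ DIM('a)"

lemma count_deviation_measurable [measurable]: "count_deviation n \<in> borel_measurable M"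
  unfolding count_deviation_def[abs_def] measure_atom_measure[OF window_measure_facts(1)[OF window_compact]]
  using card_pts_measurable[OF window_measure_facts(1)[OF window_compact], of n] by measurable

lemma scaled_compact: "compact ((*\<^sub>R) R ` B)"
  by (intro compact_continuous_image continuous_intros B)

lemma K_deviation_measurable [measurable]: "K_deviation M X J B \<alpha> (W n) r \<in> borel_measurable M"
proof -
  note [measurable] = K_estimator_measurable[OF window_compact scaled_compact]
  show ?thesis unfolding K_deviation_def[abs_def] by measurable
qed

text \<open>With \<open>|D| = V^\<alpha> * \<beta>\<close>, multiplication by
  \<open>V^(1 - 2 \<alpha>)\<close> turns the three terms of \<open>K_estimator_L2\<close> into the
  orders \<open>V^(-2 \<alpha>)\<close>, \<open>V^(-\<alpha>)\<close> and 1. The last tends to 0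
  through the factor \<open>1 / \<kappa> - 1\<close>, and \<open>slow\<close> yields the convergence
  of \<open>\<kappa>\<close> to 1.\<close>

lemma K_deviation_L2:
  assumes r: "0 \<le> r"
  defines "err \<equiv> \<lambda>n \<omega>. K_deviation M X J B \<alpha> (W n) r \<omega> - count_deviation n \<omega> * limit_coefficient r"
  shows "eventually (\<lambda>n. integrable M (\<lambda>\<omega>. (err n \<omega>)\<^sup>2)) sequentially"
    and "(\<lambda>n. expectation (\<lambda>\<omega>. (err n \<omega>)\<^sup>2)) \<longlonglongrightarrow> 0"
proof -
  define V where "V n = measure lborel (W n)" for n
  define c where "c n = window_scale (W n) powr \<alpha>" for n
  define \<rho> where "\<rho> n = inradius (W n) / 2" for n
  obtain b where b: "0 < b" "\<And>x. x \<in> B \<Longrightarrow> norm x \<le> b"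
    using compact_imp_bounded[OF B(1)] by (auto simp: bounded_pos)
  \<comment> \<open>\<open>s n\<close> is the radius of a ball around the origin that contains the
    dilated set; it is eventually below \<open>\<rho> n\<close> by \<open>ratio\<close>.\<close>
  define s where "s n = c n * r * b" for n
  define \<kappa> where "\<kappa> n = (1 - s n / \<rho> n) ^ DIM('a)" for n
  define \<beta> where "\<beta> = r ^ DIM('a) * measure lborel B"
  define bound where "bound n = 2 * (double_sum_const * V n powr (- 2 * \<alpha>) / (\<kappa> n)\<^sup>2 + mixed_const * \<beta> * V n powr (- \<alpha>) / (\<kappa> n)\<^sup>2
     + linear_const * \<beta>\<^sup>2 / \<kappa> n * (1 / \<kappa> n - 1))" for n
  have "(\<lambda>n. 2 * r * b * (window_scale (W n) powr \<alpha> / inradius (W n))) \<longlonglongrightarrow> 2 * r * b * 0"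
    by (intro tendsto_intros slow)
  then have ratio: "(\<lambda>n. s n / \<rho> n) \<longlonglongrightarrow> 0" by (simp add: s_def \<rho>_def c_def field_simps)
  have \<kappa>1: "\<kappa> \<longlonglongrightarrow> 1" unfolding \<kappa>_def[abs_def] using tendsto_power[OF tendsto_diff[OF tendsto_const ratio], of 1] by simp
  have VT: "filterlim V at_top sequentially" using volume_at_top by (simp add: V_def[abs_def])
  have Vp: "(\<lambda>n. V n powr (- 2 * \<alpha>)) \<longlonglongrightarrow> 0" "(\<lambda>n. V n powr (- \<alpha>)) \<longlonglongrightarrow> 0"
    by (rule tendsto_neg_powr[OF _ VT]; use \<alpha> in simp)+
  have "bound \<longlonglongrightarrow> 2 * (double_sum_const * 0 / 1\<^sup>2 + mixed_const * \<beta> * 0 / 1\<^sup>2 + linear_const * \<beta>\<^sup>2 / 1 * (1 / 1 - 1))"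
    unfolding bound_def[abs_def] by (intro tendsto_intros Vp \<kappa>1) simp_all
  then have bound0: "bound \<longlonglongrightarrow> 0" by simp
  have main: "eventually (\<lambda>n. integrable M (\<lambda>\<omega>. (err n \<omega>)\<^sup>2) \<and> expectation (\<lambda>\<omega>. (err n \<omega>)\<^sup>2) \<le> bound n) sequentially"
    using eventually_inradius order_tendstoD(2)[OF ratio zero_less_one] VT[unfolded filterlim_at_top_dense, rule_format, of 0]
  proof eventually_elim
    case (elim n)
    obtain x0 where x0: "cball x0 (\<rho> n) \<subseteq> W n" "x0 \<in> W n" using elim by (auto simp: \<rho>_def)
    have \<rho>0: "0 < \<rho> n" using elim by (simp add: \<rho>_def)
    have V0: "0 < V n" by fact
    have c0: "0 \<le> c n" by (simp add: c_def)
    have s: "0 \<le> s n" "s n < \<rho> n" using r b(1) c0 elim(2) \<rho>0 by (auto simp: s_def)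
    let ?D = "(*\<^sub>R) (c n * r) ` B"
    have D: "compact ?D" "uminus ` ?D = ?D" "?D \<subseteq> cball 0 (s n)"
    proof -
      show "compact ?D" by (rule scaled_compact)
      have "uminus ` ?D = (*\<^sub>R) (c n * r) ` uminus ` B" by (simp add: image_image)
      then show "uminus ` ?D = ?D" by (simp only: B(2))
      show "?D \<subseteq> cball 0 (s n)" using b(2) c0 r by (auto simp: s_def abs_mult intro!: mult_left_mono)
    qed
    have d: "measure lborel ?D = V n powr \<alpha> * \<beta>"
    proof -
      have "measure lborel ?D = (c n * r) ^ DIM('a) * measure lborel B"
        using measure_lborel_affine[OF B(1), of 0 "c n * r"] c0 r by simp
      \<comment> \<open>The window scale is the \<open>DIM('a)\<close>-th root of the volume, so the
        dimension cancels in the exponent.\<close>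
      moreover have "c n ^ DIM('a) = V n powr \<alpha>"
        using V0 by (simp add: c_def window_scale_def V_def[symmetric] powr_powr powr_power)
      ultimately show ?thesis by (simp add: \<beta>_def power_mult_distrib)
    qed
    define Z where "Z \<omega> = K_estimator X J B (W n) (c n * r) \<omega> - lam\<^sup>2 * K_function M X J B (c n * r)
      - (2 * lam * measure lborel ?D / measure lborel (W n)) * (measure (atom_measure X J \<omega>) (W n) - lam * measure lborel (W n))" for \<omega>
    note L2 = K_estimator_L2[OF window_compact window_convex x0 s \<kappa>_def D, folded Z_def V_def, unfolded d]
    have err: "err n \<omega> = V n powr (1 / 2 - \<alpha>) * Z \<omega>" for \<omega>
    proof -
      have p: "V n powr (1 / 2 - \<alpha>) * (V n powr \<alpha>) / V n = 1 / sqrt (V n)"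
      proof -
        have "V n powr (1 / 2 - \<alpha>) * V n powr \<alpha> = sqrt (V n)"
          using V0 by (simp add: powr_add[symmetric] powr_half_sqrt)
        then show ?thesis using V0 by (simp add: field_simps)
      qed
      have q: "V n powr (1 / 2 - \<alpha>) * ((2 * lam * (V n powr \<alpha> * \<beta>) / V n) * y) = y / sqrt (V n) * limit_coefficient r" for y
      proof -
        have "V n powr (1 / 2 - \<alpha>) * ((2 * lam * (V n powr \<alpha> * \<beta>) / V n) * y) = 2 * lam * \<beta> * y * (V n powr (1 / 2 - \<alpha>) * (V n powr \<alpha>) / V n)"
          by simp
        then show ?thesis unfolding p by (simp add: limit_coefficient_def \<beta>_def)
      qed
      show ?thesis
        unfolding err_def K_deviation_def count_deviation_def Z_def V_def[symmetric] c_def[symmetric] d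
        by (simp only: right_diff_distrib[of "V n powr (1 / 2 - \<alpha>)"] q)
    qed
    have sq: "(err n \<omega>)\<^sup>2 = V n powr (1 - 2 * \<alpha>) * (Z \<omega>)\<^sup>2" for \<omega>
      unfolding err power_mult_distrib using V0 by (simp add: power2_eq_square powr_add[symmetric])
    have "expectation (\<lambda>\<omega>. (err n \<omega>)\<^sup>2) = V n powr (1 - 2 * \<alpha>) * expectation (\<lambda>\<omega>. (Z \<omega>)\<^sup>2)"
      unfolding sq by simp
    also have "\<dots> \<le> V n powr (1 - 2 * \<alpha>) * (2 * (double_sum_const / ((\<kappa> n)\<^sup>2 * V n) + mixed_const * (V n powr \<alpha> * \<beta>) / ((\<kappa> n)\<^sup>2 * V n)
        + linear_const * (V n powr \<alpha> * \<beta>)\<^sup>2 / (\<kappa> n * V n) * (1 / \<kappa> n - 1)))"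
      by (intro mult_left_mono L2(2)) simp
    also have "\<dots> = bound n"
    proof -
      have e: "V n powr (1 - 2 * \<alpha>) = V n * V n powr (- 2 * \<alpha>)" "V n powr (- 2 * \<alpha>) * V n powr \<alpha> = V n powr (- \<alpha>)"
        "V n powr (- 2 * \<alpha>) * (V n powr \<alpha>)\<^sup>2 = 1"
        using V0 powr_add[of "V n" 1 "- 2 * \<alpha>"] by (simp_all add: power2_eq_square powr_add[symmetric])
      define k where "k = \<kappa> n"
      define g where "g = 1 / k - 1"
      have "V n powr (1 - 2 * \<alpha>) * (2 * (double_sum_const / (k\<^sup>2 * V n) + mixed_const * (V n powr \<alpha> * \<beta>) / (k\<^sup>2 * V n) + linear_const * (V n powr \<alpha> * \<beta>)\<^sup>2 / (k * V n) * g))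
        = 2 * (double_sum_const * V n powr (- 2 * \<alpha>) / k\<^sup>2 + mixed_const * \<beta> * (V n powr (- 2 * \<alpha>) * V n powr \<alpha>) / k\<^sup>2
          + linear_const * \<beta>\<^sup>2 * (V n powr (- 2 * \<alpha>) * (V n powr \<alpha>)\<^sup>2) / k * g)"
        unfolding e(1) using V0 by (simp add: power_mult_distrib distrib_left mult_ac)
      then show ?thesis unfolding e by (simp add: bound_def k_def g_def)
    qed
    finally show ?case using L2(1) by (simp add: sq)
  qed
  show "eventually (\<lambda>n. integrable M (\<lambda>\<omega>. (err n \<omega>)\<^sup>2)) sequentially"
    using main by eventually_elim simp
  show "(\<lambda>n. expectation (\<lambda>\<omega>. (err n \<omega>)\<^sup>2)) \<longlonglongrightarrow> 0"
  proof (rule tendsto_sandwich[OF _ _ tendsto_const bound0])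
    show "eventually (\<lambda>n. 0 \<le> expectation (\<lambda>\<omega>. (err n \<omega>)\<^sup>2)) sequentially" by (intro always_eventually allI Bochner_Integration.integral_nonneg) simp
    show "eventually (\<lambda>n. expectation (\<lambda>\<omega>. (err n \<omega>)\<^sup>2) \<le> bound n) sequentially" using main by eventually_elim simp
  qed
qed

context
  fixes \<sigma> :: real
  assumes clt: "weak_conv_m (\<lambda>n. distr M borel (count_deviation n)) (centered_normal (\<sigma>\<^sup>2))"
begin

text \<open>All coordinates are approximated by multiples of the same scalar
  \<open>count_deviation n\<close>, so the vector is close to this scalar times the fixed vector
  \<open>?u\<close>. The coordinatewise mean square errors add up, and Chebyshev's inequality
  supplies the smallness that \<open>slutsky_vector\<close> asks for.\<close>

lemma K_deviation_joint:
  fixes r :: "real ^ 'k"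
  assumes r: "\<And>i. 0 \<le> r $ i" and f: "continuous_on UNIV f" and bd: "\<And>x. \<bar>f x :: real\<bar> \<le> C"
  shows "(\<lambda>n. integral\<^sup>L (distr M borel (\<lambda>\<omega>. \<chi> i. K_deviation M X J B \<alpha> (W n) (r $ i) \<omega>)) f)
    \<longlonglongrightarrow> integral\<^sup>L (distr (centered_normal (\<sigma>\<^sup>2)) borel (\<lambda>z. \<chi> i. limit_coefficient (r $ i) * z)) f"
proof -
  let ?T = "\<lambda>n \<omega>. \<chi> i. K_deviation M X J B \<alpha> (W n) (r $ i) \<omega>"
  let ?u = "\<chi> i. limit_coefficient (r $ i)"
  have T: "?T n \<in> borel_measurable M" for n
  proof (subst borel_measurable_euclidean_space, intro ballI)
    fix v :: "real ^ 'k" assume "v \<in> Basis"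
    then obtain i where v: "v = axis i 1" by (auto simp: Basis_vec_def)
    show "(\<lambda>\<omega>. ?T n \<omega> \<bullet> v) \<in> borel_measurable M" unfolding v by (simp add: inner_axis)
  qed
  let ?E = "\<lambda>n i \<omega>. K_deviation M X J B \<alpha> (W n) (r $ i) \<omega> - count_deviation n \<omega> * limit_coefficient (r $ i)"
  have nrm: "(norm (?T n \<omega> - count_deviation n \<omega> *\<^sub>R ?u))\<^sup>2 = (\<Sum>i\<in>UNIV. (?E n i \<omega>)\<^sup>2)" for n \<omega>
    by (simp add: norm_vec_def L2_set_def sum_nonneg)
  have small: "(\<lambda>n. measure M {\<omega> \<in> space M. norm (?T n \<omega> - count_deviation n \<omega> *\<^sub>R ?u) > \<delta>}) \<longlonglongrightarrow> 0" if \<delta>: "\<delta> > 0" for \<delta>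
  proof (rule tendsto_sandwich[OF _ _ tendsto_const])
    have "(\<lambda>n. (\<Sum>i\<in>UNIV. expectation (\<lambda>\<omega>. (?E n i \<omega>)\<^sup>2)) / \<delta>\<^sup>2) \<longlonglongrightarrow> (\<Sum>i\<in>(UNIV::'k set). 0) / \<delta>\<^sup>2"
      using \<delta> by (intro tendsto_intros K_deviation_L2(2) r) simp
    then show "(\<lambda>n. (\<Sum>i\<in>UNIV. expectation (\<lambda>\<omega>. (?E n i \<omega>)\<^sup>2)) / \<delta>\<^sup>2) \<longlonglongrightarrow> 0" by simp
    have "eventually (\<lambda>n. \<forall>i. integrable M (\<lambda>\<omega>. (?E n i \<omega>)\<^sup>2)) sequentially"
      by (rule eventually_all_finite) (rule K_deviation_L2(1)[OF r])
    then show "eventually (\<lambda>n. measure M {\<omega> \<in> space M. norm (?T n \<omega> - count_deviation n \<omega> *\<^sub>R ?u) > \<delta>}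
        \<le> (\<Sum>i\<in>UNIV. expectation (\<lambda>\<omega>. (?E n i \<omega>)\<^sup>2)) / \<delta>\<^sup>2) sequentially"
    proof eventually_elim
      case (elim n)
      have "integrable M (\<lambda>\<omega>. (norm (?T n \<omega> - count_deviation n \<omega> *\<^sub>R ?u))\<^sup>2)"
        unfolding nrm using elim by (intro Bochner_Integration.integrable_sum) auto
      from prob_norm_greater_le[OF _ this \<delta>] T
      have "measure M {\<omega> \<in> space M. norm (?T n \<omega> - count_deviation n \<omega> *\<^sub>R ?u) > \<delta>}
          \<le> expectation (\<lambda>\<omega>. (norm (?T n \<omega> - count_deviation n \<omega> *\<^sub>R ?u))\<^sup>2) / \<delta>\<^sup>2" by measurable
      also have "expectation (\<lambda>\<omega>. (norm (?T n \<omega> - count_deviation n \<omega> *\<^sub>R ?u))\<^sup>2) = (\<Sum>i\<in>UNIV. expectation (\<lambda>\<omega>. (?E n i \<omega>)\<^sup>2))"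
        unfolding nrm using elim by (intro Bochner_Integration.integral_sum) auto
      finally show ?case .
    qed
  qed simp
  have "(\<lambda>z. \<chi> i. limit_coefficient (r $ i) * z) = (\<lambda>z. z *\<^sub>R ?u)"
    by (auto simp: vec_eq_iff mult.commute)
  then show ?thesis
    using slutsky_vector[OF prob_space_axioms count_deviation_measurable T real_distribution_centered_normal clt small f bd] by simp
qed

text \<open>The same argument with \<open>slutsky_vector\<close> on the real line; convergence of
  integrals of bounded continuous functions is then converted to \<open>weak_conv_m\<close>.\<close>

lemma K_deviation_single:
  assumes r: "0 \<le> r"
  shows "weak_conv_m (\<lambda>n. distr M borel (K_deviation M X J B \<alpha> (W n) r))
    (distr (centered_normal (\<sigma>\<^sup>2)) borel (\<lambda>z. limit_coefficient r * z))"
proof (rule integral_bdd_continuous_conv_imp_weak_conv)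
  show "real_distribution (distr M borel (K_deviation M X J B \<alpha> (W n) r))" for n
    by (rule real_distribution_distr) measurable
  interpret L: real_distribution "centered_normal (\<sigma>\<^sup>2)" by (rule real_distribution_centered_normal)
  show "real_distribution (distr (centered_normal (\<sigma>\<^sup>2)) borel (\<lambda>z. limit_coefficient r * z))"
    by (rule L.real_distribution_distr) simp
  fix f :: "real \<Rightarrow> real" assume f: "\<And>x. isCont f x" and bd: "\<And>x. \<bar>f x\<bar> \<le> 1"
  have fc: "continuous_on UNIV f" using f by (simp add: continuous_on_eq_continuous_at)
  let ?E = "\<lambda>n \<omega>. K_deviation M X J B \<alpha> (W n) r \<omega> - count_deviation n \<omega> * limit_coefficient r"
  have small: "(\<lambda>n. measure M {\<omega> \<in> space M. norm (K_deviation M X J B \<alpha> (W n) r \<omega> - count_deviation n \<omega> *\<^sub>R limit_coefficient r) > \<delta>}) \<longlonglongrightarrow> 0"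
    if \<delta>: "\<delta> > 0" for \<delta>
  proof (rule tendsto_sandwich[OF _ _ tendsto_const])
    have "(\<lambda>n. expectation (\<lambda>\<omega>. (?E n \<omega>)\<^sup>2) / \<delta>\<^sup>2) \<longlonglongrightarrow> 0 / \<delta>\<^sup>2"
      using \<delta> by (intro tendsto_intros K_deviation_L2(2) r) simp
    then show "(\<lambda>n. expectation (\<lambda>\<omega>. (?E n \<omega>)\<^sup>2) / \<delta>\<^sup>2) \<longlonglongrightarrow> 0" by simp
    show "eventually (\<lambda>n. measure M {\<omega> \<in> space M. norm (K_deviation M X J B \<alpha> (W n) r \<omega> - count_deviation n \<omega> *\<^sub>R limit_coefficient r) > \<delta>}
       \<le> expectation (\<lambda>\<omega>. (?E n \<omega>)\<^sup>2) / \<delta>\<^sup>2) sequentially"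
      using K_deviation_L2(1)[OF r]
    proof eventually_elim
      case (elim n)
      then show ?case using prob_norm_greater_le[of "?E n" \<delta>] \<delta> by simp
    qed
  qed simp
  show "(\<lambda>n. integral\<^sup>L (distr M borel (K_deviation M X J B \<alpha> (W n) r)) f)
     \<longlonglongrightarrow> integral\<^sup>L (distr (centered_normal (\<sigma>\<^sup>2)) borel (\<lambda>z. limit_coefficient r * z)) f"
    using slutsky_vector[OF prob_space_axioms count_deviation_measurable K_deviation_measurable real_distribution_centered_normal clt small fc bd]
    by (simp add: mult.commute)
qed

end

end

end

theorem theorem1:
  fixes M :: "'w measure"
    and X :: "nat \<Rightarrow> 'w \<Rightarrow> 'a::euclidean_space"
    and J :: "'w \<Rightarrow> nat set"
    and W :: "nat \<Rightarrow> 'a set"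
    and B :: "'a set"
    and \<alpha> \<sigma> lam :: real
  assumes "simple_point_process M X J"
    and "B4_mixing M X J"
    and "lam = intensity M X J" and "lam > 0"
    and "convex_averaging W"
    and "compact B" and "convex B" and "uminus ` B = B" and "0 \<in> interior B"
    and "\<sigma>\<^sup>2 = lam * (1 + signed_value (reduced_cumulant M X J 2) (space (tuples 2)))"
    and "weak_conv_m
           (\<lambda>n. distr M borel (\<lambda>\<omega>.
              (measure (atom_measure X J \<omega>) (W n) - lam * measure lborel (W n)) /
              sqrt (measure lborel (W n))))
           (centered_normal (\<sigma>\<^sup>2))"
    and "0 < \<alpha>" and "\<alpha> < 1"
    and "(\<lambda>n. window_scale (W n) powr \<alpha> / inradius (W n)) \<longlonglongrightarrow> 0"
  shows "(\<forall>r\<ge>0.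
            weak_conv_m
              (\<lambda>n. distr M borel (K_deviation M X J B \<alpha> (W n) r))
              (distr (centered_normal (\<sigma>\<^sup>2)) borel
                 (\<lambda>z. 2 * lam * measure lborel B * r ^ DIM('a) * z))) \<and>
         (\<forall>r :: real ^ 'k. (\<forall>i. 0 \<le> r $ i) \<longrightarrow>
            weak_conv_joint
              (\<lambda>n. distr M borel (\<lambda>\<omega>. \<chi> i. K_deviation M X J B \<alpha> (W n) (r $ i) \<omega>))
              (distr (centered_normal (\<sigma>\<^sup>2)) borel
                 (\<lambda>z. \<chi> i. 2 * lam * measure lborel B * (r $ i) ^ DIM('a) * z)))"
proof -
  interpret prob_space M using assms(1) by (simp add: simple_point_process_def)
  interpret B4_process M X J
    by unfold_locales (use assms(1-4) in \<open>auto simp: B4_mixing_def\<close>)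
  note setting = assms(5,6,8,12,14)
  have clt: "weak_conv_m (\<lambda>n. distr M borel (count_deviation W n)) (centered_normal (\<sigma>\<^sup>2))"
    using assms(11) by (simp add: count_deviation_def[OF setting, abs_def] assms(3))
  have c: "limit_coefficient B r = 2 * lam * measure lborel B * r ^ DIM('a)" for r
    by (simp add: limit_coefficient_def[OF setting] assms(3))
  show ?thesis
  proof (intro conjI allI impI)
    fix r :: real assume "0 \<le> r"
    from K_deviation_single[OF setting clt this]
    show "weak_conv_m (\<lambda>n. distr M borel (K_deviation M X J B \<alpha> (W n) r))
              (distr (centered_normal (\<sigma>\<^sup>2)) borel (\<lambda>z. 2 * lam * measure lborel B * r ^ DIM('a) * z))"
      by (simp only: c)
  next
    fix r :: "real ^ 'k" assume r: "\<forall>i. 0 \<le> r $ i"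
    show "weak_conv_joint (\<lambda>n. distr M borel (\<lambda>\<omega>. \<chi> i. K_deviation M X J B \<alpha> (W n) (r $ i) \<omega>))
       (distr (centered_normal (\<sigma>\<^sup>2)) borel (\<lambda>z. \<chi> i. 2 * lam * measure lborel B * (r $ i) ^ DIM('a) * z))"
      unfolding weak_conv_joint_def
    proof (intro allI impI, elim conjE)
      fix f :: "real ^ 'k \<Rightarrow> real" assume f: "continuous_on UNIV f" "bounded (range f)"
      then obtain C where "\<And>x. \<bar>f x\<bar> \<le> C" by (auto simp: bounded_iff)
      from K_deviation_joint[OF setting clt _ f(1) this, of r] r
      show "(\<lambda>n. integral\<^sup>L (distr M borel (\<lambda>\<omega>. \<chi> i. K_deviation M X J B \<alpha> (W n) (r $ i) \<omega>)) f)
         \<longlonglongrightarrow> integral\<^sup>L (distr (centered_normal (\<sigma>\<^sup>2)) borel (\<lambda>z. \<chi> i. 2 * lam * measure lborel B * (r $ i) ^ DIM('a) * z)) f"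
        by (simp only: c simp_thms)
    qed
  qed
qed

end
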